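(* Let $n\ge1$, $z=x+iy\in\Pi$, $w=u+iv\in\Pi$. The reproducing kernel $K^\gamma(z,w)$ of the image of $P$ is given by $$K^\gamma(z,w)=\frac1\pi\int_{\mathbb{R}_+}e^{it(x-u)}\,t\,(\phi_n(t,y),\ \phi_{n-1}(t,y))\begin{pmatrix}1&\phi(t)\\ \phi(t)&[\phi(t)]^2\end{pmatrix}\begin{pmatrix}\phi_n(t,v)\\ \phi_{n-1}(t,v)\end{pmatrix}dt,$$ where $\phi(t)=-1+\sqrt{1-e^{-2t}}$.
   Context: $\mathbb{R}_+=(0,\infty)$; $\Pi=\{z=x+iy: y>0\}$ with Lebesgue area measure. Let $\ell_k(y)=(-1)^k\chi_{\mathbb{R}_+}(y)e^{-y/2}\frac{e^y}{k!}\frac{d^k}{dy^k}(e^{-y}y^k)$, $k=0,1,2,\dots$, $N_m(y)=(\ell_0(y),\dots,\ell_{m-1}(y))^t$, and $$\phi_m(t,y)=\sum_{j=1}^me^{-(j-1)t}\ell_{j-1}(2ty).$$ Let $P_\gamma=\left(\sqrt{\gamma^{a_j}}\sqrt{\gamma^{a_k}}\right)_{j,k=1}^n$ with $\gamma^{a_k}(t)=e^{-2kt}(e^{2t}-1)$ for $1\le k\le n-1$ and $\gamma^{a_n}(t)=e^{-2(n-1)t}$. Let $R_n:L_2(\Pi)\to(L_2(\mathbb{R}_+))^n$ be $(R_n\varphi)(x)=\frac{1}{\sqrt{2\pi}}\int_{\mathbb{R}}e^{-ixt}\int_{\mathbb{R}_+}\varphi(t,r)\sqrt{2x}\,N_n(2xr)\,dr\,dt$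 (Fourier transform in the $L_2$ sense), which maps the poly-Bergman space $\mathcal{A}_n^2(\Pi)$ ($n$-polyanalytic functions in $L_2(\Pi)$, i.e. those in the kernel of $(\partial/\partial\overline z)^n$) unitarily onto $(L_2(\mathbb{R}_+))^n$. $P=R_n^*P_\gamma R_n$ is an orthogonal projection on $\mathcal{A}_n^2(\Pi)$ ($P_\gamma$ acting by multiplication), and $K^\gamma$ is its kernel, $(P f)(z)=\int_\Pi f(u,v)K^\gamma(z,w)\,du\,dv$, namely $$K^\gamma(z,w)=\frac1\pi\int_{\mathbb{R}_+}e^{it(x-u)}\,t\,N_n(2ty)^tP_\gamma(t)N_n(2tv)\,dt.$$ *)

theory Defs
  imports "HOL-Analysis.Analysis"
begin

definition upper_halfplane :: "complex set" where
  "upper_halfplane = {z. Im z > 0}"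

definition area :: "complex measure" where
  "area = restrict_space lborel upper_halfplane"

definition halfline :: "real measure" where
  "halfline = restrict_space lborel {0<..}"

text \<open>
  Elements of an \<open>L\<^sub>2\<close> space are represented by functions, not by classes modulo
  null sets; every class with respect to Lebesgue measure has a Borel representative.
\<close>

definition L2 :: "'a measure \<Rightarrow> ('a \<Rightarrow> complex) set" where
  "L2 M = {f \<in> borel_measurable M. integrable M (\<lambda>x. (cmod (f x))\<^sup>2)}"

definition L2_inner :: "'a measure \<Rightarrow> ('a \<Rightarrow> complex) \<Rightarrow> ('a \<Rightarrow> complex) \<Rightarrow> complex" where
  "L2_inner M f g = (LINT x|M. f x * cnj (g x))"

definition laguerre_fun :: "nat \<Rightarrow> real \<Rightarrow> real" where
  "laguerre_fun k y = (-1) ^ k * indicator {0<..} y * exp (- y / 2) * (exp y / fact k) *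
     (deriv ^^ k) (\<lambda>s. exp (- s) * s ^ k) y"

definition phi_sum :: "nat \<Rightarrow> real \<Rightarrow> real \<Rightarrow> real" where
  "phi_sum m t y = (\<Sum>j=1..m. exp (- (real j - 1) * t) * laguerre_fun (j - 1) (2 * t * y))"

definition phi_root :: "real \<Rightarrow> real" where
  "phi_root t = - 1 + sqrt (1 - exp (- 2 * t))"


subsection \<open>The poly-Bergman space\<close>

definition partial_x :: "(complex \<Rightarrow> complex) \<Rightarrow> complex \<Rightarrow> complex" where
  "partial_x f z = frechet_derivative f (at z) 1"

definition partial_y :: "(complex \<Rightarrow> complex) \<Rightarrow> complex \<Rightarrow> complex" where
  "partial_y f z = frechet_derivative f (at z) \<i>"

definition dbar :: "(complex \<Rightarrow> complex) \<Rightarrow> complex \<Rightarrow> complex" where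
  "dbar f z = (partial_x f z + \<i> * partial_y f z) / 2"

text \<open>\<open>k\<close> times continuously differentiable in the real sense (meant for open \<open>S\<close>).\<close>

primrec C_diff_on :: "nat \<Rightarrow> complex set \<Rightarrow> (complex \<Rightarrow> complex) \<Rightarrow> bool" where
  "C_diff_on 0 S f \<longleftrightarrow> continuous_on S f"
| "C_diff_on (Suc k) S f \<longleftrightarrow>
     (\<forall>z\<in>S. f differentiable (at z)) \<and> C_diff_on k S (partial_x f) \<and> C_diff_on k S (partial_y f)"

definition poly_bergman :: "nat \<Rightarrow> (complex \<Rightarrow> complex) set" where
  "poly_bergman n = {f \<in> L2 area. C_diff_on n upper_halfplane f \<and>
     (\<forall>z\<in>upper_halfplane. (dbar ^^ n) f z = 0)}"


subsection \<open>The operators\<close>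

text \<open>
  Elements of \<open>(L\<^sub>2(\<real>\<^sub>+))\<^sup>n\<close> are families \<open>g :: nat \<Rightarrow> real \<Rightarrow> complex\<close> whose components
  \<open>g j\<close> matter for \<open>j \<in> {1..n}\<close> only; component \<open>j\<close> of \<open>N\<^sub>n\<close> is \<open>laguerre_fun (j - 1)\<close>.
\<close>

definition R_trunc :: "real \<Rightarrow> (complex \<Rightarrow> complex) \<Rightarrow> nat \<Rightarrow> real \<Rightarrow> complex" where
  "R_trunc T \<phi> j x = of_real (1 / sqrt (2 * pi)) *
     (LINT t:{-T..T}|lborel. exp (- \<i> * of_real (x * t)) *
        (LINT r|halfline. \<phi> (Complex t r) *
           of_real (sqrt (2 * x) * laguerre_fun (j - 1) (2 * x * r))))"

text \<open>
  As usual for the Fourier transform on \<open>L\<^sub>2\<close>, the outer integral over \<open>\<real>\<close> is the limit in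
  the mean of the integrals over \<open>[-T, T]\<close>. This determines \<open>R_op n \<phi>\<close> up to null sets.
\<close>

definition R_op :: "nat \<Rightarrow> (complex \<Rightarrow> complex) \<Rightarrow> nat \<Rightarrow> real \<Rightarrow> complex" where
  "R_op n \<phi> = (SOME g. \<forall>j\<in>{1..n}. g j \<in> L2 halfline \<and>
     ((\<lambda>T. \<integral>\<^sup>+ x. ennreal ((cmod (g j x - R_trunc T \<phi> j x))\<^sup>2) \<partial>halfline) \<longlongrightarrow> 0) at_top)"

text \<open>The Hilbert space adjoint of \<open>R_op n : L\<^sub>2(\<Pi>) \<rightarrow> (L\<^sub>2(\<real>\<^sub>+))\<^sup>n\<close>, again up to null sets.\<close>

definition R_adj :: "nat \<Rightarrow> (nat \<Rightarrow> real \<Rightarrow> complex) \<Rightarrow> complex \<Rightarrow> complex" where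
  "R_adj n g = (SOME f. f \<in> L2 area \<and>
     (\<forall>\<psi>\<in>L2 area. L2_inner area f \<psi> = (\<Sum>j=1..n. L2_inner halfline (g j) (R_op n \<psi> j))))"

definition gamma_sym :: "nat \<Rightarrow> nat \<Rightarrow> real \<Rightarrow> real" where
  "gamma_sym n k t =
     (if k < n then exp (- 2 * real k * t) * (exp (2 * t) - 1) else exp (- 2 * (real n - 1) * t))"

definition P_gamma :: "nat \<Rightarrow> real \<Rightarrow> nat \<Rightarrow> nat \<Rightarrow> real" where
  "P_gamma n t j k = sqrt (gamma_sym n j t) * sqrt (gamma_sym n k t)"

definition P_gamma_mult :: "nat \<Rightarrow> (nat \<Rightarrow> real \<Rightarrow> complex) \<Rightarrow> nat \<Rightarrow> real \<Rightarrow> complex" where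
  "P_gamma_mult n g j t = (\<Sum>k=1..n. of_real (P_gamma n t j k) * g k t)"

definition P_op :: "nat \<Rightarrow> (complex \<Rightarrow> complex) \<Rightarrow> complex \<Rightarrow> complex" where
  "P_op n \<phi> = R_adj n (P_gamma_mult n (R_op n \<phi>))"

text \<open>
  The image of \<open>P_op n\<close> on the poly-Bergman space. Since \<open>P_op n \<phi>\<close> is determined only up to
  null sets, the image consists of the polyanalytic representatives, which have well-defined
  point values.
\<close>

definition image_P :: "nat \<Rightarrow> (complex \<Rightarrow> complex) set" where
  "image_P n =
     {f \<in> poly_bergman n. \<exists>\<phi>\<in>poly_bergman n. AE z in area. f z = P_op n \<phi> z}"

text \<open>
  \<open>K\<close> is the reproducing kernel of \<open>H \<subseteq> L\<^sub>2(M)\<close> if its sections \<open>K(\<cdot>, z)\<close> belong to \<open>H\<close> and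
  \<open>f(z) = \<langle>f, K(\<cdot>, z)\<rangle>\<close> for all \<open>f\<close> in \<open>H\<close>. In particular \<open>K(z, w)\<close> is Hermitian, so that
  \<open>f(z)\<close> is the integral of \<open>f(w) K(z, w)\<close> over \<open>w\<close>.
\<close>

definition is_reproducing_kernel ::
    "'a measure \<Rightarrow> ('a \<Rightarrow> complex) set \<Rightarrow> ('a \<Rightarrow> 'a \<Rightarrow> complex) \<Rightarrow> bool" where
  "is_reproducing_kernel M H K \<longleftrightarrow>
     (\<forall>z\<in>space M. (\<lambda>w. K w z) \<in> H) \<and>
     (\<forall>f\<in>H. \<forall>z\<in>space M. f z = L2_inner M f (\<lambda>w. K w z))"

end

theory Submission
  imports Defs "HOL-Probability.Characteristic_Functions" "HOL-Complex_Analysis.Cauchy_Integral_Formula"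
begin

text \<open>
  The transform pairs a function on the half-plane with the functions \<open>kern j x\<close>, plane waves of
  frequency \<open>x\<close> in \<open>Re z\<close> times dilated Laguerre functions in \<open>Im z\<close>. Its adjoint is an absolutely
  convergent integral, \<open>synth n g z = \<Sum>\<^sub>j \<integral> kern j x z g\<^sub>j(x) dx\<close>, and this explicit operator carries the
  proof. Expanding the Laguerre polynomials shows that \<open>synth n g\<close> is a polynomial in \<open>Im z\<close> of degree
  less than \<open>n\<close> whose coefficients are Laplace integrals, hence holomorphic
  (\<open>synth_polyanalytic\<close>). Plancherel's theorem in \<open>Re z\<close> and the orthonormality of the Laguerre
  functions in \<open>Im z\<close> make it isometric (\<open>synth_isometry_bounded\<close>, \<open>synth_contraction\<close>).

  The transform itself is controlled by duality with \<open>synth\<close>: the integrals over strips are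
  contractions (\<open>ana_contraction\<close>), so that the limit in the mean exists (\<open>R_op_exists\<close>); \<open>synth n g\<close>
  agrees almost everywhere with the adjoint (\<open>R_adj_eq_synth\<close>); and the transform recovers bounded
  integrable data \<open>h\<close> from \<open>synth n h\<close> (\<open>R_op_synth\<close>).

  Write \<open>P\<close> for \<open>P_gamma\<close>. It is the rank one matrix of the vector of the \<open>sqrt \<gamma>\<^sub>j\<close>, and the \<open>\<gamma>\<^sub>j\<close> telescope
  to the sum \<open>1\<close>, so \<open>P\<close> is a self-adjoint projection. An element of the image has the form
  \<open>f = synth n g\<close> with \<open>P g = g\<close>. If \<open>k\<^sub>w\<close> denotes the vector of the conjugates of \<open>kern j x w\<close>, then
  \<open>f(w) = \<langle>g, k\<^sub>w\<rangle> = \<langle>g, P k\<^sub>w\<rangle> = \<langle>f, synth n (P k\<^sub>w)\<rangle>\<close>, so the kernel section at \<open>w\<close> is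
  \<open>synth n (P k\<^sub>w)\<close>. Its integrand at \<open>z\<close> contains the product of
  \<open>\<Sum>\<^sub>j sqrt \<gamma>\<^sub>j l\<^sub>j\<^sub>-\<^sub>1(2ty)\<close> and the same sum with \<open>v\<close> for \<open>y\<close>. This sum is \<open>phi_sum n + phi_root phi_sum (n - 1)\<close>,
  and the matrix in the theorem is the product of \<open>(1, phi_root)\<^sup>t\<close> and \<open>(1, phi_root)\<close>
  (\<open>sum_sqrt_gamma_laguerre\<close>, \<open>phi_matrix_eq\<close>). Since a reproducing kernel is unique, this one is the
  only one (\<open>reproducing_kernel_unique\<close>).
\<close>

section \<open>Square integrable functions\<close>

definition sq_norm :: "'a measure \<Rightarrow> ('a \<Rightarrow> complex) \<Rightarrow> ennreal" where
  "sq_norm M f = (\<integral>\<^sup>+ x. ennreal ((cmod (f x))\<^sup>2) \<partial>M)"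

lemma L2_iff_sq_norm: "f \<in> L2 M \<longleftrightarrow> f \<in> borel_measurable M \<and> sq_norm M f < \<infinity>"
  unfolding L2_def sq_norm_def by (auto simp: integrable_iff_bounded)

lemma L2_measurable[measurable_dest]: "f \<in> L2 M \<Longrightarrow> f \<in> borel_measurable M"
  by (simp add: L2_def)

lemma sq_norm_cong_AE: "(AE x in M. f x = g x) \<Longrightarrow> sq_norm M f = sq_norm M g"
  unfolding sq_norm_def by (rule nn_integral_cong_AE) auto

lemma sq_norm_mono: "(\<And>x. x \<in> space M \<Longrightarrow> cmod (f x) \<le> cmod (g x)) \<Longrightarrow> sq_norm M f \<le> sq_norm M g"
  unfolding sq_norm_def by (intro nn_integral_mono ennreal_leI power_mono) auto

lemma sq_norm_cmult: "f \<in> borel_measurable M \<Longrightarrow>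
    sq_norm M (\<lambda>x. c * f x) = ennreal ((cmod c)\<^sup>2) * sq_norm M f"
  unfolding sq_norm_def
  by (subst nn_integral_cmult[symmetric])
     (auto simp: norm_mult power_mult_distrib ennreal_mult)

lemma sq_norm_add_le:
  assumes [measurable]: "f \<in> borel_measurable M" "g \<in> borel_measurable M"
  shows "sq_norm M (\<lambda>x. f x + g x) \<le> 2 * (sq_norm M f + sq_norm M g)"
proof -
  have "(cmod (f x + g x))\<^sup>2 \<le> 2 * ((cmod (f x))\<^sup>2 + (cmod (g x))\<^sup>2)" for x
  proof -
    have "(cmod (f x + g x))\<^sup>2 \<le> (cmod (f x) + cmod (g x))\<^sup>2"
      by (intro power_mono norm_triangle_ineq) auto
    also have "\<dots> \<le> 2 * ((cmod (f x))\<^sup>2 + (cmod (g x))\<^sup>2)"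
      using sum_squares_bound[of "cmod (f x)" "cmod (g x)"] by (simp add: power2_sum)
    finally show ?thesis .
  qed
  have "sq_norm M (\<lambda>x. f x + g x)
      \<le> (\<integral>\<^sup>+x. ennreal 2 * (ennreal ((cmod (f x))\<^sup>2) + ennreal ((cmod (g x))\<^sup>2)) \<partial>M)"
    unfolding sq_norm_def
  proof (rule nn_integral_mono)
    fix x
    have "ennreal ((cmod (f x + g x))\<^sup>2) \<le> ennreal (2 * ((cmod (f x))\<^sup>2 + (cmod (g x))\<^sup>2))"
      by (rule ennreal_leI) fact
    also have "\<dots> = ennreal 2 * (ennreal ((cmod (f x))\<^sup>2) + ennreal ((cmod (g x))\<^sup>2))"
      by (subst ennreal_mult) (simp_all add: ennreal_plus)
    finally show "ennreal ((cmod (f x + g x))\<^sup>2)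
      \<le> ennreal 2 * (ennreal ((cmod (f x))\<^sup>2) + ennreal ((cmod (g x))\<^sup>2))" .
  qed
  also have "\<dots> = 2 * (sq_norm M f + sq_norm M g)"
    unfolding sq_norm_def by (subst nn_integral_cmult) (auto simp: nn_integral_add)
  finally show ?thesis .
qed

lemma L2_add: "f \<in> L2 M \<Longrightarrow> g \<in> L2 M \<Longrightarrow> (\<lambda>x. f x + g x) \<in> L2 M"
  using sq_norm_add_le[of f M g]
  by (auto simp: L2_iff_sq_norm ennreal_mult_less_top intro: le_less_trans)

lemma L2_cmult: "f \<in> L2 M \<Longrightarrow> (\<lambda>x. c * f x) \<in> L2 M"
  by (auto simp: L2_iff_sq_norm sq_norm_cmult ennreal_mult_less_top)

lemma L2_diff: "f \<in> L2 M \<Longrightarrow> g \<in> L2 M \<Longrightarrow> (\<lambda>x. f x - g x) \<in> L2 M"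
  using L2_add[of f M "\<lambda>x. (-1) * g x"] L2_cmult[of g M "-1"] by simp

lemma L2_zero: "(\<lambda>x. 0) \<in> L2 M"
  by (simp add: L2_def)

lemma L2_sum: "(\<And>i. i \<in> I \<Longrightarrow> f i \<in> L2 M) \<Longrightarrow> (\<lambda>x. \<Sum>i\<in>I. f i x) \<in> L2 M"
  by (induction I rule: infinite_finite_induct) (auto intro: L2_add L2_zero)

lemma L2_bounded_mult:
  assumes "f \<in> L2 M" and [measurable]: "b \<in> borel_measurable M"
    and b: "\<And>x. x \<in> space M \<Longrightarrow> cmod (b x) \<le> C"
  shows "(\<lambda>x. b x * f x) \<in> L2 M"
proof -
  have [measurable]: "f \<in> borel_measurable M" using assms(1) by (rule L2_measurable)
  have "sq_norm M (\<lambda>x. b x * f x) \<le> sq_norm M (\<lambda>x. complex_of_real C * f x)"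
  proof (rule sq_norm_mono)
    fix x assume "x \<in> space M"
    then have "cmod (b x) \<le> \<bar>C\<bar>" using b[of x] by linarith
    then show "cmod (b x * f x) \<le> cmod (complex_of_real C * f x)"
      by (simp add: norm_mult mult_right_mono)
  qed
  also have "\<dots> < \<infinity>" using L2_cmult[OF assms(1)] by (auto simp: L2_iff_sq_norm)
  finally show ?thesis by (auto simp: L2_iff_sq_norm)
qed

lemma borel_measurable_cnj[measurable]: "cnj \<in> borel_measurable borel"
  by (intro borel_measurable_continuous_onI continuous_intros)

lemma L2_cnj: "f \<in> L2 M \<Longrightarrow> (\<lambda>x. cnj (f x)) \<in> L2 M"
  unfolding L2_def by (auto intro: measurable_compose[OF _ borel_measurable_cnj])

lemma L2_bounded_integrable:
  assumes int: "integrable M f" and b: "\<And>x. x \<in> space M \<Longrightarrow> cmod (f x) \<le> C"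
  shows "f \<in> L2 M"
proof -
  have "integrable M (\<lambda>x. (cmod (f x))\<^sup>2)"
  proof (rule Bochner_Integration.integrable_bound[of _ "\<lambda>x. C * cmod (f x)"])
    show "integrable M (\<lambda>x. C * cmod (f x))" using int by auto
    show "AE x in M. norm ((cmod (f x))\<^sup>2) \<le> norm (C * cmod (f x))"
    proof (rule AE_I2)
      fix x assume "x \<in> space M"
      then have "cmod (f x) \<le> \<bar>C\<bar>" using b[of x] by linarith
      then show "norm ((cmod (f x))\<^sup>2) \<le> norm (C * cmod (f x))"
        by (simp add: power2_eq_square abs_mult mult_right_mono)
    qed
  qed (use int in auto)
  then show ?thesis using int by (auto simp: L2_def)
qed

lemma L2_mult_integrable:
  assumes "f \<in> L2 M" "g \<in> L2 M"
  shows "integrable M (\<lambda>x. f x * g x)"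
proof (rule Bochner_Integration.integrable_bound[of _ "\<lambda>x. (cmod (f x))\<^sup>2 + (cmod (g x))\<^sup>2"])
  show "integrable M (\<lambda>x. (cmod (f x))\<^sup>2 + (cmod (g x))\<^sup>2)" using assms by (auto simp: L2_def)
  have [measurable]: "f \<in> borel_measurable M" "g \<in> borel_measurable M"
    using assms by (auto intro: L2_measurable)
  show "(\<lambda>x. f x * g x) \<in> borel_measurable M" by measurable
  show "AE x in M. norm (f x * g x) \<le> norm ((cmod (f x))\<^sup>2 + (cmod (g x))\<^sup>2)"
  proof (rule AE_I2)
    fix x
    have "2 * (cmod (f x) * cmod (g x)) \<le> (cmod (f x))\<^sup>2 + (cmod (g x))\<^sup>2"
      using sum_squares_bound[of "cmod (f x)" "cmod (g x)"] by simp
    moreover have "0 \<le> cmod (f x) * cmod (g x)" by simp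
    ultimately show "norm (f x * g x) \<le> norm ((cmod (f x))\<^sup>2 + (cmod (g x))\<^sup>2)"
      unfolding norm_mult real_norm_def by linarith
  qed
qed

lemma L2_inner_integrable:
  "f \<in> L2 M \<Longrightarrow> g \<in> L2 M \<Longrightarrow> integrable M (\<lambda>x. f x * cnj (g x))"
  by (intro L2_mult_integrable L2_cnj)

lemma L2_integral_square:
  assumes "f \<in> L2 M"
  shows "integrable M (\<lambda>x. (cmod (f x))\<^sup>2)" "(LINT x|M. (cmod (f x))\<^sup>2) = enn2real (sq_norm M f)"
proof -
  show int: "integrable M (\<lambda>x. (cmod (f x))\<^sup>2)" using assms by (simp add: L2_def)
  show "(LINT x|M. (cmod (f x))\<^sup>2) = enn2real (sq_norm M f)"
    unfolding sq_norm_def using int by (intro integral_eq_nn_integral) auto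
qed

lemma L2_inner_self:
  assumes "f \<in> L2 M"
  shows "L2_inner M f f = of_real (enn2real (sq_norm M f))"
proof -
  have "L2_inner M f f = (LINT x|M. complex_of_real ((cmod (f x))\<^sup>2))"
    unfolding L2_inner_def
    by (rule Bochner_Integration.integral_cong) (simp_all only: complex_norm_square)
  also have "\<dots> = of_real (LINT x|M. (cmod (f x))\<^sup>2)" by (rule integral_complex_of_real)
  finally show ?thesis unfolding L2_integral_square(2)[OF assms] .
qed

lemma L2_inner_diff_left:
  "f \<in> L2 M \<Longrightarrow> g \<in> L2 M \<Longrightarrow> h \<in> L2 M \<Longrightarrow>
    L2_inner M (\<lambda>x. f x - g x) h = L2_inner M f h - L2_inner M g h"
  unfolding L2_inner_def
  by (simp add: left_diff_distrib Bochner_Integration.integral_diff L2_inner_integrable)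

lemma L2_inner_diff_right:
  "f \<in> L2 M \<Longrightarrow> g \<in> L2 M \<Longrightarrow> h \<in> L2 M \<Longrightarrow>
    L2_inner M h (\<lambda>x. f x - g x) = L2_inner M h f - L2_inner M h g"
  unfolding L2_inner_def
  by (simp add: right_diff_distrib Bochner_Integration.integral_diff L2_inner_integrable)

lemma L2_inner_commute: "L2_inner M g f = cnj (L2_inner M f g)"
  unfolding L2_inner_def by (subst Bochner_Integration.integral_cnj[symmetric]) (simp add: mult.commute)

lemma L2_inner_weighted_bound:
  assumes "f \<in> L2 M" "g \<in> L2 M" "s > 0"
  shows "2 * cmod (L2_inner M f g) \<le>
    s * enn2real (sq_norm M f) + enn2real (sq_norm M g) / s"
proof -
  note int = L2_integral_square(1)[OF assms(1)] L2_integral_square(1)[OF assms(2)]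
  note eq = L2_integral_square(2)[OF assms(1)] L2_integral_square(2)[OF assms(2)]
  have pt: "2 * cmod (f x * cnj (g x)) \<le> s * (cmod (f x))\<^sup>2 + (cmod (g x))\<^sup>2 / s" for x
  proof -
    have "0 \<le> (s * cmod (f x) - cmod (g x))\<^sup>2 / s" using assms by simp
    also have "\<dots> = s * (cmod (f x))\<^sup>2 + (cmod (g x))\<^sup>2 / s - 2 * (cmod (f x) * cmod (g x))"
      using assms by (simp add: power2_eq_square field_simps)
    finally show ?thesis by (simp add: norm_mult)
  qed
  have "2 * cmod (L2_inner M f g) \<le> 2 * (LINT x|M. cmod (f x * cnj (g x)))"
    unfolding L2_inner_def using integral_norm_bound by simp
  also have "\<dots> = (LINT x|M. 2 * cmod (f x * cnj (g x)))" by simp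
  also have "\<dots> \<le> (LINT x|M. s * (cmod (f x))\<^sup>2 + (cmod (g x))\<^sup>2 / s)"
    using int L2_inner_integrable[OF assms(1,2)] pt by (intro integral_mono) auto
  also have "\<dots> = s * enn2real (sq_norm M f) + enn2real (sq_norm M g) / s"
    using int eq by simp
  finally show ?thesis .
qed

lemma L2_inner_tendsto:
  assumes f: "\<And>i. f i \<in> L2 M" and l: "l \<in> L2 M" and g: "g \<in> L2 M"
    and lim: "((\<lambda>i. sq_norm M (\<lambda>x. f i x - l x)) \<longlongrightarrow> 0) F"
  shows "((\<lambda>i. L2_inner M (f i) g) \<longlongrightarrow> L2_inner M l g) F"
proof (rule tendstoI)
  fix e :: real assume e: "e > 0"
  define b s where "b = enn2real (sq_norm M g)" and "s = (b + 1) / e"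
  have "b \<ge> 0" by (simp add: b_def)
  then have s: "s > 0" "b / s < e" using e by (simp_all add: s_def field_simps)
  have "((\<lambda>i. enn2real (sq_norm M (\<lambda>x. f i x - l x))) \<longlongrightarrow> enn2real 0) F"
    by (rule tendsto_enn2real) (use lim in auto)
  then have "\<forall>\<^sub>F i in F. enn2real (sq_norm M (\<lambda>x. f i x - l x)) < e / s"
    using e s by (intro order_tendstoD) auto
  then show "\<forall>\<^sub>F i in F. dist (L2_inner M (f i) g) (L2_inner M l g) < e"
  proof eventually_elim
    case (elim i)
    have "2 * dist (L2_inner M (f i) g) (L2_inner M l g) =
        2 * cmod (L2_inner M (\<lambda>x. f i x - l x) g)"
      by (simp add: dist_norm L2_inner_diff_left f l g)
    also have "\<dots> \<le> s * enn2real (sq_norm M (\<lambda>x. f i x - l x)) + b / s"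
      unfolding b_def by (intro L2_inner_weighted_bound L2_diff f l g s)
    also have "\<dots> < e + e" using elim s by (intro add_strict_mono) (auto simp: field_simps)
    finally show ?case by simp
  qed
qed

lemma L2_inner_tendsto_right:
  assumes "\<And>i. f i \<in> L2 M" "l \<in> L2 M" "g \<in> L2 M"
    "((\<lambda>i. sq_norm M (\<lambda>x. f i x - l x)) \<longlongrightarrow> 0) F"
  shows "((\<lambda>i. L2_inner M g (f i)) \<longlongrightarrow> L2_inner M g l) F"
  unfolding L2_inner_commute[of M g] by (intro tendsto_cnj L2_inner_tendsto assms)

lemma sq_norm_zero_imp_AE:
  assumes "f \<in> borel_measurable M" "sq_norm M f = 0"
  shows "AE x in M. f x = 0"
proof -
  have "AE x in M. ennreal ((cmod (f x))\<^sup>2) = 0"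
    using assms unfolding sq_norm_def by (subst (asm) nn_integral_0_iff_AE) auto
  then show ?thesis by eventually_elim (simp add: ennreal_eq_0_iff)
qed

lemma sq_norm_Fatou:
  assumes [measurable]: "\<And>k. f k \<in> borel_measurable M"
    and lim: "AE x in M. (\<lambda>k. f k x) \<longlonglongrightarrow> l x"
    and le: "\<forall>\<^sub>F k in sequentially. sq_norm M (f k) \<le> C"
  shows "sq_norm M l \<le> C"
proof -
  have "sq_norm M l = (\<integral>\<^sup>+x. liminf (\<lambda>k. ennreal ((cmod (f k x))\<^sup>2)) \<partial>M)"
    unfolding sq_norm_def
  proof (rule nn_integral_cong_AE, use lim in eventually_elim)
    case (elim x)
    then have "(\<lambda>k. ennreal ((cmod (f k x))\<^sup>2)) \<longlonglongrightarrow> ennreal ((cmod (l x))\<^sup>2)"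
      by (intro tendsto_intros)
    then show ?case by (intro lim_imp_Liminf[symmetric]) auto
  qed
  also have "\<dots> \<le> liminf (\<lambda>k. sq_norm M (f k))"
    unfolding sq_norm_def by (rule nn_integral_liminf) measurable
  also have "\<dots> \<le> C" using le by (rule Liminf_le[rotated]) simp
  finally show ?thesis .
qed

text \<open>Completeness of \<open>L\<^sub>2\<close>: along a sequence of parameters with \<open>\<parallel>h\<^sub>k\<^sub>+\<^sub>1 - h\<^sub>k\<parallel>\<^sup>2 \<le> 4\<^sup>-\<^sup>k\<close> the
  function \<open>\<Sum>\<^sub>k 2\<^sup>k |h\<^sub>k\<^sub>+\<^sub>1 - h\<^sub>k|\<^sup>2\<close> is integrable, hence finite almost everywhere, so that the
  sequence converges pointwise geometrically fast; Fatou's lemma bounds the distance to the limit.\<close>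

lemma L2_complete:
  fixes h :: "real \<Rightarrow> 'a \<Rightarrow> complex" and \<tau> :: "real \<Rightarrow> real"
  assumes [measurable]: "\<And>T. h T \<in> borel_measurable M"
    and cauchy: "\<And>S T. S \<le> T \<Longrightarrow> sq_norm M (\<lambda>x. h T x - h S x) \<le> ennreal (\<tau> S)"
    and \<tau>: "(\<tau> \<longlongrightarrow> 0) at_top"
  obtains g where "g \<in> borel_measurable M" "((\<lambda>T. sq_norm M (\<lambda>x. g x - h T x)) \<longlongrightarrow> 0) at_top"
proof -
  have "\<exists>c. \<forall>T\<ge>c. \<tau> T \<le> (1/4)^k" for k :: nat
  proof -
    have "\<forall>\<^sub>F T in at_top. \<tau> T < (1/4)^k" by (rule order_tendstoD[OF \<tau>]) simp
    then show ?thesis by (auto simp: eventually_at_top_linorder intro: less_imp_le)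
  qed
  then obtain c where c: "\<And>k T. T \<ge> c k \<Longrightarrow> \<tau> T \<le> (1/4)^k" by metis
  \<comment> \<open>An increasing unbounded sequence of parameters beyond the thresholds \<open>c k\<close>.\<close>
  define t where "t k = (\<Sum>i\<le>k. \<bar>c i\<bar>) + real k" for k
  have t_c: "c k \<le> t k" for k
  proof -
    have "\<bar>c k\<bar> \<le> (\<Sum>i\<le>k. \<bar>c i\<bar>)" by (rule member_le_sum) auto
    then show ?thesis unfolding t_def by linarith
  qed
  have t_mono: "t k \<le> t (Suc k)" for k by (simp add: t_def)
  have t_ge: "real k \<le> t k" for k by (simp add: t_def sum_nonneg)
  define d where "d k x = h (t (Suc k)) x - h (t k) x" for k x
  have [measurable]: "d k \<in> borel_measurable M" for k unfolding d_def by measurable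
  let ?w = "\<lambda>k x. ennreal (2^k * (cmod (d k x))\<^sup>2)"
  have d: "sq_norm M (d k) \<le> ennreal ((1/4)^k)" for k
    using cauchy[OF t_mono[of k]] c[OF t_c[of k]] unfolding d_def
    by (meson ennreal_leI order_trans)
  have "(\<integral>\<^sup>+x. (\<Sum>k. ?w k x) \<partial>M) = (\<Sum>k. \<integral>\<^sup>+x. ?w k x \<partial>M)"
    by (rule nn_integral_suminf) measurable
  also have "\<dots> \<le> (\<Sum>k. ennreal ((1/2)^k))"
  proof (rule suminf_le)
    fix k
    have "(\<integral>\<^sup>+x. ?w k x \<partial>M) = ennreal (2^k) * sq_norm M (d k)"
      unfolding sq_norm_def by (subst nn_integral_cmult[symmetric]) (auto simp: ennreal_mult)
    also have "\<dots> \<le> ennreal (2^k) * ennreal ((1/4)^k)" by (intro mult_left_mono d) auto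
    also have "\<dots> = ennreal ((1/2)^k)"
      by (simp flip: ennreal_mult power_mult_distrib)
    finally show "(\<integral>\<^sup>+x. ?w k x \<partial>M) \<le> ennreal ((1/2)^k)" .
  qed auto
  also have "\<dots> < \<infinity>"
    by (subst suminf_ennreal2) (auto simp: summable_geometric)
  finally have "(\<integral>\<^sup>+x. (\<Sum>k. ?w k x) \<partial>M) \<noteq> \<infinity>" by simp
  then have "AE x in M. (\<Sum>k. ?w k x) \<noteq> \<infinity>"
    by (intro nn_integral_noteq_infinite) measurable
  then have conv: "AE x in M. convergent (\<lambda>k. h (t k) x)"
  proof eventually_elim
    case (elim x)
    then obtain C where C: "(\<Sum>k. ?w k x) = ennreal C" "C \<ge> 0"
      using ennreal_cases[of "\<Sum>k. ?w k x"]
      by (metis infinity_ennreal_def)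
    have bound: "cmod (d k x) \<le> sqrt C * (sqrt (1/2))^k" for k
    proof -
      have "?w k x \<le> ennreal C"
        unfolding C(1)[symmetric]
        using sum_le_suminf[of "\<lambda>k. ?w k x" "{k}"]
        by (metis (no_types, lifting) finite.intros summableI sum.insert sum.empty empty_iff
            add.right_neutral zero_le)
      then have "2^k * (cmod (d k x))\<^sup>2 \<le> C" using C(2) by (subst (asm) ennreal_le_iff) auto
      then have "(1/2)^k * (2^k * (cmod (d k x))\<^sup>2) \<le> (1/2)^k * C" by (rule mult_left_mono) simp
      also have "(1/2)^k * (2^k * (cmod (d k x))\<^sup>2) = (cmod (d k x))\<^sup>2"
        by (simp add: mult.assoc[symmetric] power_mult_distrib[symmetric])
      finally have "(cmod (d k x))\<^sup>2 \<le> C * (1/2)^k" by (simp only: mult.commute)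
      then have "sqrt ((cmod (d k x))\<^sup>2) \<le> sqrt (C * (1/2)^k)" by (rule real_sqrt_le_mono)
      then show ?thesis by (simp add: real_sqrt_mult real_sqrt_power)
    qed
    have "summable (\<lambda>k. d k x)"
    proof (rule summable_comparison_test')
      show "summable (\<lambda>k. sqrt C * (sqrt (1/2))^k)"
        by (intro summable_mult summable_geometric) (simp add: real_sqrt_divide)
    qed (rule bound)
    then have "convergent (\<lambda>m. h (t 0) x + (\<Sum>k<m. d k x))"
      by (intro convergent_add convergent_const) (simp add: summable_iff_convergent)
    also have "(\<lambda>m. h (t 0) x + (\<Sum>k<m. d k x)) = (\<lambda>m. h (t m) x)"
      unfolding d_def sum_lessThan_telescope[of "\<lambda>k. h (t k) x"] by simp
    finally show ?case .
  qed
  define g where "g x = lim (\<lambda>k. h (t k) x)" for x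
  have g_meas[measurable]: "g \<in> borel_measurable M"
    unfolding g_def by (rule borel_measurable_lim_metric) measurable
  have est: "sq_norm M (\<lambda>x. g x - h T x) \<le> ennreal (\<tau> T)" for T
  proof (rule sq_norm_Fatou)
    show "AE x in M. (\<lambda>k. h (t k) x - h T x) \<longlonglongrightarrow> g x - h T x"
      using conv by eventually_elim (auto simp: g_def convergent_LIMSEQ_iff intro: tendsto_diff)
    have "\<forall>\<^sub>F k in sequentially. T \<le> t k"
      using eventually_ge_at_top[of "nat \<lceil>T\<rceil>"]
      by eventually_elim (use t_ge in \<open>smt (verit) real_nat_ceiling_ge of_nat_mono\<close>)
    then show "\<forall>\<^sub>F k in sequentially. sq_norm M (\<lambda>x. h (t k) x - h T x) \<le> ennreal (\<tau> T)"
      by eventually_elim (rule cauchy)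
  qed measurable
  have "((\<lambda>T. ennreal (\<tau> T)) \<longlongrightarrow> ennreal 0) at_top" by (intro tendsto_intros \<tau>)
  then have lim: "((\<lambda>T. ennreal (\<tau> T)) \<longlongrightarrow> 0) at_top" by simp
  have "((\<lambda>T. sq_norm M (\<lambda>x. g x - h T x)) \<longlongrightarrow> 0) at_top"
    by (rule tendsto_sandwich[OF _ _ tendsto_const lim]) (use est in simp_all)
  then show ?thesis using that g_meas by blast
qed

section \<open>Orthonormality of the Laguerre functions\<close>

text \<open>The operator by which \<open>d/ds\<close> acts on the factor \<open>p\<close> of \<open>e\<^sup>-\<^sup>s p(s)\<close>.\<close>

definition pderiv_minus :: "real poly \<Rightarrow> real poly" where
  "pderiv_minus p = pderiv p - p"

lemma deriv_exp_poly: "(deriv ^^ m) (\<lambda>s. exp (- s) * poly p s) =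
    (\<lambda>s. exp (- s) * poly ((pderiv_minus ^^ m) p) s)"
proof (induction m)
  case (Suc m)
  have "deriv (\<lambda>s. exp (- s) * poly q s) s = exp (- s) * poly (pderiv_minus q) s" for q s
    by (rule DERIV_imp_deriv)
       (auto intro!: derivative_eq_intros simp: pderiv_minus_def algebra_simps)
  then show ?case by (simp add: Suc fun_eq_iff)
qed simp

definition laguerre_poly :: "nat \<Rightarrow> real poly" where
  "laguerre_poly k = smult (1 / fact k) ((pderiv_minus ^^ k) (monom 1 k))"

lemma laguerre_fun_eq:
  "laguerre_fun k y = indicator {0<..} y * ((-1) ^ k * exp (- y / 2) * poly (laguerre_poly k) y)"
proof -
  have "(deriv ^^ k) (\<lambda>s. exp (- s) * s ^ k) y = exp (- y) * (fact k * poly (laguerre_poly k) y)"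
    using deriv_exp_poly[of k "monom 1 k"] by (simp add: poly_monom laguerre_poly_def)
  then have "laguerre_fun k y = indicator {0<..} y *
      ((-1) ^ k * exp (- y / 2) * (exp y * exp (- y)) * poly (laguerre_poly k) y)"
    by (simp add: laguerre_fun_def)
  then show ?thesis by (simp add: exp_minus)
qed

lemma borel_measurable_laguerre_fun[measurable]: "laguerre_fun k \<in> borel_measurable borel"
proof -
  have "poly p \<in> borel_measurable borel" for p :: "real poly"
    by (intro borel_measurable_continuous_onI continuous_intros)
  note [measurable] = this
  show ?thesis unfolding laguerre_fun_eq[abs_def] by measurable
qed

lemma power_le_exp:
  fixes x :: real
  assumes "x \<ge> 0"
  shows "x ^ n \<le> fact n * exp x"
proof -
  have "x ^ n /\<^sub>R fact n \<le> exp x"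
    unfolding exp_def using sum_le_suminf[of "\<lambda>n. x ^ n /\<^sub>R fact n" "{n}"] assms
    by (simp add: summable_exp)
  then show ?thesis by (simp add: field_simps)
qed

text \<open>Every polynomial grows more slowly than \<open>e\<^sup>s\<^sup>/\<^sup>4\<close>. Against the factor \<open>e\<^sup>-\<^sup>s\<^sup>/\<^sup>2\<close> of the Laguerre
  functions this leaves a decay of \<open>e\<^sup>-\<^sup>s\<^sup>/\<^sup>4\<close>.\<close>

lemma poly_bound_exp:
  fixes p :: "real poly"
  obtains C where "C \<ge> 0" "\<And>s. s \<ge> 0 \<Longrightarrow> \<bar>poly p s\<bar> \<le> C * exp (s / 4)"
proof
  define C where "C = (\<Sum>i\<le>degree p. \<bar>coeff p i\<bar> * (4 ^ i * fact i))"
  show "C \<ge> 0" unfolding C_def by (intro sum_nonneg) auto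
  fix s :: real assume s: "s \<ge> 0"
  have "\<bar>poly p s\<bar> \<le> (\<Sum>i\<le>degree p. \<bar>coeff p i\<bar> * s ^ i)"
    unfolding poly_altdef using s by (intro order_trans[OF sum_abs]) (simp add: abs_mult)
  also have "\<dots> \<le> (\<Sum>i\<le>degree p. \<bar>coeff p i\<bar> * (4 ^ i * (fact i * exp (s / 4))))"
  proof (intro sum_mono mult_left_mono)
    fix i
    have "s ^ i = 4 ^ i * (s / 4) ^ i" by (simp add: power_divide)
    also have "\<dots> \<le> 4 ^ i * (fact i * exp (s / 4))"
      using s by (intro mult_left_mono power_le_exp) auto
    finally show "s ^ i \<le> 4 ^ i * (fact i * exp (s / 4))" .
  qed auto
  also have "\<dots> = C * exp (s / 4)"
    unfolding C_def sum_distrib_right by (simp add: mult.assoc)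
  finally show "\<bar>poly p s\<bar> \<le> C * exp (s / 4)" .
qed

lemma laguerre_fun_bound:
  obtains C where "C \<ge> 0" "\<And>s. \<bar>laguerre_fun k s\<bar> \<le> C * exp (- s / 4)"
proof -
  obtain C where C: "C \<ge> 0" "\<And>s. s \<ge> 0 \<Longrightarrow> \<bar>poly (laguerre_poly k) s\<bar> \<le> C * exp (s / 4)"
    using poly_bound_exp by blast
  have "\<bar>laguerre_fun k s\<bar> \<le> C * exp (- s / 4)" for s
  proof (cases "s > 0")
    case True
    then have "\<bar>laguerre_fun k s\<bar> = exp (- s / 2) * \<bar>poly (laguerre_poly k) s\<bar>"
      by (simp add: laguerre_fun_eq abs_mult)
    also have "\<dots> \<le> exp (- s / 2) * (C * exp (s / 4))"
      using True by (intro mult_left_mono C) auto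
    also have "\<dots> = C * exp (- s / 4)" by (simp add: mult.left_commute flip: exp_add)
    finally show ?thesis .
  next
    case False
    then show ?thesis using C(1) by (simp add: laguerre_fun_eq)
  qed
  then show thesis using that C(1) by blast
qed

definition exp_integral :: "real poly \<Rightarrow> real" where
  "exp_integral p = (LINT s|halfline. exp (- s) * poly p s)"

lemma sets_halfline[measurable_cong]: "sets halfline = sets (restrict_space borel {0<..})"
  unfolding halfline_def by (intro sets_restrict_space_cong) simp

lemma space_halfline[simp]: "space halfline = {0<..}"
  by (simp add: halfline_def space_restrict_space)

lemma borel_measurable_halflineI: "f \<in> borel_measurable borel \<Longrightarrow> f \<in> borel_measurable halfline"
  unfolding halfline_def by (intro measurable_restrict_space1) simp

lemma exp_integral_monom:
  "integrable halfline (\<lambda>s. exp (- s) * poly (monom a i) s)"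
  "exp_integral (monom a i) = a * fact i"
proof -
  have "has_bochner_integral lborel (\<lambda>s::real. indicator {0..} s *\<^sub>R (s ^ i * exp (- s))) (fact i)"
  proof (rule has_bochner_integral_nn_integral)
    show "(\<integral>\<^sup>+ s. ennreal (indicator {0..} s *\<^sub>R (s ^ i * exp (- s))) \<partial>lborel) = ennreal (fact i)"
      using nn_intergal_power_times_exp_Ici[of i]
      by (simp add: mult.commute indicator_mult_ennreal)
  qed (auto simp: indicator_def)
  then have "has_bochner_integral lborel (\<lambda>s::real. indicator {0<..} s *\<^sub>R (s ^ i * exp (- s))) (fact i)"
    by (rule has_bochner_integral_cong_AE[THEN iffD1, rotated 3])
       (auto simp: indicator_def intro!: AE_I'[of "{0}"])
  then have "has_bochner_integral halfline (\<lambda>s. s ^ i * exp (- s)) (fact i)"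
    unfolding halfline_def by (subst has_bochner_integral_restrict_space) auto
  from has_bochner_integral_mult_right[OF this, of a]
  have "has_bochner_integral halfline (\<lambda>s. exp (- s) * poly (monom a i) s) (a * fact i)"
    by (simp add: poly_monom mult_ac)
  then show "integrable halfline (\<lambda>s. exp (- s) * poly (monom a i) s)"
    "exp_integral (monom a i) = a * fact i"
    by (auto simp: has_bochner_integral_iff exp_integral_def)
qed

lemma integrable_exp_poly: "integrable halfline (\<lambda>s. exp (- s) * poly p s)"
proof -
  have "integrable halfline (\<lambda>s. \<Sum>i\<le>degree p. exp (- s) * poly (monom (coeff p i) i) s)"
    by (intro Bochner_Integration.integrable_sum exp_integral_monom)
  then show ?thesis
    by (simp only: poly_monom poly_altdef[of p] sum_distrib_left)
qed

lemma exp_integral_diff: "exp_integral (p - q) = exp_integral p - exp_integral q"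
  unfolding exp_integral_def
  by (simp add: right_diff_distrib Bochner_Integration.integral_diff integrable_exp_poly)

lemma exp_integral_add: "exp_integral (p + q) = exp_integral p + exp_integral q"
  unfolding exp_integral_def
  by (simp add: distrib_left Bochner_Integration.integral_add integrable_exp_poly)

lemma exp_integral_smult: "exp_integral (smult c p) = c * exp_integral p"
  unfolding exp_integral_def by (simp add: mult.left_commute)

lemma exp_integral_sum: "exp_integral (\<Sum>i\<in>A. f i) = (\<Sum>i\<in>A. exp_integral (f i))"
proof (induction A rule: infinite_finite_induct)
qed (auto simp: exp_integral_add, (simp add: exp_integral_def)+)

lemma pderiv_minus_sum: "pderiv_minus (\<Sum>i\<in>A. f i) = (\<Sum>i\<in>A. pderiv_minus (f i))"
  by (induction A rule: infinite_finite_induct) (auto simp: pderiv_minus_def pderiv_add)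

text \<open>The integrand is the derivative of \<open>e\<^sup>-\<^sup>s p(s)\<close>, which vanishes at infinity. For monomials the
  claim is the recursion of the factorial.\<close>

lemma exp_integral_pderiv_minus: "exp_integral (pderiv_minus p) = - poly p 0"
proof -
  have minus: "exp_integral (- q) = - exp_integral q" for q
    by (simp add: exp_integral_def)
  have mono: "exp_integral (pderiv_minus (monom a i)) = - poly (monom a i) 0" for a i
    by (cases i) (simp_all add: pderiv_minus_def exp_integral_diff pderiv_monom
        exp_integral_monom(2) poly_monom algebra_simps pderiv_0 minus)
  have "pderiv_minus p = (\<Sum>i\<le>degree p. pderiv_minus (monom (coeff p i) i))"
    unfolding pderiv_minus_sum[symmetric] poly_as_sum_of_monoms ..
  then have "exp_integral (pderiv_minus p) = (\<Sum>i\<le>degree p. - poly (monom (coeff p i) i) 0)"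
    by (simp add: exp_integral_sum mono)
  also have "\<dots> = - poly p 0"
    using poly_as_sum_of_monoms[of p] by (simp only: sum_negf flip: poly_sum)
  finally show ?thesis .
qed

lemma pderiv_minus_funpow_monom:
  "m \<le> k \<Longrightarrow> \<exists>u. (pderiv_minus ^^ m) (monom 1 k) = monom 1 (k - m) * u"
proof (induction m)
  case 0
  show ?case by (intro exI[of _ 1]) simp
next
  case (Suc m)
  then obtain u where u: "(pderiv_minus ^^ m) (monom 1 k) = monom 1 (k - m) * u" by auto
  obtain r where r: "k - m = Suc r" "k - Suc m = r" using Suc.prems by (cases "k - m") auto
  have "pderiv_minus (monom 1 (Suc r) * u) =
      monom 1 r * (smult (real (Suc r)) u + monom 1 1 * pderiv u - monom 1 1 * u)"
  proof -
    define X A :: "real poly" where "X = monom 1 1" and "A = monom 1 r"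
    have 1: "monom 1 (Suc r) = A * X" by (simp add: mult_monom X_def A_def)
    have 2: "pderiv (monom 1 (Suc r)) = smult (real (Suc r)) A"
      by (simp add: pderiv_monom smult_monom A_def)
    have "pderiv_minus (monom 1 (Suc r) * u) = A * X * pderiv u + u * smult (real (Suc r)) A - A * X * u"
      unfolding pderiv_minus_def pderiv_mult 2 unfolding 1 ..
    also have "\<dots> = A * (smult (real (Suc r)) u + X * pderiv u - X * u)"
      by (simp add: algebra_simps)
    finally show ?thesis by (simp only: X_def A_def)
  qed
  then show ?case using u r by auto
qed

text \<open>Integration by parts: every factor \<open>d/ds\<close> in Rodrigues' formula moves to the other
  factor, the boundary terms vanishing because \<open>s\<^sup>k\<close> has a zero of order \<open>k\<close> at the origin.\<close>

lemma exp_integral_by_parts: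
  "m \<le> k \<Longrightarrow> exp_integral ((pderiv_minus ^^ m) (monom 1 k) * q) =
    (-1) ^ m * exp_integral (monom 1 k * (pderiv ^^ m) q)"
proof (induction m arbitrary: q)
  case (Suc m)
  define r where "r = (pderiv_minus ^^ m) (monom 1 k)"
  have r0: "poly r 0 = 0"
    using pderiv_minus_funpow_monom[of m k] Suc.prems by (auto simp: r_def poly_monom)
  have "pderiv_minus r * q = pderiv_minus (r * q) - r * pderiv q"
    by (simp add: pderiv_minus_def pderiv_mult algebra_simps)
  then have "exp_integral (pderiv_minus r * q) = - exp_integral (r * pderiv q)"
    by (simp add: exp_integral_diff exp_integral_pderiv_minus r0)
  also have "exp_integral (r * pderiv q) = (-1) ^ m * exp_integral (monom 1 k * (pderiv ^^ m) (pderiv q))"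
    using Suc by (simp add: r_def)
  finally show ?case unfolding funpow_Suc_right[of m pderiv] by (simp add: r_def)
qed simp

lemma coeff_pderiv_minus_funpow:
  assumes "degree p \<le> k"
  shows "degree ((pderiv_minus ^^ m) p) \<le> k \<and> coeff ((pderiv_minus ^^ m) p) k = (-1) ^ m * coeff p k"
proof (induction m)
  case (Suc m)
  define r where "r = (pderiv_minus ^^ m) p"
  have IH: "degree r \<le> k" "coeff r k = (-1) ^ m * coeff p k" using Suc by (auto simp: r_def)
  have "degree (pderiv_minus r) \<le> k"
    unfolding pderiv_minus_def using IH by (intro degree_diff_le) (auto simp: degree_pderiv)
  moreover have "coeff (pderiv_minus r) k = - coeff r k"
    using IH coeff_eq_0[of r "Suc k"] by (simp add: pderiv_minus_def coeff_pderiv)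
  ultimately show ?case using IH by (simp add: r_def)
qed (use assms in simp)

text \<open>Integrating by parts \<open>k\<close> times differentiates the second polynomial \<open>k\<close> times, which kills it
  in degree less than \<open>k\<close> and leaves its leading coefficient in degree \<open>k\<close>.\<close>

lemma exp_integral_laguerre:
  assumes "j \<le> k"
  shows "exp_integral (laguerre_poly k * laguerre_poly j) = (if j = k then 1 else 0)"
proof -
  define q where "q = laguerre_poly j"
  have q: "degree q \<le> j" "coeff q j = (-1) ^ j / fact j"
    using coeff_pderiv_minus_funpow[of "monom 1 j" j j]
    by (auto simp: q_def laguerre_poly_def degree_monom_eq)
  have "(pderiv ^^ k) q = [: fact k * coeff q k :]"
  proof (rule poly_eqI)
    fix i
    show "coeff ((pderiv ^^ k) q) i = coeff [: fact k * coeff q k :] i"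
      using q(1) assms
      by (cases i) (auto simp: coeff_higher_pderiv coeff_eq_0 pochhammer_fact)
  qed
  then have "exp_integral (laguerre_poly k * q) =
      1 / fact k * ((-1) ^ k * exp_integral (monom 1 k * [: fact k * coeff q k :]))"
    using exp_integral_by_parts[of k k q] by (simp add: laguerre_poly_def exp_integral_smult)
  also have "monom 1 k * [: fact k * coeff q k :] = monom (fact k * coeff q k) k"
    by (simp add: smult_monom mult.commute)
  finally have "exp_integral (laguerre_poly k * q) = (-1) ^ k * (fact k * coeff q k)"
    by (simp add: exp_integral_monom(2))
  also have "\<dots> = (if j = k then 1 else 0)"
  proof (cases "j = k")
    case True
    have "(-1) ^ k * (-1) ^ k = (1::real)" by (simp only: power_mult_distrib[symmetric]) simp
    then show ?thesis using q True by simp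
  next
    case False
    then have "degree q < k" using q assms by simp
    then show ?thesis using False by (simp add: coeff_eq_0)
  qed
  finally show ?thesis by (simp add: q_def)
qed

lemma laguerre_fun_mult:
  assumes "s \<in> {0<..}"
  shows "laguerre_fun j s * laguerre_fun k s =
    (-1) ^ (j + k) * (exp (- s) * poly (laguerre_poly k * laguerre_poly j) s)"
proof -
  have "exp (- s / 2) * exp (- s / 2) = exp (- s)" by (simp flip: exp_add)
  then show ?thesis using assms
    by (simp add: laguerre_fun_eq power_add algebra_simps)
qed

lemma integrable_laguerre_fun_mult: "integrable halfline (\<lambda>s. laguerre_fun j s * laguerre_fun k s)"
  using integrable_mult_right[OF integrable_exp_poly[of "laguerre_poly k * laguerre_poly j"], of "(-1) ^ (j + k)"]
  by (subst Bochner_Integration.integrable_cong[OF refl laguerre_fun_mult]) auto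

lemma laguerre_fun_orthonormal:
  "(LINT s|halfline. laguerre_fun j s * laguerre_fun k s) = (if j = k then 1 else 0)"
proof -
  have "(LINT s|halfline. laguerre_fun j s * laguerre_fun k s) =
      (-1) ^ (j + k) * exp_integral (laguerre_poly k * laguerre_poly j)"
    by (subst Bochner_Integration.integral_cong[OF refl laguerre_fun_mult])
       (auto simp: exp_integral_def)
  also have "\<dots> = (if j = k then 1 else 0)"
    using exp_integral_laguerre[of j k] exp_integral_laguerre[of k j]
    by (cases "j \<le> k") (auto simp: mult.commute simp flip: mult_2)
  finally show ?thesis .
qed

section \<open>Plancherel's theorem\<close>

text \<open>Fubini for a bounded kernel between two integrable functions. The proof of Plancherel's theorem
  applies it to plane waves twice and to translates of a bounded function once.\<close>

lemma integral_swap_kernel: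
  fixes f g :: "real \<Rightarrow> complex" and k :: "real \<Rightarrow> real \<Rightarrow> complex"
  assumes f: "integrable lborel f" and g: "integrable lborel g"
    and k[measurable]: "(\<lambda>(x, y). k x y) \<in> borel_measurable (lborel \<Otimes>\<^sub>M lborel)"
    and bound: "\<And>x y. cmod (k x y) \<le> C"
  shows "(LINT x|lborel. f x * (LINT y|lborel. k x y * g y)) =
    (LINT y|lborel. g y * (LINT x|lborel. k x y * f x))"
proof -
  have [measurable]: "f \<in> borel_measurable lborel" "g \<in> borel_measurable lborel"
    using f g by auto
  have C: "0 \<le> C" using bound[of 0 0] norm_ge_zero order_trans by blast
  have int: "integrable (lborel \<Otimes>\<^sub>M lborel) (\<lambda>(x, y). f x * (k x y * g y))"
  proof (rule integrableI_bounded)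
    have "(\<integral>\<^sup>+ p. norm (case p of (x, y) \<Rightarrow> f x * (k x y * g y)) \<partial>(lborel \<Otimes>\<^sub>M lborel)) =
        (\<integral>\<^sup>+ x. \<integral>\<^sup>+ y. norm (f x * (k x y * g y)) \<partial>lborel \<partial>lborel)"
      by (subst lborel.nn_integral_fst[symmetric]) auto
    also have "\<dots> \<le> (\<integral>\<^sup>+ x. \<integral>\<^sup>+ y. ennreal (C * norm (f x)) * ennreal (norm (g y)) \<partial>lborel \<partial>lborel)"
    proof (intro nn_integral_mono)
      fix x y
      have "norm (k x y) * (norm (f x) * norm (g y)) \<le> C * (norm (f x) * norm (g y))"
        using bound by (intro mult_right_mono) auto
      then show "ennreal (norm (f x * (k x y * g y))) \<le> ennreal (C * norm (f x)) * ennreal (norm (g y))"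
        using C by (simp add: norm_mult ac_simps flip: ennreal_mult)
    qed
    also have "\<dots> = ennreal C * (\<integral>\<^sup>+ x. norm (f x) \<partial>lborel) * (\<integral>\<^sup>+ y. norm (g y) \<partial>lborel)"
      using C by (simp add: nn_integral_cmult nn_integral_multc ennreal_mult)
    also have "\<dots> < \<infinity>"
      using f g by (auto simp: integrable_iff_bounded ennreal_mult_less_top)
    finally show "(\<integral>\<^sup>+ p. norm (case p of (x, y) \<Rightarrow> f x * (k x y * g y)) \<partial>(lborel \<Otimes>\<^sub>M lborel)) < \<infinity>" .
  qed measurable
  have "(LINT x|lborel. f x * (LINT y|lborel. k x y * g y)) =
      (LINT x|lborel. LINT y|lborel. f x * (k x y * g y))"
    by simp
  also have "\<dots> = (LINT y|lborel. LINT x|lborel. f x * (k x y * g y))"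
    using lborel_pair.Fubini_integral[OF int] by simp
  also have "\<dots> = (LINT y|lborel. LINT x|lborel. g y * (k x y * f x))"
    by (simp only: ac_simps)
  finally show ?thesis by simp
qed

definition fourier :: "(real \<Rightarrow> complex) \<Rightarrow> real \<Rightarrow> complex" where
  "fourier G x = (LINT t|lborel. iexp (t * x) * G t)"

lemma fourier_bound: "cmod (fourier G x) \<le> (LINT t|lborel. cmod (G t))"
  unfolding fourier_def
  by (rule order_trans[OF integral_norm_bound]) (simp add: norm_mult)

lemma borel_measurable_fourier:
  assumes [measurable]: "G \<in> borel_measurable borel"
  shows "fourier G \<in> borel_measurable borel"
proof -
  have "(\<lambda>x. LINT t|lborel. iexp (t * x) * G t) \<in> borel_measurable borel"
    by (intro lborel.borel_measurable_lebesgue_integral) measurable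
  then show ?thesis by (simp add: fourier_def[abs_def])
qed

definition translation_dist :: "(real \<Rightarrow> complex) \<Rightarrow> real \<Rightarrow> real" where
  "translation_dist f u = (LINT t|lborel. cmod (f (u + t) - f t))"

lemma integrable_translate:
  fixes f :: "real \<Rightarrow> complex"
  shows "integrable lborel f \<Longrightarrow> integrable lborel (\<lambda>t. f (u + t))"
  using lborel_integrable_real_affine[of f 1 u] by simp

lemma integral_translate:
  fixes f :: "real \<Rightarrow> 'b :: {banach, second_countable_topology}"
  shows "(LINT t|lborel. f (u + t)) = (LINT t|lborel. f t)"
  using lborel_integral_real_affine[of 1 f u] by simp

text \<open>For an open set \<open>U\<close> the differences \<open>\<chi>\<^sub>U(t) - \<chi>\<^sub>U(u + t)\<close> have integral zero, and their positive
  parts tend to zero pointwise as \<open>u \<rightarrow> 0\<close>, precisely because \<open>U\<close> is open.\<close>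

lemma translation_dist_open:
  assumes "open U" "emeasure lborel U < \<infinity>" and X: "X \<longlonglongrightarrow> 0"
  shows "(\<lambda>n. translation_dist (indicator U) (X n)) \<longlonglongrightarrow> 0"
proof -
  have [measurable]: "U \<in> sets borel" using assms by auto
  have int: "integrable lborel (indicator U :: real \<Rightarrow> real)"
    using assms by (auto simp: integrable_indicator_iff)
  have intu: "integrable lborel (\<lambda>t. indicator U (u + t) :: real)" for u
    using lborel_integrable_real_affine[OF int, of 1 u] by simp
  \<comment> \<open>The positive part is dominated by \<open>\<chi>\<^sub>U\<close>, the negative part is not.\<close>
  define p where "p u t = max 0 (indicator U t - indicator U (u + t) :: real)" for u t
  have p_int: "integrable lborel (p u)" for u
    unfolding p_def[abs_def] by (intro integrable_max Bochner_Integration.integrable_diff int intu) auto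
  have eq: "translation_dist (indicator U) u = 2 * (LINT t|lborel. p u t)" for u
  proof -
    have "translation_dist (indicator U) u =
        (LINT t|lborel. 2 * p u t - (indicator U t - indicator U (u + t)))"
      unfolding translation_dist_def
      by (intro Bochner_Integration.integral_cong) (auto simp: p_def indicator_def)
    also have "\<dots> = 2 * (LINT t|lborel. p u t) -
        ((LINT t|lborel. indicator U t) - (LINT t|lborel. indicator U (u + t)))"
      using p_int int intu by simp
    finally show ?thesis by (simp add: integral_translate)
  qed
  have "(\<lambda>n. LINT t|lborel. p (X n) t) \<longlonglongrightarrow> (LINT t|(lborel::real measure). 0)"
  proof (rule integral_dominated_convergence[where w = "indicator U"])
    show "AE t in lborel. (\<lambda>n. p (X n) t) \<longlonglongrightarrow> 0"
    proof (rule AE_I2)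
      fix t :: real
      show "(\<lambda>n. p (X n) t) \<longlonglongrightarrow> 0"
      proof (cases "t \<in> U")
        case True
        have "(\<lambda>n. X n + t) \<longlonglongrightarrow> 0 + t" by (intro tendsto_intros X)
        then have "\<forall>\<^sub>F n in sequentially. X n + t \<in> U"
          using topological_tendstoD[OF _ \<open>open U\<close>, of _ t] True by auto
        then have "\<forall>\<^sub>F n in sequentially. p (X n) t = 0"
          by eventually_elim (use True in \<open>simp add: p_def\<close>)
        then show ?thesis by (rule tendsto_eventually)
      qed (simp add: p_def)
    qed
    show "AE t in lborel. norm (p (X n) t) \<le> indicator U t" for n
      by (rule AE_I2) (auto simp: p_def indicator_def)
  qed (use int p_int in \<open>auto\<close>)
  from tendsto_mult_left[OF this, of 2] show ?thesis by (simp add: eq)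
qed

lemma translation_dist_approx:
  assumes f: "integrable lborel f" and s: "integrable lborel s"
  shows "translation_dist f u \<le> translation_dist s u + 2 * (LINT t|lborel. cmod (f t - s t))"
proof -
  note int = f s integrable_translate[OF f, of u] integrable_translate[OF s, of u]
  have "translation_dist f u \<le> (LINT t|lborel. cmod (s (u + t) - s t) +
      (cmod (f (u + t) - s (u + t)) + cmod (f t - s t)))"
    unfolding translation_dist_def
  proof (rule integral_mono)
    fix t
    show "cmod (f (u + t) - f t) \<le> cmod (s (u + t) - s t) +
        (cmod (f (u + t) - s (u + t)) + cmod (f t - s t))"
      by norm
  qed (use int in auto)
  also have "\<dots> = translation_dist s u +
      ((LINT t|lborel. cmod (f (u + t) - s (u + t))) + (LINT t|lborel. cmod (f t - s t)))"
    using int by (simp add: translation_dist_def)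
  also have "(LINT t|lborel. cmod (f (u + t) - s (u + t))) = (LINT t|lborel. cmod (f t - s t))"
    by (rule integral_translate[of "\<lambda>t. cmod (f t - s t)"])
  finally show ?thesis by simp
qed

lemma translation_dist_limit:
  assumes f: "integrable lborel f" and X: "X \<longlonglongrightarrow> 0"
    and approx: "\<And>e. e > 0 \<Longrightarrow> \<exists>s. integrable lborel s \<and>
      (LINT t|lborel. cmod (f t - s t)) \<le> e \<and> (\<lambda>n. translation_dist s (X n)) \<longlonglongrightarrow> 0"
  shows "(\<lambda>n. translation_dist f (X n)) \<longlonglongrightarrow> 0"
proof (rule LIMSEQ_I)
  fix r :: real assume r: "r > 0"
  obtain s where s: "integrable lborel s" "(LINT t|lborel. cmod (f t - s t)) \<le> r / 4"
    "(\<lambda>n. translation_dist s (X n)) \<longlonglongrightarrow> 0"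
    using approx[of "r / 4"] r by auto
  from LIMSEQ_D[OF s(3), of "r / 2"] r obtain N where N: "\<And>n. n \<ge> N \<Longrightarrow> norm (translation_dist s (X n)) < r / 2"
    by auto
  have "norm (translation_dist f (X n) - 0) < r" if "n \<ge> N" for n
    using N[OF that] translation_dist_approx[OF f s(1), of "X n"] s(2)
    by (simp add: translation_dist_def)
  then show "\<exists>no. \<forall>n\<ge>no. norm (translation_dist f (X n) - 0) < r" by blast
qed

lemma integrable_indicator_complex:
  assumes "A \<in> sets M" "emeasure M A < \<infinity>"
  shows "integrable M (indicator A :: _ \<Rightarrow> complex)"
proof -
  have "integrable M (\<lambda>t. complex_of_real (indicator A t))"
    using assms by (intro integrable_of_real integrable_real_indicator)
  then show ?thesis by (simp add: of_real_indicator)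
qed

text \<open>Lebesgue measure is outer regular, so \<open>\<chi>\<^sub>A\<close> lies within any \<open>e\<close> of the indicator of an open set.\<close>

lemma translation_dist_indicator:
  assumes [measurable]: "A \<in> sets lborel" and fin: "emeasure lborel A < \<infinity>" and X: "X \<longlonglongrightarrow> 0"
  shows "(\<lambda>n. translation_dist (indicator A) (X n)) \<longlonglongrightarrow> 0"
proof (rule translation_dist_limit[OF _ X])
  show "integrable lborel (indicator A :: real \<Rightarrow> complex)"
    using assms(1) fin by (rule integrable_indicator_complex)
  fix e :: real assume e: "e > 0"
  have "A \<in> sets lebesgue" using assms by auto
  then obtain U where U: "open U" "A \<subseteq> U" "U - A \<in> lmeasurable" "emeasure lebesgue (U - A) < ennreal e"
    using sets_lebesgue_outer_open[of A e] e by blast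
  have [measurable]: "U \<in> sets borel" "A \<in> sets borel" using U assms by auto
  have diff: "emeasure lborel (U - A) < ennreal e"
  proof -
    have "U - A \<in> sets lborel" by measurable
    then show ?thesis using U(4) by simp
  qed
  have "emeasure lborel U = emeasure lborel A + emeasure lborel (U - A)"
    using U(2) by (subst plus_emeasure) (auto simp: Un_absorb1)
  then have Ufin: "emeasure lborel U < \<infinity>"
    using fin diff by (metis ennreal_add_eq_top infinity_ennreal_def less_top order_less_trans)
  have "(LINT t|lborel. cmod (indicator A t - indicator U t)) = (LINT t|lborel. indicator (U - A) t)"
    using U(2) by (intro Bochner_Integration.integral_cong) (auto simp: indicator_def)
  also have "\<dots> = measure lborel (U - A)" by simp
  also have "\<dots> \<le> e"
    using diff e by (simp add: measure_def enn2real_leI less_imp_le)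
  finally have "(LINT t|lborel. cmod (indicator A t - indicator U t)) \<le> e" .
  then show "\<exists>s. integrable lborel s \<and> (LINT t|lborel. cmod (indicator A t - s t)) \<le> e \<and>
      (\<lambda>n. translation_dist s (X n)) \<longlonglongrightarrow> 0"
    using translation_dist_open[OF U(1) Ufin X] Ufin
    by (intro exI[of _ "indicator U"]) (auto intro: integrable_indicator_complex)
qed

text \<open>Translation is continuous in \<open>L\<^sub>1\<close>: the property passes from indicator functions to linear
  combinations and to \<open>L\<^sub>1\<close> limits.\<close>

lemma translation_dist_tendsto_zero:
  assumes "integrable lborel f" and X: "X \<longlonglongrightarrow> 0"
  shows "(\<lambda>n. translation_dist f (X n)) \<longlonglongrightarrow> 0"
  using assms(1)
proof (induction rule: integrable_induct)
  case (base A c)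
  have "translation_dist (\<lambda>t. indicator A t *\<^sub>R c) u = cmod c * translation_dist (indicator A) u" for u
  proof -
    have "translation_dist (\<lambda>t. indicator A t *\<^sub>R c) u =
        (LINT t|lborel. cmod c * cmod (indicator A (u + t) - indicator A t))"
      unfolding translation_dist_def
      by (intro Bochner_Integration.integral_cong) (auto simp: indicator_def)
    then show ?thesis by (simp add: translation_dist_def)
  qed
  then show ?case
    using tendsto_mult_left[OF translation_dist_indicator[OF base X], of "cmod c"] by simp
next
  case (add f g)
  have le: "translation_dist (\<lambda>x. f x + g x) u \<le> translation_dist f u + translation_dist g u" for u
  proof -
    note int = add(1,2) integrable_translate[OF add(1), of u] integrable_translate[OF add(2), of u]
    have "translation_dist (\<lambda>x. f x + g x) u \<le>
        (LINT t|lborel. cmod (f (u + t) - f t) + cmod (g (u + t) - g t))"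
      unfolding translation_dist_def
    proof (rule integral_mono)
      fix t
      show "cmod (f (u + t) + g (u + t) - (f t + g t)) \<le> cmod (f (u + t) - f t) + cmod (g (u + t) - g t)"
        by norm
    qed (use int in auto)
    also have "\<dots> = translation_dist f u + translation_dist g u"
      using int by (simp add: translation_dist_def)
    finally show ?thesis .
  qed
  show ?case
  proof (rule tendsto_sandwich[OF _ _ tendsto_const])
    show "(\<lambda>n. translation_dist f (X n) + translation_dist g (X n)) \<longlonglongrightarrow> 0"
      using tendsto_add[OF add(3,4)] by simp
  qed (use le in \<open>simp_all add: translation_dist_def\<close>)
next
  case (lim f s)
  have "(\<lambda>i. LINT t|lborel. cmod (f t - s i t)) \<longlonglongrightarrow> (LINT t|(lborel::real measure). 0)"
  proof (rule integral_dominated_convergence[where w = "\<lambda>t. 3 * cmod (f t)"])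
    show "AE t in lborel. (\<lambda>i. cmod (f t - s i t)) \<longlonglongrightarrow> 0"
    proof (rule AE_I2)
      fix t
      have "(\<lambda>i. cmod (f t - s i t)) \<longlonglongrightarrow> cmod (f t - f t)"
        using lim(2) by (intro tendsto_intros) auto
      then show "(\<lambda>i. cmod (f t - s i t)) \<longlonglongrightarrow> 0" by simp
    qed
    show "AE t in lborel. norm (cmod (f t - s i t)) \<le> 3 * cmod (f t)" for i
    proof (rule AE_I2)
      fix t
      have "cmod (f t - s i t) \<le> cmod (f t) + cmod (s i t)" by norm
      also have "cmod (s i t) \<le> 2 * cmod (f t)" using lim(3)[of t i] by simp
      finally show "norm (cmod (f t - s i t)) \<le> 3 * cmod (f t)" by simp
    qed
  qed (use lim in auto)
  then have conv: "(\<lambda>i. LINT t|lborel. cmod (f t - s i t)) \<longlonglongrightarrow> 0" by simp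
  show ?case
  proof (rule translation_dist_limit[OF lim(4) X])
    fix e :: real assume "e > 0"
    from order_tendstoD(2)[OF conv this] obtain i where "(LINT t|lborel. cmod (f t - s i t)) < e"
      by (auto simp: eventually_sequentially)
    then show "\<exists>s. integrable lborel s \<and> (LINT t|lborel. cmod (f t - s t)) \<le> e \<and>
      (\<lambda>n. translation_dist s (X n)) \<longlonglongrightarrow> 0"
      using lim(1,5) by (intro exI[of _ "s i"]) (auto intro: less_imp_le)
  qed
qed

lemma fourier_gaussian:
  assumes "d > 0"
  shows "(LINT x|lborel. iexp (u * x) * exp (- (d * x)\<^sup>2 / 2)) =
    of_real (2 * pi / d * std_normal_density (u / d))"
proof -
  have "char std_normal_distribution (u / d) =
      (LINT y|lborel. std_normal_density y *\<^sub>R iexp (u / d * y))"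
    unfolding char_def by (rule integral_density) (auto simp: normal_density_nonneg)
  also have "\<dots> = d *\<^sub>R (LINT x|lborel. std_normal_density (d * x) *\<^sub>R iexp (u / d * (d * x)))"
    using assms by (subst lborel_integral_real_affine[of d _ 0]) auto
  also have "\<dots> = d *\<^sub>R (LINT x|lborel. of_real (1 / sqrt (2 * pi)) * (iexp (u * x) * exp (- (d * x)\<^sup>2 / 2)))"
    using assms by (simp add: std_normal_density_def scaleR_conv_of_real mult_ac exp_of_real)
  also have "\<dots> = of_real (d / sqrt (2 * pi)) * (LINT x|lborel. iexp (u * x) * exp (- (d * x)\<^sup>2 / 2))"
    by (simp add: scaleR_conv_of_real)
  finally have "(LINT x|lborel. iexp (u * x) * exp (- (d * x)\<^sup>2 / 2)) =
      of_real (sqrt (2 * pi) / d * exp (- ((u / d)\<^sup>2) / 2))"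
    using assms by (simp add: char_std_normal_distribution field_simps)
  also have "sqrt (2 * pi) / d * exp (- ((u / d)\<^sup>2) / 2) = 2 * pi / d * std_normal_density (u / d)"
  proof -
    have "2 * pi / d * std_normal_density (u / d) = (2 * pi / sqrt (2 * pi)) / d * exp (- ((u / d)\<^sup>2) / 2)"
      by (simp add: std_normal_density_def)
    also have "2 * pi / sqrt (2 * pi) = sqrt (2 * pi)" by (rule real_div_sqrt) simp
    finally show ?thesis by (rule sym)
  qed
  finally show ?thesis .
qed

text \<open>A Gaussian weight makes the double integral behind \<open>|F(x)|\<^sup>2\<close> absolutely convergent in \<open>x\<close> as
  well. Integrating over \<open>x\<close> first replaces the plane waves by the Fourier transform of the weight,
  a Gaussian of width \<open>d\<close>, so that an average of the autocorrelation of \<open>G\<close> over shifts of size \<open>d\<close>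
  remains.\<close>

lemma gaussian_average_fourier:
  assumes G: "integrable lborel G" and d: "d > 0" and B: "\<And>t. cmod (G t) \<le> B"
  shows "(LINT x|lborel. of_real (exp (- (d * x)\<^sup>2 / 2) * (cmod (fourier G x))\<^sup>2)) =
    of_real (2 * pi) * (LINT v|lborel. of_real (std_normal_density v) *
      (LINT t|lborel. G (t + d * v) * cnj (G t)))"
proof -
  have [measurable]: "G \<in> borel_measurable borel" using G by auto
  note [measurable] = borel_measurable_fourier[of G]
  define w where "w x = complex_of_real (exp (- (d * x)\<^sup>2 / 2))" for x
  have [measurable]: "w \<in> borel_measurable borel" unfolding w_def by measurable
  have nint: "integrable lborel (\<lambda>v. complex_of_real (std_normal_density v))"
    by (intro integrable_of_real integrable_normal_density) simp
  have w_eq: "w x = of_real (sqrt (2 * pi)) * of_real (std_normal_density (0 + d * x))" for x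
  proof -
    have "exp (- (d * x)\<^sup>2 / 2) = sqrt (2 * pi) * std_normal_density (0 + d * x)"
      by (simp add: std_normal_density_def)
    then show ?thesis by (simp only: w_def of_real_mult)
  qed
  have w_int: "integrable lborel w"
    unfolding w_eq[abs_def] using d
    by (intro integrable_mult_right lborel_integrable_real_affine nint) auto
  have wF_int: "integrable lborel (\<lambda>x. w x * fourier G x)"
  proof (rule Bochner_Integration.integrable_bound)
    show "integrable lborel (\<lambda>x. w x * of_real (LINT t|lborel. cmod (G t)))"
      using w_int by simp
    show "AE x in lborel. norm (w x * fourier G x) \<le> norm (w x * of_real (LINT t|lborel. cmod (G t)))"
      using fourier_bound[of G] by (auto simp: norm_mult intro!: mult_left_mono)
  qed measurable
  have cG_int: "integrable lborel (\<lambda>t. cnj (G t))" using G by simp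
  have cnj_F: "cnj (fourier G x) = (LINT t|lborel. iexp (- (t * x)) * cnj (G t))" for x
    unfolding fourier_def Bochner_Integration.integral_cnj[symmetric]
    by (simp add: exp_cnj)
  have inner: "(LINT x|lborel. iexp (- (t * x)) * (w x * fourier G x)) =
      of_real (2 * pi) * (LINT v|lborel. G (t + d * v) * of_real (std_normal_density v))" for t
  proof -
    have int1: "integrable lborel (\<lambda>x. iexp (- (t * x)) * w x)"
      by (rule Bochner_Integration.integrable_bound[OF w_int]) (auto simp: norm_mult)
    have iexp_diff: "iexp (s * x) * (iexp (- (t * x)) * w x) = iexp ((s - t) * x) * w x" for s x
    proof -
      have "iexp ((s - t) * x) = iexp (s * x) * iexp (- (t * x))"
        by (subst exp_add[symmetric]) (simp add: algebra_simps)
      then show ?thesis by (simp only: mult.assoc)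
    qed
    have "(LINT x|lborel. iexp (- (t * x)) * (w x * fourier G x)) =
        (LINT x|lborel. (iexp (- (t * x)) * w x) * (LINT s|lborel. iexp (s * x) * G s))"
      by (simp add: fourier_def mult.assoc)
    also have "\<dots> = (LINT s|lborel. G s * (LINT x|lborel. iexp (s * x) * (iexp (- (t * x)) * w x)))"
      by (rule integral_swap_kernel[OF int1 G, where C = 1]) auto
    also have "\<dots> = (LINT s|lborel. G s * (LINT x|lborel. iexp ((s - t) * x) * w x))"
      by (simp only: iexp_diff)
    also have "\<dots> = (LINT s|lborel. G s * of_real (2 * pi / d * std_normal_density ((s - t) / d)))"
      by (simp only: w_def fourier_gaussian[OF d])
    also have "\<dots> = d *\<^sub>R (LINT v|lborel. G (t + d * v) *
        of_real (2 * pi / d * std_normal_density v))"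
      using d by (subst lborel_integral_real_affine[of d _ t]) auto
    also have "\<dots> = (LINT v|lborel. of_real d * (G (t + d * v) *
        of_real (2 * pi / d * std_normal_density v)))"
      by (simp only: scaleR_conv_of_real integral_mult_right_zero)
    also have "\<dots> = (LINT v|lborel. of_real (2 * pi) * (G (t + d * v) * of_real (std_normal_density v)))"
      using d by (intro Bochner_Integration.integral_cong) auto
    finally show ?thesis by simp
  qed
  have "(LINT x|lborel. of_real (exp (- (d * x)\<^sup>2 / 2) * (cmod (fourier G x))\<^sup>2)) =
      (LINT x|lborel. (w x * fourier G x) * (LINT t|lborel. iexp (- (t * x)) * cnj (G t)))"
    by (intro Bochner_Integration.integral_cong)
       (simp_all only: w_def mult.assoc complex_norm_square of_real_mult cnj_F[symmetric])
  also have "\<dots> = (LINT t|lborel. cnj (G t) * (LINT x|lborel. iexp (- (t * x)) * (w x * fourier G x)))"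
    by (rule integral_swap_kernel[OF wF_int cG_int, where C = 1]) auto
  also have "\<dots> = of_real (2 * pi) * (LINT t|lborel. cnj (G t) *
      (LINT v|lborel. G (t + d * v) * of_real (std_normal_density v)))"
    by (simp only: inner mult.left_commute[where a = "of_real (2 * pi)"] integral_mult_right_zero)
  also have "(LINT t|lborel. cnj (G t) * (LINT v|lborel. G (t + d * v) * of_real (std_normal_density v))) =
      (LINT v|lborel. of_real (std_normal_density v) * (LINT t|lborel. G (t + d * v) * cnj (G t)))"
    by (rule integral_swap_kernel[OF cG_int nint, where C = B]) (use B in auto)
  finally show ?thesis .
qed

lemma autocorrelation_integrable:
  fixes G :: "real \<Rightarrow> complex"
  assumes G: "integrable lborel G" and B: "\<And>t. cmod (G t) \<le> B"
  shows "integrable lborel (\<lambda>t. G (t + u) * cnj (G t))"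
proof -
  have [measurable]: "G \<in> borel_measurable borel" using G by auto
  show ?thesis
    by (rule Bochner_Integration.integrable_bound[of _ "\<lambda>t. of_real B * G t"])
       (use G B[THEN order_trans[OF _ abs_ge_self]] in \<open>auto simp: norm_mult intro!: mult_mono\<close>)
qed

text \<open>Boundedness of \<open>G\<close> reduces the claim to the continuity of translation in \<open>L\<^sub>1\<close>.\<close>

lemma autocorrelation_tendsto:
  fixes G :: "real \<Rightarrow> complex"
  assumes G: "integrable lborel G" and B: "\<And>t. cmod (G t) \<le> B" and X: "X \<longlonglongrightarrow> 0"
  shows "(\<lambda>n. LINT t|lborel. G (t + X n) * cnj (G t)) \<longlonglongrightarrow> (LINT t|lborel. G t * cnj (G t))"
proof -
  have [measurable]: "G \<in> borel_measurable borel" using G by auto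
  note int = autocorrelation_integrable[OF G B]
  have bound: "norm ((LINT t|lborel. G (t + u) * cnj (G t)) - (LINT t|lborel. G t * cnj (G t)))
      \<le> translation_dist G u * B" for u
  proof -
    have intu: "integrable lborel (\<lambda>t. cmod (G (u + t) - G t))"
      using integrable_translate[OF G] G by auto
    have "(LINT t|lborel. G (t + u) * cnj (G t)) - (LINT t|lborel. G t * cnj (G t)) =
        (LINT t|lborel. G (t + u) * cnj (G t) - G t * cnj (G t))"
      using int[of u] int[of 0] by simp
    also have "\<dots> = (LINT t|lborel. (G (u + t) - G t) * cnj (G t))"
      by (simp add: left_diff_distrib add.commute)
    also have "norm \<dots> \<le> (LINT t|lborel. cmod ((G (u + t) - G t) * cnj (G t)))"
      by (rule integral_norm_bound)
    also have "\<dots> \<le> (LINT t|lborel. cmod (G (u + t) - G t) * B)"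
    proof (rule integral_mono)
      show "integrable lborel (\<lambda>t. cmod ((G (u + t) - G t) * cnj (G t)))"
        using int[of u] int[of 0] by (auto simp: left_diff_distrib add.commute)
    qed (use intu B in \<open>auto simp: norm_mult intro!: mult_left_mono\<close>)
    also have "\<dots> = translation_dist G u * B" by (simp add: translation_dist_def)
    finally show ?thesis .
  qed
  have "(\<lambda>n. (LINT t|lborel. G (t + X n) * cnj (G t)) - (LINT t|lborel. G t * cnj (G t))) \<longlonglongrightarrow> 0"
    by (rule Lim_null_comparison[OF always_eventually tendsto_mult_left_zero[OF
          translation_dist_tendsto_zero[OF G X], of B]]) (use bound in auto)
  then show ?thesis by (simp add: LIM_zero_iff)
qed

text \<open>As the width \<open>d\<close> of the Gaussian average tends to zero, the left-hand side of
  \<open>gaussian_average_fourier\<close> increases to \<open>\<integral> |F|\<^sup>2\<close>, where \<open>F\<close> is the transform, and the right-hand side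
  tends to the autocorrelation at shift zero, which is \<open>\<integral> |G|\<^sup>2\<close>.\<close>

theorem plancherel_bounded:
  assumes G: "integrable lborel G" and B: "\<And>t. cmod (G t) \<le> B"
  shows "sq_norm lborel (fourier G) = ennreal (2 * pi) * sq_norm lborel G"
proof -
  have [measurable]: "G \<in> borel_measurable borel" using G by auto
  note [measurable] = borel_measurable_fourier[of G]
  have GL2: "G \<in> L2 lborel" using G B by (rule L2_bounded_integrable)
  define d where "d n = inverse (real (Suc n))" for n
  have d: "d n > 0" "d \<longlonglongrightarrow> 0" for n
    unfolding d_def[abs_def] using LIMSEQ_inverse_real_of_nat by auto
  let ?I = "LINT t|lborel. cmod (G t)"
  let ?n = "\<lambda>n x. sqrt (2 * pi) * std_normal_density (0 + d n * x)"
  define f where "f n x = exp (- (d n * x)\<^sup>2 / 2) * (cmod (fourier G x))\<^sup>2" for n x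
  have [measurable]: "f n \<in> borel_measurable borel" for n unfolding f_def by measurable
  define A where "A u = (LINT t|lborel. G (t + u) * cnj (G t))" for u
  define L where "L = (LINT t|lborel. G t * cnj (G t))"
  have L: "L = of_real (enn2real (sq_norm lborel G))"
    using L2_inner_self[OF GL2] by (simp add: L_def L2_inner_def)
  have [measurable]: "A \<in> borel_measurable borel"
    unfolding A_def by (intro lborel.borel_measurable_lebesgue_integral) measurable
  have nint: "integrable lborel (std_normal_density)" by (rule integrable_normal_density) simp
  have n1: "(LINT v|lborel. complex_of_real (std_normal_density v)) = 1"
    by (subst integral_complex_of_real) (simp add: integral_normal_density)
  have A_bound: "cmod (A u) \<le> B * ?I" for u
  proof -
    have "cmod (A u) \<le> (LINT t|lborel. cmod (G (t + u) * cnj (G t)))"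
      unfolding A_def by (rule integral_norm_bound)
    also have "\<dots> \<le> (LINT t|lborel. B * cmod (G t))"
      using G B by (intro integral_mono integrable_norm autocorrelation_integrable)
        (auto simp: norm_mult intro!: mult_right_mono)
    finally show ?thesis by simp
  qed
  have lim: "(\<lambda>n. LINT v|lborel. of_real (std_normal_density v) * A (d n * v)) \<longlonglongrightarrow>
      (LINT v|lborel. of_real (std_normal_density v) * L)"
  proof (rule integral_dominated_convergence[where w = "\<lambda>v. std_normal_density v * (B * ?I)"])
    show "AE v in lborel. (\<lambda>n. of_real (std_normal_density v) * A (d n * v)) \<longlonglongrightarrow> of_real (std_normal_density v) * L"
    proof (rule AE_I2)
      fix v
      have "(\<lambda>n. d n * v) \<longlonglongrightarrow> 0" using tendsto_mult_left_zero[OF d(2)] by simp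
      from autocorrelation_tendsto[OF G B this]
      show "(\<lambda>n. of_real (std_normal_density v) * A (d n * v)) \<longlonglongrightarrow> of_real (std_normal_density v) * L"
        unfolding A_def L_def by (intro tendsto_intros)
    qed
    show "AE v in lborel. norm (of_real (std_normal_density v) * A (d n * v)) \<le>
        std_normal_density v * (B * ?I)" for n
      using A_bound by (auto simp: norm_mult intro!: mult_left_mono)
  qed (use nint in auto)
  have f_int: "integrable lborel (f n)" for n
  proof (rule Bochner_Integration.integrable_bound)
    show "integrable lborel (\<lambda>x. ?n n x *
        ?I\<^sup>2)"
      using d(1)[of n] by (intro integrable_mult_left integrable_mult_right lborel_integrable_real_affine nint) auto
    show "AE x in lborel. norm (f n x) \<le>
      norm (?n n x * ?I\<^sup>2)"
    proof (rule AE_I2)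
      fix x
      have "?n n x = exp (- (d n * x)\<^sup>2 / 2)"
        by (simp add: std_normal_density_def)
      then show "norm (f n x) \<le>
        norm (?n n x * ?I\<^sup>2)"
        using fourier_bound[of G x] by (simp add: f_def abs_mult power_mono)
    qed
  qed measurable
  have f_eq: "complex_of_real (LINT x|lborel. f n x) =
      of_real (2 * pi) * (LINT v|lborel. of_real (std_normal_density v) * A (d n * v))" for n
    unfolding A_def gaussian_average_fourier[OF G d(1) B, symmetric] f_def
    by (rule integral_complex_of_real[symmetric])
  have "(\<lambda>n. complex_of_real (LINT x|lborel. f n x)) \<longlonglongrightarrow> of_real (2 * pi) * (1 * L)"
    unfolding f_eq using tendsto_mult_left[OF lim] n1 by simp
  then have "(\<lambda>n. LINT x|lborel. f n x) \<longlonglongrightarrow> 2 * pi * enn2real (sq_norm lborel G)"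
    unfolding L by (simp flip: of_real_mult add: tendsto_of_real_iff)
  then have "(\<lambda>n. ennreal (LINT x|lborel. f n x)) \<longlonglongrightarrow> ennreal (2 * pi * enn2real (sq_norm lborel G))"
    by (rule tendsto_ennrealI)
  also have "(\<lambda>n. ennreal (LINT x|lborel. f n x)) = (\<lambda>n. \<integral>\<^sup>+x. ennreal (f n x) \<partial>lborel)"
    by (intro ext nn_integral_eq_integral[symmetric] f_int) (simp add: f_def)
  also have "ennreal (2 * pi * enn2real (sq_norm lborel G)) = ennreal (2 * pi) * sq_norm lborel G"
    using GL2 by (simp add: ennreal_mult L2_iff_sq_norm ennreal_enn2real)
  finally have lim1: "(\<lambda>n. \<integral>\<^sup>+x. ennreal (f n x) \<partial>lborel) \<longlonglongrightarrow> ennreal (2 * pi) * sq_norm lborel G" .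
  have "(\<lambda>n. \<integral>\<^sup>+x. ennreal (f n x) \<partial>lborel) \<longlonglongrightarrow> (\<integral>\<^sup>+x. ennreal ((cmod (fourier G x))\<^sup>2) \<partial>lborel)"
  proof (rule nn_integral_LIMSEQ)
    have "d n \<le> d m" if "m \<le> n" for m n using that by (simp add: d_def field_simps)
    then have "(d n * x)\<^sup>2 \<le> (d m * x)\<^sup>2" if "m \<le> n" for m n x
      using that d(1)[of n] d(1)[of m] by (simp add: power_mult_distrib mult_right_mono power_mono less_imp_le)
    then show "incseq (\<lambda>n x. ennreal (f n x))"
      by (auto simp: incseq_def le_fun_def f_def intro!: ennreal_leI mult_right_mono)
    fix x
    have "(\<lambda>n. f n x) \<longlonglongrightarrow> exp (- (0 * x)\<^sup>2 / 2) * (cmod (fourier G x))\<^sup>2"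
      unfolding f_def by (intro tendsto_intros d(2)) auto
    then show "(\<lambda>n. ennreal (f n x)) \<longlonglongrightarrow> ennreal ((cmod (fourier G x))\<^sup>2)"
      by (intro tendsto_ennrealI) simp
  qed measurable
  from LIMSEQ_unique[OF this lim1] show ?thesis by (simp add: sq_norm_def)
qed

section \<open>Polyanalytic functions\<close>

lemma open_upper_halfplane: "open upper_halfplane"
  unfolding upper_halfplane_def by (rule open_halfspace_Im_gt)

text \<open>A function annihilated by the \<open>n\<close>-th power of the Cauchy--Riemann operator is a polynomial of
  degree less than \<open>n\<close> in the conjugate variable, equivalently in \<open>Im z\<close>, with holomorphic coefficients. The variable \<open>Im z\<close> is
  the one in which the Laguerre polynomials occur.\<close>

definition polyanalytic :: "nat \<Rightarrow> (complex \<Rightarrow> complex) \<Rightarrow> bool" where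
  "polyanalytic n f \<longleftrightarrow> (\<exists>F. (\<forall>m<n. F m holomorphic_on upper_halfplane) \<and>
     (\<forall>z\<in>upper_halfplane. f z = (\<Sum>m<n. of_real (Im z) ^ m * F m z)))"

lemma polyanalyticI:
  "(\<And>m. m < n \<Longrightarrow> F m holomorphic_on upper_halfplane) \<Longrightarrow>
   (\<And>z. z \<in> upper_halfplane \<Longrightarrow> f z = (\<Sum>m<n. of_real (Im z) ^ m * F m z)) \<Longrightarrow> polyanalytic n f"
  unfolding polyanalytic_def by blast

lemma polyanalytic_cong:
  "polyanalytic n f \<Longrightarrow> (\<And>z. z \<in> upper_halfplane \<Longrightarrow> f z = g z) \<Longrightarrow> polyanalytic n g"
  unfolding polyanalytic_def by metis

lemma polynomial_in_Im_has_derivative: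
  assumes F: "\<And>m. m < n \<Longrightarrow> F m holomorphic_on upper_halfplane"
    and f: "\<And>z. z \<in> upper_halfplane \<Longrightarrow> f z = (\<Sum>m<n. of_real (Im z) ^ m * F m z)"
    and z: "z \<in> upper_halfplane"
  shows "(f has_derivative (\<lambda>h. \<Sum>m<n. of_real (Im h) * (of_nat m * of_real (Im z) ^ (m - 1) * F m z) +
      of_real (Im z) ^ m * deriv (F m) z * h)) (at z)"
proof -
  have D: "(F m has_derivative (\<lambda>h. deriv (F m) z * h)) (at z)" if "m < n" for m
    using holomorphic_derivI[OF F[OF that] open_upper_halfplane z, of UNIV]
    by (simp add: has_field_derivative_def)
  have "((\<lambda>z. of_real (Im z) ^ m * F m z) has_derivative
      (\<lambda>h. of_real (Im h) * (of_nat m * of_real (Im z) ^ (m - 1) * F m z) +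
      of_real (Im z) ^ m * deriv (F m) z * h)) (at z)" if "m < n" for m
    by (rule derivative_eq_intros D[OF that] refl)+ (auto simp: algebra_simps)
  then have "((\<lambda>z. \<Sum>m<n. of_real (Im z) ^ m * F m z) has_derivative
      (\<lambda>h. \<Sum>m<n. of_real (Im h) * (of_nat m * of_real (Im z) ^ (m - 1) * F m z) +
      of_real (Im z) ^ m * deriv (F m) z * h)) (at z)"
    by (intro has_derivative_sum) auto
  then show ?thesis
    by (rule has_derivative_transform_within_open[OF _ open_upper_halfplane z]) (simp add: f)
qed

lemma sum_pderiv_shift:
  fixes c :: "nat \<Rightarrow> complex"
  shows "(\<Sum>m<n. of_nat m * y ^ (m - 1) * c m) = (\<Sum>m<n - 1. y ^ m * (of_nat (Suc m) * c (Suc m)))"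
proof (cases n)
  case (Suc k)
  show ?thesis unfolding Suc sum.lessThan_Suc_shift by (simp add: mult_ac)
qed simp

text \<open>The Cauchy--Riemann operator annihilates the holomorphic coefficients and differentiates the
  powers of \<open>Im z\<close>, with the factor \<open>\<i>/2\<close>; hence it lowers the degree by one.\<close>

lemma polyanalytic_partials:
  assumes "polyanalytic n f"
  shows "z \<in> upper_halfplane \<Longrightarrow> f differentiable (at z)"
    and "polyanalytic n (partial_x f)" and "polyanalytic n (partial_y f)"
    and "polyanalytic (n - 1) (dbar f)"
proof -
  obtain F where F: "\<And>m. m < n \<Longrightarrow> F m holomorphic_on upper_halfplane"
    and f: "\<And>z. z \<in> upper_halfplane \<Longrightarrow> f z = (\<Sum>m<n. of_real (Im z) ^ m * F m z)"
    using assms unfolding polyanalytic_def by blast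
  let ?G = "\<lambda>m z. if m < n - 1 then of_nat (Suc m) * F (Suc m) z else 0"
  note D = polynomial_in_Im_has_derivative[of n F f, OF F f]
  show "z \<in> upper_halfplane \<Longrightarrow> f differentiable (at z)" for z
    using D unfolding differentiable_def by blast
  have deriv_hol: "deriv (F m) holomorphic_on upper_halfplane" if "m < n" for m
    using F[OF that] open_upper_halfplane by (rule holomorphic_deriv)
  have px: "partial_x f z = (\<Sum>m<n. of_real (Im z) ^ m * deriv (F m) z)"
    if "z \<in> upper_halfplane" for z
    using frechet_derivative_at[OF D[OF _ _ that], symmetric] by (simp add: partial_x_def)
  have "partial_y f z = (\<Sum>m<n. of_nat m * of_real (Im z) ^ (m - 1) * F m z) +
      \<i> * (\<Sum>m<n. of_real (Im z) ^ m * deriv (F m) z)"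
    if "z \<in> upper_halfplane" for z
    using frechet_derivative_at[OF D[OF _ _ that], symmetric]
    by (simp add: partial_y_def sum.distrib sum_distrib_left mult_ac)
  then have py: "partial_y f z = (\<Sum>m<n - 1. of_real (Im z) ^ m * (of_nat (Suc m) * F (Suc m) z)) +
      \<i> * (\<Sum>m<n. of_real (Im z) ^ m * deriv (F m) z)"
    if "z \<in> upper_halfplane" for z
    using that sum_pderiv_shift[of "of_real (Im z)" "\<lambda>m. F m z" n] by simp
  show "polyanalytic n (partial_x f)"
    using deriv_hol px by (rule polyanalyticI)
  show "polyanalytic n (partial_y f)"
  proof (rule polyanalyticI)
    show "(\<lambda>z. ?G m z + \<i> * deriv (F m) z)
        holomorphic_on upper_halfplane" if "m < n" for m
      using F[of "Suc m"] deriv_hol[OF that] by (cases "m < n - 1") (auto intro!: holomorphic_intros)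
    fix z assume z: "z \<in> upper_halfplane"
    have "(\<Sum>m<n. of_real (Im z) ^ m * ?G m z) =
        (\<Sum>m<n - 1. of_real (Im z) ^ m * (of_nat (Suc m) * F (Suc m) z))"
      by (rule sum.mono_neutral_cong_right) auto
    then show "partial_y f z = (\<Sum>m<n. of_real (Im z) ^ m *
        (?G m z + \<i> * deriv (F m) z))"
      by (simp add: py[OF z] distrib_left sum.distrib sum_distrib_left mult_ac)
  qed
  show "polyanalytic (n - 1) (dbar f)"
  proof (rule polyanalyticI)
    show "(\<lambda>z. \<i> / 2 * of_nat (Suc m) * F (Suc m) z) holomorphic_on upper_halfplane" if "m < n - 1" for m
      using F[of "Suc m"] that by (auto intro!: holomorphic_intros)
    fix z assume z: "z \<in> upper_halfplane"
    show "dbar f z = (\<Sum>m<n - 1. of_real (Im z) ^ m * (\<i> / 2 * of_nat (Suc m) * F (Suc m) z))"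
    proof -
      have cancel: "(B + \<i> * (A + \<i> * B)) / 2 = \<i> / 2 * A" for A B :: complex
        by (simp add: distrib_left flip: mult.assoc)
      show ?thesis
        unfolding dbar_def px[OF z] py[OF z] cancel by (simp only: sum_distrib_left mult_ac)
    qed
  qed
qed

lemma polyanalytic_continuous_on: "polyanalytic n f \<Longrightarrow> continuous_on upper_halfplane f"
  using polyanalytic_partials(1)
  by (meson continuous_at_imp_continuous_on differentiable_imp_continuous_within)

lemma polyanalytic_C_diff_on: "polyanalytic n f \<Longrightarrow> C_diff_on k upper_halfplane f"
  by (induction k arbitrary: f) (auto intro: polyanalytic_continuous_on polyanalytic_partials)

lemma polyanalytic_dbar_funpow: "polyanalytic n f \<Longrightarrow> polyanalytic (n - k) ((dbar ^^ k) f)"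
proof (induction k)
  case (Suc k)
  from polyanalytic_partials(4)[OF Suc.IH[OF Suc.prems]] show ?case by simp
qed simp

lemma polyanalytic_imp_poly_bergman:
  assumes "polyanalytic n f" "f \<in> L2 area"
  shows "f \<in> poly_bergman n"
  using assms polyanalytic_C_diff_on[OF assms(1)] polyanalytic_dbar_funpow[OF assms(1), of n]
  by (auto simp: poly_bergman_def polyanalytic_def)

text \<open>The set where two continuous functions differ is open, and an open null set is empty.\<close>

lemma continuous_AE_eq_imp_eq:
  assumes f: "continuous_on upper_halfplane f" and g: "continuous_on upper_halfplane g"
    and AE: "AE z in area. f z = (g z :: complex)" and z: "z \<in> upper_halfplane"
  shows "f z = g z"
proof -
  define N where "N = upper_halfplane \<inter> (\<lambda>z. f z - g z) -` (- {0})"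
  have N: "open N"
    unfolding N_def using open_upper_halfplane
    by (intro continuous_open_preimage continuous_intros f g) auto
  have "AE z in lborel. z \<in> upper_halfplane \<longrightarrow> f z = g z"
    using AE open_upper_halfplane unfolding area_def by (subst (asm) AE_restrict_space_iff) auto
  then have "AE z in lborel. z \<notin> N" by eventually_elim (auto simp: N_def)
  then have "N \<in> null_sets lborel" using N by (subst AE_iff_null_sets) auto
  then have "negligible N" by (simp add: negligible_iff_null_sets null_sets_completionI)
  then have "N = {}" using N open_not_negligible by blast
  then show ?thesis using z by (auto simp: N_def)
qed

lemma exp_minus_one_bound: "cmod (exp z - 1) \<le> cmod z * exp (cmod z)"
proof -
  have "cmod (exp z - exp 0) \<le> exp (cmod z) * cmod (z - 0)"
  proof (rule field_differentiable_bound[where S = "cball 0 (cmod z)" and f' = exp])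
    fix w assume "w \<in> cball (0::complex) (cmod z)"
    then show "cmod (exp w) \<le> exp (cmod z)"
      using norm_exp[of w] by (auto intro: order_trans)
  qed (auto intro: has_field_derivative_at_within DERIV_exp)
  then show ?thesis by (simp add: mult.commute)
qed

text \<open>Differentiation under the integral sign. For increments of modulus less than \<open>y/4\<close>, with
  \<open>y = Im z\<close>, the difference quotient of \<open>e\<^sup>i\<^sup>t\<^sup>z\<close> exceeds \<open>e\<^sup>-\<^sup>y\<^sup>t\<close> at most by the factor \<open>t e\<^sup>y\<^sup>t\<^sup>/\<^sup>4\<close>, and
  \<open>t \<le> (4/y) e\<^sup>y\<^sup>t\<^sup>/\<^sup>4\<close>, so that half of the exponential decay is left to dominate it.\<close>

lemma laplace_holomorphic:
  assumes [measurable]: "h \<in> borel_measurable halfline"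
    and int: "\<And>y. y > 0 \<Longrightarrow> integrable halfline (\<lambda>t. exp (- y * t) * cmod (h t))"
  shows "(\<lambda>z. LINT t|halfline. exp (\<i> * of_real t * z) * h t) holomorphic_on upper_halfplane"
    and "z \<in> upper_halfplane \<Longrightarrow> integrable halfline (\<lambda>t. exp (\<i> * of_real t * z) * h t)"
proof -
  have [measurable]: "(\<lambda>t. complex_of_real t) \<in> borel_measurable halfline"
    unfolding halfline_def by (intro measurable_restrict_space1) auto
  have norm_exp: "cmod (exp (\<i> * of_real t * z)) = exp (- Im z * t)" for t z
    by (simp add: mult.commute)
  show intF: "integrable halfline (\<lambda>t. exp (\<i> * of_real t * z) * h t)" if "z \<in> upper_halfplane" for z
  proof (rule Bochner_Integration.integrable_bound[OF int[of "Im z"]])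
    show "AE t in halfline. norm (exp (\<i> * of_real t * z) * h t) \<le> norm (exp (- Im z * t) * cmod (h t))"
      unfolding norm_mult norm_exp by simp
  qed (use that in \<open>auto simp: upper_halfplane_def\<close>)
  define F where "F z = (LINT t|halfline. exp (\<i> * of_real t * z) * h t)" for z
  define F' where "F' z = (LINT t|halfline. exp (\<i> * of_real t * z) * h t * (\<i> * of_real t))" for z
  have "(F has_field_derivative F' z) (at z)" if z: "z \<in> upper_halfplane" for z
    unfolding has_field_derivative_iff
  proof (subst tendsto_at_iff_sequentially, safe)
    define y where "y = Im z"
    have y: "y > 0" using z by (simp add: y_def upper_halfplane_def)
    fix X assume X: "\<forall>i. X i \<in> UNIV - {z}" "X \<longlonglongrightarrow> z"
    have "\<forall>\<^sub>F n in sequentially. dist (X n) z < y / 4"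
      using X(2) y by (intro tendstoD) auto
    then obtain N where N: "\<And>n. n \<ge> N \<Longrightarrow> dist (X n) z < y / 4"
      by (auto simp: eventually_sequentially)
    \<comment> \<open>Discarding finitely many terms makes all increments smaller than \<open>y/4\<close>.\<close>
    define Y where "Y n = X (n + N) - z" for n
    have Y: "Y n \<noteq> 0" "cmod (Y n) < y / 4" for n
      using X(1) N[of "n + N"] by (auto simp: Y_def dist_norm)
    have "Y \<longlonglongrightarrow> z - z"
      unfolding Y_def by (intro tendsto_intros LIMSEQ_ignore_initial_segment X)
    then have Y0: "Y \<longlonglongrightarrow> 0" by simp
    have Xup: "z + Y n \<in> upper_halfplane" for n
    proof -
      have "\<bar>Im (Y n)\<bar> < y / 4" using abs_Im_le_cmod[of "Y n"] Y(2)[of n] by linarith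
      then show ?thesis using y by (simp add: upper_halfplane_def y_def)
    qed
    let ?d = "\<lambda>n t. (exp (\<i> * of_real t * Y n) - 1) / Y n"
    define q where "q n t = exp (\<i> * of_real t * z) * h t * (?d n t)" for n t
    have [measurable]: "q n \<in> borel_measurable halfline" for n unfolding q_def by measurable
    have quot: "(F (X (n + N)) - F z) / (X (n + N) - z) = (LINT t|halfline. q n t)" for n
    proof -
      have "F (z + Y n) - F z = (LINT t|halfline. exp (\<i> * of_real t * (z + Y n)) * h t -
          exp (\<i> * of_real t * z) * h t)"
        unfolding F_def using intF[OF Xup] intF[OF z]
        by simp
      also have "\<dots> = (LINT t|halfline. Y n * q n t)"
      proof (intro Bochner_Integration.integral_cong refl)
        fix t
        have "Y n * q n t = exp (\<i> * of_real t * z) * h t * (exp (\<i> * of_real t * Y n) - 1)"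
          using Y(1)[of n] by (simp add: q_def)
        then show "exp (\<i> * of_real t * (z + Y n)) * h t - exp (\<i> * of_real t * z) * h t = Y n * q n t"
          by (simp only: distrib_left exp_add right_diff_distrib mult_1_right mult.assoc mult.commute[of "h t"])
      qed
      finally have "F (z + Y n) - F z = Y n * (LINT t|halfline. q n t)" by simp
      then show ?thesis using Y(1)[of n] by (simp add: Y_def)
    qed
    have "(\<lambda>n. LINT t|halfline. q n t) \<longlonglongrightarrow> F' z"
      unfolding F'_def
    proof (rule integral_dominated_convergence[where w = "\<lambda>t. (4 / y) * (exp (- (y / 2) * t) * cmod (h t))"])
      show "AE t in halfline. (\<lambda>n. q n t) \<longlonglongrightarrow> exp (\<i> * of_real t * z) * h t * (\<i> * of_real t)"
      proof (rule AE_I2)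
        fix t
        have "((\<lambda>w. exp (\<i> * of_real t * w)) has_field_derivative \<i> * of_real t) (at 0)"
          by (auto intro!: derivative_eq_intros)
        then have "((\<lambda>w. (exp (\<i> * of_real t * w) - 1) / w) \<longlongrightarrow> \<i> * of_real t) (at 0)"
          by (simp add: has_field_derivative_iff)
        then have "(\<lambda>n. ?d n t) \<longlonglongrightarrow> \<i> * of_real t"
          using Y(1) Y0 by (subst (asm) tendsto_at_iff_sequentially) (auto simp: o_def)
        then show "(\<lambda>n. q n t) \<longlonglongrightarrow> exp (\<i> * of_real t * z) * h t * (\<i> * of_real t)"
          unfolding q_def by (intro tendsto_intros)
      qed
      show "AE t in halfline. norm (q n t) \<le> (4 / y) * (exp (- (y / 2) * t) * cmod (h t))" for n
      proof (rule AE_I2)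
        fix t assume "t \<in> space halfline"
        then have t: "t > 0" by (simp add: halfline_def space_restrict_space)
        have "cmod (?d n t) \<le>
            cmod (\<i> * of_real t * Y n) * exp (cmod (\<i> * of_real t * Y n)) / cmod (Y n)"
          unfolding norm_divide by (intro divide_right_mono exp_minus_one_bound) auto
        also have "\<dots> = t * exp (t * cmod (Y n))" using Y(1)[of n] t by (simp add: norm_mult)
        also have "\<dots> \<le> (4 / y * exp (y / 4 * t)) * exp (y / 4 * t)"
        proof (intro mult_mono)
          have "y / 4 * t \<le> exp (y / 4 * t)" using exp_ge_add_one_self[of "y / 4 * t"] by linarith
          then show "t \<le> 4 / y * exp (y / 4 * t)" using y by (simp add: field_simps)
          show "exp (t * cmod (Y n)) \<le> exp (y / 4 * t)"
            using Y(2)[of n] t by (simp add: mult.commute mult_right_mono less_imp_le)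
        qed (use t y in auto)
        also have "\<dots> = 4 / y * exp (y / 2 * t)" by (simp add: mult.assoc flip: exp_add)
        finally have *: "cmod (?d n t) \<le> 4 / y * exp (y / 2 * t)" .
        have "norm (q n t) = exp (- y * t) * cmod (h t) * cmod (?d n t)"
          unfolding q_def norm_mult norm_exp y_def ..
        also have "\<dots> \<le> exp (- y * t) * cmod (h t) * (4 / y * exp (y / 2 * t))"
          by (intro mult_left_mono *) auto
        also have "\<dots> = (4 / y) * ((exp (- y * t) * exp (y / 2 * t)) * cmod (h t))" by simp
        also have "exp (- y * t) * exp (y / 2 * t) = exp (- (y / 2) * t)"
          by (simp flip: exp_add)
        finally show "norm (q n t) \<le> (4 / y) * (exp (- (y / 2) * t) * cmod (h t))" .
      qed
      show "integrable halfline (\<lambda>t. 4 / y * (exp (- (y / 2) * t) * cmod (h t)))"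
        using int[of "y / 2"] y by (intro integrable_mult_right) auto
    qed measurable
    then have "(\<lambda>n. (F (X (n + N)) - F z) / (X (n + N) - z)) \<longlonglongrightarrow> F' z" by (simp only: quot)
    then show "((\<lambda>y. (F y - F z) / (y - z)) \<circ> X) \<longlonglongrightarrow> F' z"
      unfolding o_def by (rule LIMSEQ_offset)
  qed
  then show "(\<lambda>z. LINT t|halfline. exp (\<i> * of_real t * z) * h t) holomorphic_on upper_halfplane"
    using open_upper_halfplane unfolding F_def[symmetric] by (subst holomorphic_on_open) auto
qed

section \<open>The half-plane as a product\<close>

lemma space_area[simp]: "space area = upper_halfplane"
  by (simp add: area_def space_restrict_space)

lemma sets_area[measurable_cong]: "sets area = sets (restrict_space borel upper_halfplane)"
  unfolding area_def by (intro sets_restrict_space_cong) simp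

lemma measurable_ident_halfline[measurable]: "(\<lambda>x. x) \<in> halfline \<rightarrow>\<^sub>M borel"
  unfolding halfline_def by (intro measurable_restrict_space1) simp

lemma measurable_ident_area[measurable]: "(\<lambda>z. z) \<in> area \<rightarrow>\<^sub>M borel"
  unfolding area_def by (intro measurable_restrict_space1) simp

lemma borel_measurable_areaI: "f \<in> borel_measurable borel \<Longrightarrow> f \<in> borel_measurable area"
  using measurable_compose[OF measurable_ident_area] by simp

interpretation halfline: sigma_finite_measure halfline
  unfolding halfline_def
  by (intro sigma_finite_measure_restrict_space lborel.sigma_finite_measure_axioms) simp

interpretation area: sigma_finite_measure area
  unfolding area_def using open_upper_halfplane
  by (intro sigma_finite_measure_restrict_space lborel.sigma_finite_measure_axioms) auto

interpretation lborel_halfline: pair_sigma_finite lborel halfline ..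
interpretation halfline_area: pair_sigma_finite halfline area ..

lemma borel_measurable_Complex[measurable (raw)]:
  assumes [measurable]: "f \<in> borel_measurable M" "g \<in> borel_measurable M"
  shows "(\<lambda>x. Complex (f x) (g x)) \<in> borel_measurable M"
  unfolding Complex_eq by measurable

lemma lborel_complex_eq: "(lborel :: complex measure) = distr (lborel \<Otimes>\<^sub>M lborel) borel (\<lambda>(x, y). Complex x y)"
proof (rule lborel_eqI)
  fix l u :: complex
  assume le: "\<And>b. b \<in> Basis \<Longrightarrow> l \<bullet> b \<le> u \<bullet> b"
  have le': "Re l \<le> Re u" "Im l \<le> Im u" using le[of 1] le[of \<i>] by (auto simp: Basis_complex_def)
  have pre: "(\<lambda>(x, y). Complex x y) -` box l u \<inter> space (lborel \<Otimes>\<^sub>M lborel) =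
      {Re l<..<Re u} \<times> {Im l<..<Im u}"
    by (auto simp: space_pair_measure box_def Basis_complex_def)
  have "emeasure (distr (lborel \<Otimes>\<^sub>M lborel) borel (\<lambda>(x, y). Complex x y)) (box l u) =
      emeasure (lborel \<Otimes>\<^sub>M lborel) ({Re l<..<Re u} \<times> {Im l<..<Im u})"
    by (subst emeasure_distr) (auto simp: pre)
  also have "\<dots> = ennreal ((Re u - Re l) * (Im u - Im l))"
    using le' by (subst lborel.emeasure_pair_measure_Times) (auto simp: ennreal_mult)
  also have "\<dots> = (\<Prod>b\<in>Basis. (u - l) \<bullet> b)"
    by (simp add: Basis_complex_def)
  finally show "emeasure (distr (lborel \<Otimes>\<^sub>M lborel) borel (\<lambda>(x, y). Complex x y)) (box l u) =
      (\<Prod>b\<in>Basis. (u - l) \<bullet> b)" .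
qed simp

lemma measurable_Complex_area[measurable]: "(\<lambda>(t, r). Complex t r) \<in> lborel \<Otimes>\<^sub>M halfline \<rightarrow>\<^sub>M area"
proof -
  have [measurable]: "(\<lambda>p. snd p) \<in> borel_measurable (lborel \<Otimes>\<^sub>M halfline)"
    using measurable_compose[OF measurable_snd measurable_ident_halfline] by simp
  have "(\<lambda>(t, r). Complex t r) \<in> lborel \<Otimes>\<^sub>M halfline \<rightarrow>\<^sub>M restrict_space borel upper_halfplane"
    unfolding case_prod_beta
    by (intro measurable_restrict_space2) (auto simp: space_pair_measure upper_halfplane_def)
  then show ?thesis by (simp cong: measurable_cong_sets add: measurable_cong_sets[OF refl sets_area])
qed

lemma area_eq_distr: "area = distr (lborel \<Otimes>\<^sub>M halfline) area (\<lambda>(t, r). Complex t r)"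
proof (rule measure_eqI)
  fix A assume A: "A \<in> sets area"
  then have A': "A \<in> sets borel" "A \<subseteq> upper_halfplane"
    using open_upper_halfplane unfolding area_def by (auto simp: sets_restrict_space_iff)
  note [measurable] = A A'(1)
  have "emeasure (distr (lborel \<Otimes>\<^sub>M halfline) area (\<lambda>(t, r). Complex t r)) A =
      (\<integral>\<^sup>+p. indicator A (case p of (t, r) \<Rightarrow> Complex t r) \<partial>(lborel \<Otimes>\<^sub>M halfline))"
    using nn_integral_distr[OF measurable_Complex_area, of "indicator A"] A by simp
  also have "\<dots> = (\<integral>\<^sup>+t. \<integral>\<^sup>+r. indicator A (Complex t r) \<partial>halfline \<partial>lborel)"
    by (subst halfline.nn_integral_fst[symmetric]) auto
  also have "\<dots> = (\<integral>\<^sup>+t. \<integral>\<^sup>+r. indicator A (Complex t r) \<partial>lborel \<partial>lborel)"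
    unfolding halfline_def
  proof (intro nn_integral_cong, subst nn_integral_restrict_space)
    fix t :: real
    show "(\<integral>\<^sup>+r. indicator A (Complex t r) * indicator {0<..} r \<partial>lborel) =
        (\<integral>\<^sup>+r. indicator A (Complex t r) \<partial>lborel)"
      using A'(2) by (intro nn_integral_cong) (auto simp: indicator_def upper_halfplane_def)
  qed auto
  also have "\<dots> = (\<integral>\<^sup>+p. indicator A (case p of (t, r) \<Rightarrow> Complex t r) \<partial>(lborel \<Otimes>\<^sub>M lborel))"
    by (subst lborel.nn_integral_fst[symmetric]) auto
  also have "\<dots> = emeasure lborel A"
    using nn_integral_distr[of "\<lambda>(t, r). Complex t r" "lborel \<Otimes>\<^sub>M lborel" borel "indicator A"] A'(1)
    by (simp flip: lborel_complex_eq)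
  also have "\<dots> = emeasure area A"
    using A'(2) open_upper_halfplane unfolding area_def by (subst emeasure_restrict_space) auto
  finally show "emeasure area A = emeasure (distr (lborel \<Otimes>\<^sub>M halfline) area (\<lambda>(t, r). Complex t r)) A"
    by simp
qed simp

lemma nn_integral_area:
  assumes [measurable]: "f \<in> borel_measurable area"
  shows "(\<integral>\<^sup>+z. f z \<partial>area) = (\<integral>\<^sup>+r. \<integral>\<^sup>+t. f (Complex t r) \<partial>lborel \<partial>halfline)"
proof -
  have "(\<integral>\<^sup>+z. f z \<partial>area) = (\<integral>\<^sup>+p. f (case p of (t, r) \<Rightarrow> Complex t r) \<partial>(lborel \<Otimes>\<^sub>M halfline))"
    by (subst area_eq_distr, subst nn_integral_distr) auto
  also have "\<dots> = (\<integral>\<^sup>+r. \<integral>\<^sup>+t. f (Complex t r) \<partial>lborel \<partial>halfline)"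
    by (subst lborel_halfline.nn_integral_snd[symmetric]) (auto simp: case_prod_beta)
  finally show ?thesis .
qed

lemma integral_area:
  fixes f :: "complex \<Rightarrow> complex"
  assumes "integrable area f"
  shows "(LINT z|area. f z) = (LINT t|lborel. LINT r|halfline. f (Complex t r))"
proof -
  have [measurable]: "f \<in> borel_measurable area" using assms by auto
  have "integrable (lborel \<Otimes>\<^sub>M halfline) (\<lambda>p. f (case p of (t, r) \<Rightarrow> Complex t r))"
    using assms by (subst (asm) area_eq_distr, subst (asm) integrable_distr_eq) auto
  from lborel_halfline.integral_fst'[OF this]
  have "(LINT t|lborel. LINT r|halfline. f (Complex t r)) =
      (LINT p|(lborel \<Otimes>\<^sub>M halfline). f (case p of (t, r) \<Rightarrow> Complex t r))" by simp
  also have "\<dots> = (LINT z|area. f z)"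
    using integral_distr[OF measurable_Complex_area, of f] by (simp flip: area_eq_distr)
  finally show ?thesis ..
qed

lemma nn_integral_halfline_scale:
  assumes [measurable]: "f \<in> borel_measurable borel" and c: "c > 0"
  shows "(\<integral>\<^sup>+x. f x \<partial>halfline) = ennreal c * (\<integral>\<^sup>+x. f (c * x) \<partial>halfline)"
proof -
  have "(\<integral>\<^sup>+x. f x \<partial>halfline) = (\<integral>\<^sup>+x. f x * indicator {0<..} x \<partial>lborel)"
    unfolding halfline_def by (subst nn_integral_restrict_space) auto
  also have "\<dots> = ennreal c * (\<integral>\<^sup>+x. f (c * x) * indicator {0<..} (c * x) \<partial>lborel)"
    using c by (subst nn_integral_real_affine[where c = c and t = 0]) auto
  also have "(\<integral>\<^sup>+x. f (c * x) * indicator {0<..} (c * x) \<partial>lborel) = (\<integral>\<^sup>+x. f (c * x) \<partial>halfline)"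
    unfolding halfline_def using c
    by (subst nn_integral_restrict_space) (auto intro!: nn_integral_cong simp: indicator_def zero_less_mult_iff)
  finally show ?thesis .
qed

lemma integrable_exp_halfline:
  assumes "a > 0"
  shows "integrable halfline (\<lambda>x. exp (- (a * x)))"
proof (rule integrableI_bounded)
  have "(\<integral>\<^sup>+x. exp (- x) \<partial>halfline) < \<infinity>"
    using integrable_exp_poly[of 1] by (simp add: integrable_iff_bounded)
  then have "ennreal a * (\<integral>\<^sup>+x. exp (- (a * x)) \<partial>halfline) < \<infinity>"
    using nn_integral_halfline_scale[of "\<lambda>x. exp (- x)", OF _ assms] by simp
  then show "(\<integral>\<^sup>+x. norm (exp (- (a * x))) \<partial>halfline) < \<infinity>"
    using assms by (auto simp: ennreal_mult_less_top ennreal_mult_eq_top_iff)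
qed simp

lemma integrable_bounded_support_halfline:
  fixes f :: "real \<Rightarrow> complex"
  assumes "f \<in> borel_measurable halfline" and B: "\<And>x. x > 0 \<Longrightarrow> cmod (f x) \<le> B"
    and A: "\<And>x. x > A \<Longrightarrow> f x = 0"
  shows "integrable halfline f"
proof (rule Bochner_Integration.integrable_bound[of _ "\<lambda>x. \<bar>B\<bar> * exp \<bar>A\<bar> * exp (- (1 * x))"])
  show "integrable halfline (\<lambda>x. \<bar>B\<bar> * exp \<bar>A\<bar> * exp (- (1 * x)))"
    by (intro integrable_mult_right integrable_exp_halfline) simp
  show "AE x in halfline. norm (f x) \<le> norm (\<bar>B\<bar> * exp \<bar>A\<bar> * exp (- (1 * x)))"
  proof (rule AE_I2)
    fix x assume "x \<in> space halfline"
    then have x: "x > 0" by simp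
    show "norm (f x) \<le> norm (\<bar>B\<bar> * exp \<bar>A\<bar> * exp (- (1 * x)))"
    proof (cases "x > A")
      case False
      then have "1 \<le> exp \<bar>A\<bar> * exp (- (1 * x))" by (simp flip: exp_add)
      then have "\<bar>B\<bar> * 1 \<le> \<bar>B\<bar> * (exp \<bar>A\<bar> * exp (- (1 * x)))" by (intro mult_left_mono) auto
      then show ?thesis using B[OF x] by (simp add: abs_mult)
    qed (use A in simp)
  qed
qed fact

section \<open>Plane waves times Laguerre functions\<close>

text \<open>The function on the half-plane against which the transform pairs: a plane wave of frequency \<open>x\<close> in
  \<open>Re z\<close> times a dilated Laguerre function in \<open>Im z\<close>, normalized in \<open>L\<^sub>2(\<real>\<^sub>+)\<close> up to \<open>1/sqrt(2\<pi>)\<close>.\<close>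

definition kern :: "nat \<Rightarrow> real \<Rightarrow> complex \<Rightarrow> complex" where
  "kern j x z = of_real (sqrt (2 * x) * laguerre_fun (j - 1) (2 * x * Im z) / sqrt (2 * pi)) *
     iexp (x * Re z)"

lemma measurable_kern[measurable (raw)]:
  assumes [measurable]: "f \<in> borel_measurable M" "g \<in> borel_measurable M"
  shows "(\<lambda>w. kern j (f w) (g w)) \<in> borel_measurable M"
  unfolding kern_def by measurable

lemma poly_bound_exp_scaled:
  fixes p :: "real poly"
  assumes "a > 0"
  obtains C where "C \<ge> 0" "\<And>s. s \<ge> 0 \<Longrightarrow> \<bar>poly p s\<bar> \<le> C * exp (a * s)"
proof -
  obtain C where C: "C \<ge> 0" "\<And>s. s \<ge> 0 \<Longrightarrow> \<bar>poly (pcompose p [:0, 1 / (4 * a):]) s\<bar> \<le> C * exp (s / 4)"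
    using poly_bound_exp by blast
  have "\<bar>poly p s\<bar> \<le> C * exp (a * s)" if "s \<ge> 0" for s
    using C(2)[of "4 * a * s"] that assms by (simp add: poly_pcompose)
  then show thesis using that C(1) by blast
qed

lemma sqrt_le_one_plus: "x \<ge> 0 \<Longrightarrow> sqrt x \<le> 1 + x"
  by (rule real_le_lsqrt) (auto simp: power2_eq_square algebra_simps)

lemma kern_bound:
  assumes "z \<in> upper_halfplane"
  obtains C where "C \<ge> 0" "\<And>x. x > 0 \<Longrightarrow> cmod (kern j x z) \<le> C * exp (- (Im z / 4 * x))"
proof -
  define y where "y = Im z"
  have y: "y > 0" using assms by (simp add: y_def upper_halfplane_def)
  obtain C where C: "C \<ge> 0" "\<And>s. \<bar>laguerre_fun (j - 1) s\<bar> \<le> C * exp (- s / 4)"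
    using laguerre_fun_bound by blast
  obtain D where D: "D \<ge> 0" "\<And>s. s \<ge> 0 \<Longrightarrow> \<bar>poly [:1, 2:] s\<bar> \<le> D * exp (y / 4 * s)"
    using poly_bound_exp_scaled[of "y / 4" "[:1, 2:]"] y by auto
  show thesis
  proof (rule that[of "D * C / sqrt (2 * pi)"])
    fix x :: real assume x: "x > 0"
    have "sqrt (2 * x) \<le> D * exp (y / 4 * x)"
      using D(2)[of x] sqrt_le_one_plus[of "2 * x"] x by (simp add: mult.commute)
    then have "sqrt (2 * x) * \<bar>laguerre_fun (j - 1) (2 * x * y)\<bar> \<le>
        (D * exp (y / 4 * x)) * (C * exp (- (2 * x * y) / 4))"
      using C(1) D(1) x by (intro mult_mono C(2)) auto
    also have "\<dots> = D * C * (exp (y / 4 * x) * exp (- (2 * x * y) / 4))" by simp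
    also have "exp (y / 4 * x) * exp (- (2 * x * y) / 4) = exp (- (y / 4 * x))"
      by (simp add: field_simps flip: exp_add)
    finally have "sqrt (2 * x) * \<bar>laguerre_fun (j - 1) (2 * x * y)\<bar> / sqrt (2 * pi) \<le>
        D * C * exp (- (y / 4 * x)) / sqrt (2 * pi)" by (rule divide_right_mono) simp
    moreover have "cmod (kern j x z) = sqrt (2 * x) * \<bar>laguerre_fun (j - 1) (2 * x * y)\<bar> / sqrt (2 * pi)"
      using x unfolding kern_def norm_mult norm_of_real norm_exp_i_times y_def by (simp add: abs_mult)
    ultimately show "cmod (kern j x z) \<le> D * C / sqrt (2 * pi) * exp (- (Im z / 4 * x))"
      by (simp add: y_def)
  qed (use C D in auto)
qed

lemma L2_exp_decay:
  assumes "f \<in> borel_measurable halfline" "a > 0"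
    and b: "\<And>x. x > 0 \<Longrightarrow> cmod (f x) \<le> C * exp (- (a * x))"
  shows "f \<in> L2 halfline" "integrable halfline f"
proof -
  show int: "integrable halfline f"
  proof (rule Bochner_Integration.integrable_bound)
    show "integrable halfline (\<lambda>x. C * exp (- (a * x)))"
      by (intro integrable_mult_right integrable_exp_halfline assms)
    show "AE x in halfline. norm (f x) \<le> norm (C * exp (- (a * x)))"
      using b by (intro AE_I2) (auto intro: order_trans[OF _ abs_ge_self])
  qed fact
  show "f \<in> L2 halfline"
  proof (rule L2_bounded_integrable[OF int, of "\<bar>C\<bar>"])
    fix x assume "x \<in> space halfline"
    then have x: "x > 0" by simp
    have "cmod (f x) \<le> \<bar>C\<bar> * exp (- (a * x))"
      using b[OF x] by (rule order_trans) (intro mult_right_mono, auto)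
    also have "\<dots> \<le> \<bar>C\<bar> * 1" using x assms(2) by (intro mult_left_mono) auto
    finally show "cmod (f x) \<le> \<bar>C\<bar>" by simp
  qed
qed

lemma kern_L2:
  assumes "z \<in> upper_halfplane"
  shows "(\<lambda>x. kern j x z) \<in> L2 halfline"
proof -
  obtain C where "\<And>x. x > 0 \<Longrightarrow> cmod (kern j x z) \<le> C * exp (- (Im z / 4 * x))"
    using kern_bound[OF assms] by blast
  then show ?thesis
    using assms by (intro L2_exp_decay(1)[where a = "Im z / 4"]) (auto simp: upper_halfplane_def)
qed

section \<open>The adjoint transform\<close>

text \<open>The adjoint of the transform as an absolutely convergent integral. It converges pointwise for
  all square integrable \<open>g\<close>, because for fixed \<open>z\<close> the kernel decays exponentially in \<open>x\<close>.\<close>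

definition synth :: "nat \<Rightarrow> (nat \<Rightarrow> real \<Rightarrow> complex) \<Rightarrow> complex \<Rightarrow> complex" where
  "synth n g z = (\<Sum>j=1..n. LINT x|halfline. kern j x z * g j x)"

lemma kern_mult_integrable:
  "z \<in> upper_halfplane \<Longrightarrow> g \<in> L2 halfline \<Longrightarrow> integrable halfline (\<lambda>x. kern j x z * g x)"
  by (intro L2_mult_integrable kern_L2)

lemma synth_diff:
  assumes "\<And>j. j \<in> {1..n} \<Longrightarrow> g j \<in> L2 halfline" "\<And>j. j \<in> {1..n} \<Longrightarrow> h j \<in> L2 halfline"
    and "z \<in> upper_halfplane"
  shows "synth n (\<lambda>j x. g j x - h j x) z = synth n g z - synth n h z"
  unfolding synth_def sum_subtractf[symmetric]
  using assms by (intro sum.cong)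
    (auto simp: right_diff_distrib kern_mult_integrable)

text \<open>The coefficient of \<open>(Im z)\<^sup>m\<close> in the Laguerre polynomial at \<open>2 x Im z\<close>, with the normalizing factors of
  \<open>kern\<close>.\<close>

definition kern_coeff :: "nat \<Rightarrow> nat \<Rightarrow> real \<Rightarrow> real" where
  "kern_coeff j m x = (-1) ^ (j - 1) * coeff (laguerre_poly (j - 1)) m * (2 * x) ^ m *
     sqrt (2 * x) / sqrt (2 * pi)"

text \<open>The exponential factor of the Laguerre function and the plane wave combine to the holomorphic
  function \<open>e\<^sup>i\<^sup>x\<^sup>z\<close>.\<close>

lemma kern_eq_polynomial:
  assumes x: "x > 0" and z: "z \<in> upper_halfplane" and j: "j \<in> {1..n}"
  shows "kern j x z = (\<Sum>m<n. of_real (Im z) ^ m * (exp (\<i> * of_real x * z) * of_real (kern_coeff j m x)))"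
proof -
  define y where "y = Im z"
  have y: "y > 0" using z by (simp add: y_def upper_halfplane_def)
  define p where "p = laguerre_poly (j - 1)"
  have "degree p \<le> j - 1"
    using coeff_pderiv_minus_funpow[of "monom 1 (j - 1)" "j - 1" "j - 1"]
    by (auto simp: p_def laguerre_poly_def degree_monom_eq)
  then have deg: "degree p < n" using j by auto
  have p: "poly p s = (\<Sum>m<n. coeff p m * s ^ m)" for s
    unfolding poly_altdef using deg by (intro sum.mono_neutral_left) (auto simp: coeff_eq_0)
  have lag: "laguerre_fun (j - 1) (2 * x * y) = (-1) ^ (j - 1) * exp (- (x * y)) * poly p (2 * x * y)"
    using x y by (simp add: laguerre_fun_eq p_def)
  have ex: "exp (\<i> * of_real x * z) = of_real (exp (- (x * y))) * iexp (x * Re z)"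
  proof -
    have "\<i> * of_real x * z = of_real (- (x * y)) + \<i> * of_real (x * Re z)"
      by (simp add: complex_eq_iff y_def)
    then show ?thesis by (simp only: exp_add exp_of_real)
  qed
  have real: "sqrt (2 * x) * laguerre_fun (j - 1) (2 * x * y) / sqrt (2 * pi) =
      exp (- (x * y)) * (\<Sum>m<n. y ^ m * kern_coeff j m x)"
    unfolding lag p sum_distrib_left sum_distrib_right sum_divide_distrib
    by (intro sum.cong refl) (simp add: kern_coeff_def p_def power_mult_distrib mult_ac)
  have "kern j x z = of_real (exp (- (x * y)) * (\<Sum>m<n. y ^ m * kern_coeff j m x)) * iexp (x * Re z)"
    unfolding kern_def y_def[symmetric] real ..
  also have "\<dots> = exp (\<i> * of_real x * z) * (\<Sum>m<n. of_real y ^ m * of_real (kern_coeff j m x))"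
    unfolding ex by (simp add: mult_ac)
  also have "\<dots> = (\<Sum>m<n. of_real y ^ m * (exp (\<i> * of_real x * z) * of_real (kern_coeff j m x)))"
    unfolding sum_distrib_left by (intro sum.cong refl) (simp add: mult_ac)
  finally show ?thesis by (simp add: y_def)
qed

lemma borel_measurable_kern_coeff[measurable]: "kern_coeff j m \<in> borel_measurable borel"
  unfolding kern_coeff_def by measurable

lemma kern_coeff_decay:
  assumes y: "y > 0"
  shows "(\<lambda>x. of_real (exp (- y * x) * kern_coeff j m x)) \<in> L2 halfline"
proof -
  define c where "c = \<bar>coeff (laguerre_poly (j - 1)) m\<bar> / sqrt (2 * pi)"
  obtain D where D: "D \<ge> 0" "\<And>s. s \<ge> 0 \<Longrightarrow> \<bar>poly ([:0, 2:] ^ m * [:1, 2:]) s\<bar> \<le> D * exp (y / 2 * s)"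
    using poly_bound_exp_scaled[of "y / 2" "[:0, 2:] ^ m * [:1, 2:]"] y by auto
  have "cmod (of_real (exp (- y * x) * kern_coeff j m x)) \<le> c * D * exp (- (y / 2 * x))"
    if x: "x > 0" for x
  proof -
    have "(2 * x) ^ m * sqrt (2 * x) \<le> (2 * x) ^ m * (1 + 2 * x)"
      using x by (intro mult_left_mono sqrt_le_one_plus) auto
    also have "\<dots> \<le> D * exp (y / 2 * x)"
      using D(2)[of x] x by (simp add: poly_power abs_mult algebra_simps)
    finally have b: "(2 * x) ^ m * sqrt (2 * x) \<le> D * exp (y / 2 * x)" .
    have "cmod (of_real (exp (- y * x) * kern_coeff j m x)) =
        exp (- y * x) * (c * ((2 * x) ^ m * sqrt (2 * x)))"
      unfolding norm_of_real using x by (simp add: kern_coeff_def c_def abs_mult power_abs)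
    also have "\<dots> \<le> exp (- y * x) * (c * (D * exp (y / 2 * x)))"
      using b by (intro mult_left_mono) (auto simp: c_def)
    also have "\<dots> = c * D * (exp (- y * x) * exp (y / 2 * x))" by simp
    also have "exp (- y * x) * exp (y / 2 * x) = exp (- (y / 2 * x))" by (simp flip: exp_add)
    finally show ?thesis .
  qed
  then show ?thesis using y by (intro L2_exp_decay(1)[where a = "y / 2"]) auto
qed

text \<open>Expanding the Laguerre polynomials in powers of \<open>Im z\<close> leaves Laplace integrals as coefficients,
  and these are holomorphic.\<close>

lemma synth_polyanalytic:
  assumes g: "\<And>j. j \<in> {1..n} \<Longrightarrow> g j \<in> L2 halfline"
  shows "polyanalytic n (synth n g)"
proof -
  define h where "h m x = (\<Sum>j=1..n. of_real (kern_coeff j m x) * g j x)" for m x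
  have [measurable]: "g j \<in> borel_measurable halfline" if "j \<in> {1..n}" for j
    using g[OF that] by (rule L2_measurable)
  have h_meas: "h m \<in> borel_measurable halfline" for m unfolding h_def by measurable
  have h_int: "integrable halfline (\<lambda>x. exp (- y * x) * cmod (h m x))" if y: "y > 0" for m y
  proof -
    have "integrable halfline (\<lambda>x. \<Sum>j=1..n. of_real (exp (- y * x) * kern_coeff j m x) * g j x)"
      by (intro Bochner_Integration.integrable_sum L2_mult_integrable kern_coeff_decay g y)
    then have "integrable halfline (\<lambda>x. cmod (\<Sum>j=1..n. of_real (exp (- y * x) * kern_coeff j m x) * g j x))"
      by (rule integrable_norm)
    also have "(\<lambda>x. cmod (\<Sum>j=1..n. of_real (exp (- y * x) * kern_coeff j m x) * g j x)) =
        (\<lambda>x. cmod (of_real (exp (- y * x)) * h m x))"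
      by (simp only: h_def sum_distrib_left of_real_mult mult.assoc)
    finally show ?thesis by (simp add: norm_mult)
  qed
  show ?thesis
  proof (rule polyanalyticI)
    show "(\<lambda>z. LINT x|halfline. exp (\<i> * of_real x * z) * h m x) holomorphic_on upper_halfplane" for m
      by (rule laplace_holomorphic(1)[OF h_meas h_int])
    fix z assume z: "z \<in> upper_halfplane"
    have "synth n g z = (LINT x|halfline. (\<Sum>j=1..n. kern j x z * g j x))"
      unfolding synth_def using g z
      by (intro Bochner_Integration.integral_sum[symmetric] kern_mult_integrable)
    also have "\<dots> = (LINT x|halfline. (\<Sum>m<n. of_real (Im z) ^ m * (exp (\<i> * of_real x * z) * h m x)))"
    proof (intro Bochner_Integration.integral_cong refl)
      fix x assume "x \<in> space halfline"
      then have x: "x > 0" by simp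
      have "(\<Sum>j=1..n. kern j x z * g j x) = (\<Sum>j=1..n. \<Sum>m<n. of_real (Im z) ^ m *
          (exp (\<i> * of_real x * z) * (of_real (kern_coeff j m x) * g j x)))"
        by (intro sum.cong refl, subst kern_eq_polynomial[OF x z])
           (auto simp: sum_distrib_right mult.assoc)
      also have "\<dots> = (\<Sum>m<n. of_real (Im z) ^ m * (exp (\<i> * of_real x * z) * h m x))"
        by (subst sum.swap) (simp add: h_def sum_distrib_left)
      finally show "(\<Sum>j=1..n. kern j x z * g j x) =
        (\<Sum>m<n. of_real (Im z) ^ m * (exp (\<i> * of_real x * z) * h m x))" .
    qed
    also have "\<dots> = (\<Sum>m<n. of_real (Im z) ^ m * (LINT x|halfline. exp (\<i> * of_real x * z) * h m x))"
      using laplace_holomorphic(2)[OF h_meas h_int z]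
      by (subst Bochner_Integration.integral_sum) auto
    finally show "synth n g z =
        (\<Sum>m<n. of_real (Im z) ^ m * (LINT x|halfline. exp (\<i> * of_real x * z) * h m x))" .
  qed
qed

lemma synth_measurable:
  "(\<And>j. j \<in> {1..n} \<Longrightarrow> g j \<in> L2 halfline) \<Longrightarrow> synth n g \<in> borel_measurable area"
  using borel_measurable_continuous_on_restrict[OF polyanalytic_continuous_on[OF synth_polyanalytic]]
  by (simp add: measurable_cong_sets[OF sets_area refl])

lemma laguerre_fun_L2: "(\<lambda>s. complex_of_real (laguerre_fun k s)) \<in> L2 halfline"
proof -
  obtain C where "\<And>s. \<bar>laguerre_fun k s\<bar> \<le> C * exp (- s / 4)"
    using laguerre_fun_bound by blast
  then show ?thesis by (intro L2_exp_decay(1)[where a = "1/4"]) auto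
qed

lemma sq_norm_laguerre_sum:
  "sq_norm halfline (\<lambda>s. \<Sum>j=1..n. of_real (laguerre_fun (j - 1) s) * c j) =
    (\<Sum>j=1..n. ennreal ((cmod (c j))\<^sup>2))"
proof -
  define f where "f s = (\<Sum>j=1..n. of_real (laguerre_fun (j - 1) s) * c j)" for s
  have f: "f \<in> L2 halfline"
    unfolding f_def using L2_cmult[OF laguerre_fun_L2] by (intro L2_sum) (simp add: mult.commute)
  have "complex_of_real (enn2real (sq_norm halfline f)) = (LINT s|halfline. f s * cnj (f s))"
    using L2_inner_self[OF f] by (simp add: L2_inner_def)
  also have "\<dots> = (LINT s|halfline. (\<Sum>j=1..n. \<Sum>k=1..n.
      c j * cnj (c k) * of_real (laguerre_fun (j - 1) s * laguerre_fun (k - 1) s)))"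
    unfolding f_def by (simp add: sum_product mult_ac)
  also have "\<dots> = (\<Sum>j=1..n. \<Sum>k=1..n. c j * cnj (c k) *
      of_real (LINT s|halfline. laguerre_fun (j - 1) s * laguerre_fun (k - 1) s))"
    using integrable_laguerre_fun_mult
    by (simp add: Bochner_Integration.integral_sum Bochner_Integration.integrable_sum
        integrable_of_real del: of_real_mult)
  also have "\<dots> = (\<Sum>j=1..n. \<Sum>k=1..n. if k = j then c j * cnj (c j) else 0)"
    unfolding laguerre_fun_orthonormal by (intro sum.cong refl) auto
  also have "\<dots> = (\<Sum>j=1..n. c j * cnj (c j))" by simp
  also have "\<dots> = of_real (\<Sum>j=1..n. (cmod (c j))\<^sup>2)"
    unfolding of_real_sum complex_norm_square ..
  finally have "enn2real (sq_norm halfline f) = (\<Sum>j=1..n. (cmod (c j))\<^sup>2)"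
    by (simp only: of_real_eq_iff)
  then have "sq_norm halfline f = ennreal (\<Sum>j=1..n. (cmod (c j))\<^sup>2)"
    using f by (metis L2_iff_sq_norm ennreal_enn2real infinity_ennreal_def)
  then show ?thesis by (simp add: f_def[abs_def] sum_ennreal)
qed

text \<open>On each horizontal line the function is a Fourier integral, so Plancherel's theorem gives its
  norm there; integrating over the height of the line, the substitution \<open>s = 2 x Im z\<close> turns the integral
  into the norm of a combination of Laguerre functions with coefficients \<open>g\<^sub>j(x)\<close>. Everything is
  nonnegative, so that the integrals may be interchanged freely.\<close>

lemma synth_isometry_bounded:
  assumes int: "\<And>j. j \<in> {1..n} \<Longrightarrow> integrable halfline (g j)"
    and bd: "\<And>j x. j \<in> {1..n} \<Longrightarrow> x > 0 \<Longrightarrow> cmod (g j x) \<le> B"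
  shows "sq_norm area (synth n g) = (\<Sum>j=1..n. sq_norm halfline (g j))"
proof -
  have gL2: "g j \<in> L2 halfline" if "j \<in> {1..n}" for j
    using int[OF that] bd[OF that] by (intro L2_bounded_integrable) auto
  have [measurable]: "g j \<in> borel_measurable halfline" if "j \<in> {1..n}" for j
    using gL2[OF that] by (rule L2_measurable)
  note [measurable] = synth_measurable[OF gL2]
  define G where "G r x = (\<Sum>j=1..n. of_real (sqrt (2 * x) * laguerre_fun (j - 1) (2 * x * r)) * g j x)" for r x
  have slice: "(\<integral>\<^sup>+t. ennreal ((cmod (synth n g (Complex t r)))\<^sup>2) \<partial>lborel) = sq_norm halfline (G r)"
    if r: "r > 0" for r
  proof -
    have z: "Complex t r \<in> upper_halfplane" for t using r by (simp add: upper_halfplane_def)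
    have kern_eq: "kern j x (Complex t r) = of_real (1 / sqrt (2 * pi)) * (iexp (x * t) *
        of_real (sqrt (2 * x) * laguerre_fun (j - 1) (2 * x * r)))" for j x t
      by (simp add: kern_def)
    have "\<exists>C\<ge>0. \<forall>x>0. cmod (kern j x (Complex 0 r)) \<le> C" for j
    proof -
      obtain C where C: "C \<ge> 0" "\<And>x. x > 0 \<Longrightarrow> cmod (kern j x (Complex 0 r)) \<le> C * exp (- (Im (Complex 0 r) / 4 * x))"
        using kern_bound[OF z] by blast
      have "cmod (kern j x (Complex 0 r)) \<le> C" if "x > 0" for x
        using C(2)[OF that] C(1) that r
          mult_left_mono[of "exp (- (Im (Complex 0 r) / 4 * x))" 1 C] by simp
      then show ?thesis using C(1) by blast
    qed
    then obtain C where C: "\<And>j. C j \<ge> 0" "\<And>j x. x > 0 \<Longrightarrow> cmod (kern j x (Complex 0 r)) \<le> C j"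
      by metis
    define G' where "G' x = indicator {0<..} x *\<^sub>R G r x" for x
    have kern_G: "of_real (1 / sqrt (2 * pi)) * G r x = (\<Sum>j=1..n. kern j x (Complex 0 r) * g j x)" for x
      by (simp add: G_def kern_eq sum_distrib_left mult.assoc)
    have bound: "cmod (of_real (1 / sqrt (2 * pi)) * G r x) \<le> (\<Sum>j=1..n. C j * B)" if "x > 0" for x
      unfolding kern_G using that C bd
      by (intro order_trans[OF norm_sum] sum_mono) (auto simp: norm_mult intro!: mult_mono)
    have "integrable halfline (\<lambda>x. of_real (1 / sqrt (2 * pi)) * G r x)"
      unfolding kern_G
      by (intro Bochner_Integration.integrable_sum kern_mult_integrable z gL2)
    from integrable_mult_right[OF this, of "of_real (sqrt (2 * pi))"]
    have intG: "integrable halfline (G r)" by simp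
    then have intG': "integrable lborel G'"
      unfolding G'_def halfline_def by (subst (asm) integrable_restrict_space) auto
    have bdG': "cmod (G' x) \<le> sqrt (2 * pi) * \<bar>\<Sum>j=1..n. C j * B\<bar>" for x
    proof (cases "x > 0")
      case True
      have "cmod (G r x) / sqrt (2 * pi) \<le> (\<Sum>j=1..n. C j * B)"
        using bound[OF True] by (simp add: norm_mult norm_divide)
      also have "\<dots> \<le> \<bar>\<Sum>j=1..n. C j * B\<bar>" by simp
      finally show ?thesis using True by (simp add: G'_def pos_divide_le_eq mult.commute)
    qed (simp add: G'_def)
    have syn: "synth n g (Complex t r) = of_real (1 / sqrt (2 * pi)) * fourier G' t" for t
    proof -
      have "synth n g (Complex t r) = (LINT x|halfline. (\<Sum>j=1..n. kern j x (Complex t r) * g j x))"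
        unfolding synth_def
        by (intro Bochner_Integration.integral_sum[symmetric] kern_mult_integrable gL2 z)
      also have "\<dots> = (LINT x|halfline. of_real (1 / sqrt (2 * pi)) * (iexp (x * t) * G r x))"
        unfolding kern_eq G_def sum_distrib_left by (simp only: mult.assoc)
      also have "\<dots> = of_real (1 / sqrt (2 * pi)) * (LINT x|halfline. iexp (x * t) * G r x)"
        by (rule integral_mult_right_zero)
      also have "(LINT x|halfline. iexp (x * t) * G r x) = fourier G' t"
        unfolding halfline_def fourier_def
        by (subst integral_restrict_space) (auto simp: G'_def intro!: Bochner_Integration.integral_cong)
      finally show ?thesis .
    qed
    have "(\<integral>\<^sup>+t. ennreal ((cmod (synth n g (Complex t r)))\<^sup>2) \<partial>lborel) =
        sq_norm lborel (\<lambda>t. of_real (1 / sqrt (2 * pi)) * fourier G' t)"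
      by (simp add: sq_norm_def syn)
    also have "\<dots> = ennreal ((cmod (of_real (1 / sqrt (2 * pi))))\<^sup>2) * sq_norm lborel (fourier G')"
      using intG' by (intro sq_norm_cmult) (auto intro: borel_measurable_fourier)
    also have "sq_norm lborel (fourier G') = ennreal (2 * pi) * sq_norm lborel G'"
      by (rule plancherel_bounded[OF intG' bdG'])
    also have "ennreal ((cmod (of_real (1 / sqrt (2 * pi))))\<^sup>2) * (ennreal (2 * pi) * sq_norm lborel G') =
        sq_norm lborel G'"
      by (simp add: power_divide norm_divide mult.assoc[symmetric] flip: ennreal_mult)
    also have "sq_norm lborel G' = sq_norm halfline (G r)"
      unfolding sq_norm_def halfline_def G'_def
      by (subst nn_integral_restrict_space) (auto intro!: nn_integral_cong simp: indicator_def)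
    finally show ?thesis .
  qed
  have [measurable]: "(\<lambda>p. fst p) \<in> borel_measurable (halfline \<Otimes>\<^sub>M halfline)"
      "(\<lambda>p. snd p) \<in> borel_measurable (halfline \<Otimes>\<^sub>M halfline)"
    using measurable_compose[OF measurable_fst measurable_ident_halfline]
      measurable_compose[OF measurable_snd measurable_ident_halfline] by simp_all
  interpret hh: pair_sigma_finite halfline halfline ..
  have "sq_norm area (synth n g) = (\<integral>\<^sup>+r. sq_norm halfline (G r) \<partial>halfline)"
    unfolding sq_norm_def[of area] using slice
    by (subst nn_integral_area) (auto intro!: nn_integral_cong)
  also have "\<dots> = (\<integral>\<^sup>+x. \<integral>\<^sup>+r. ennreal ((cmod (G r x))\<^sup>2) \<partial>halfline \<partial>halfline)"
    unfolding sq_norm_def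
    by (rule hh.Fubini'[symmetric]) (auto simp: G_def case_prod_beta)
  also have "\<dots> = (\<integral>\<^sup>+x. (\<Sum>j=1..n. ennreal ((cmod (g j x))\<^sup>2)) \<partial>halfline)"
  proof (rule nn_integral_cong)
    fix x assume "x \<in> space halfline"
    then have x: "x > 0" by simp
    define q where "q s = ennreal ((cmod (\<Sum>j=1..n. of_real (laguerre_fun (j - 1) s) * g j x))\<^sup>2)" for s
    have [measurable]: "q \<in> borel_measurable borel" unfolding q_def by measurable
    have "ennreal ((cmod (G r x))\<^sup>2) = ennreal (2 * x) * q (2 * x * r)" for r
    proof -
      have "G r x = of_real (sqrt (2 * x)) * (\<Sum>j=1..n. of_real (laguerre_fun (j - 1) (2 * x * r)) * g j x)"
        by (simp add: G_def sum_distrib_left mult.assoc)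
      moreover have "(cmod (of_real (sqrt (2 * x)) * w))\<^sup>2 = 2 * x * (cmod w)\<^sup>2" for w
        using x by (simp add: norm_mult power_mult_distrib)
      ultimately have "(cmod (G r x))\<^sup>2 = (2 * x) *
          (cmod (\<Sum>j=1..n. of_real (laguerre_fun (j - 1) (2 * x * r)) * g j x))\<^sup>2"
        by simp
      then show ?thesis using x by (simp add: q_def ennreal_mult)
    qed
    then have "(\<integral>\<^sup>+r. ennreal ((cmod (G r x))\<^sup>2) \<partial>halfline) =
        (\<integral>\<^sup>+r. ennreal (2 * x) * q (2 * x * r) \<partial>halfline)" by simp
    also have "\<dots> = ennreal (2 * x) * (\<integral>\<^sup>+r. q (2 * x * r) \<partial>halfline)"
      by (rule nn_integral_cmult) measurable
    also have "\<dots> = (\<integral>\<^sup>+s. q s \<partial>halfline)"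
      using x by (subst nn_integral_halfline_scale[of q "2 * x"]) auto
    also have "\<dots> = (\<Sum>j=1..n. ennreal ((cmod (g j x))\<^sup>2))"
      using sq_norm_laguerre_sum[of "\<lambda>j. g j x" n] by (simp add: q_def sq_norm_def)
    finally show "(\<integral>\<^sup>+r. ennreal ((cmod (G r x))\<^sup>2) \<partial>halfline) =
        (\<Sum>j=1..n. ennreal ((cmod (g j x))\<^sup>2))" .
  qed
  also have "\<dots> = (\<Sum>j=1..n. sq_norm halfline (g j))"
    unfolding sq_norm_def by (rule nn_integral_sum) auto
  finally show ?thesis .
qed

text \<open>Cutting off both the argument and the value turns a square integrable function on the half-line
  into a bounded integrable one.\<close>

definition truncate :: "nat \<Rightarrow> (real \<Rightarrow> complex) \<Rightarrow> real \<Rightarrow> complex" where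
  "truncate k f x = (if x \<le> real k \<and> cmod (f x) \<le> real k then f x else 0)"

lemma truncate_integrable:
  assumes "f \<in> borel_measurable halfline"
  shows "integrable halfline (truncate k f)"
proof (rule integrable_bounded_support_halfline[where A = "real k" and B = "real k"])
  show "truncate k f \<in> borel_measurable halfline"
    using assms unfolding truncate_def by measurable
qed (auto simp: truncate_def)

lemma truncate_bound: "cmod (truncate k f x) \<le> real k"
  by (simp add: truncate_def)

lemma norm_truncate_le: "cmod (truncate k f x) \<le> cmod (f x)"
  by (simp add: truncate_def)

lemma truncate_L2: "f \<in> borel_measurable halfline \<Longrightarrow> truncate k f \<in> L2 halfline"
  by (rule L2_bounded_integrable[OF truncate_integrable truncate_bound])

lemma truncate_eventually: "\<forall>\<^sub>F k in sequentially. truncate k f x = f x"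
proof -
  have "\<forall>\<^sub>F k in sequentially. nat \<lceil>max x (cmod (f x))\<rceil> \<le> k" by (rule eventually_ge_at_top)
  then show ?thesis
  proof eventually_elim
    case (elim k)
    then have "max x (cmod (f x)) \<le> real k"
      by (meson of_nat_mono order_trans real_nat_ceiling_ge)
    then show ?case by (simp add: truncate_def)
  qed
qed

lemma truncate_tendsto:
  assumes f: "f \<in> L2 halfline"
  shows "(\<lambda>k. sq_norm halfline (\<lambda>x. truncate k f x - f x)) \<longlonglongrightarrow> 0"
proof -
  have [measurable]: "f \<in> borel_measurable halfline" using f by (rule L2_measurable)
  have [measurable]: "truncate k f \<in> borel_measurable halfline" for k
    using truncate_integrable[of f k] by auto
  have "(\<lambda>k. \<integral>\<^sup>+x. ennreal ((cmod (truncate k f x - f x))\<^sup>2) \<partial>halfline) \<longlonglongrightarrow> (\<integral>\<^sup>+x. 0 \<partial>halfline)"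
  proof (rule nn_integral_dominated_convergence[where w = "\<lambda>x. ennreal ((cmod (f x))\<^sup>2)"])
    show "AE x in halfline. (\<lambda>k. ennreal ((cmod (truncate k f x - f x))\<^sup>2)) \<longlonglongrightarrow> 0"
    proof (rule AE_I2)
      fix x
      show "(\<lambda>k. ennreal ((cmod (truncate k f x - f x))\<^sup>2)) \<longlonglongrightarrow> 0"
        by (rule tendsto_eventually, use truncate_eventually[of f x] in eventually_elim) simp
    qed
    show "(\<integral>\<^sup>+x. ennreal ((cmod (f x))\<^sup>2) \<partial>halfline) < \<infinity>"
      using f by (simp add: L2_iff_sq_norm sq_norm_def)
    show "AE x in halfline. ennreal ((cmod (truncate k f x - f x))\<^sup>2) \<le> ennreal ((cmod (f x))\<^sup>2)" for k
      by (rule AE_I2) (auto simp: truncate_def)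
  qed measurable
  then show ?thesis by (simp add: sq_norm_def)
qed

text \<open>The truncations satisfy the bound with equality, and their images converge pointwise by dominated
  convergence, so that Fatou's lemma passes to the limit.\<close>

lemma synth_contraction:
  assumes g: "\<And>j. j \<in> {1..n} \<Longrightarrow> g j \<in> L2 halfline"
  shows "sq_norm area (synth n g) \<le> (\<Sum>j=1..n. sq_norm halfline (g j))"
proof -
  define gk where "gk k j = truncate k (g j)" for k j
  have gm[measurable]: "g j \<in> borel_measurable halfline" if "j \<in> {1..n}" for j
    using g[OF that] by (rule L2_measurable)
  have gkL2: "gk k j \<in> L2 halfline" if "j \<in> {1..n}" for j k
    using gm[OF that] unfolding gk_def by (rule truncate_L2)
  note [measurable] = synth_measurable[OF gkL2]
  have lim: "(\<lambda>k. synth n (gk k) z) \<longlonglongrightarrow> synth n g z" if z: "z \<in> upper_halfplane" for z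
    unfolding synth_def
  proof (intro tendsto_sum integral_dominated_convergence)
    fix j assume j: "j \<in> {1..n}"
    show "integrable halfline (\<lambda>x. cmod (kern j x z * g j x))"
      by (intro integrable_norm kern_mult_integrable z g j)
    show "(\<lambda>x. kern j x z * g j x) \<in> borel_measurable halfline"
      using kern_mult_integrable[OF z g[OF j]] by auto
    show "(\<lambda>x. kern j x z * gk k j x) \<in> borel_measurable halfline" for k
      using kern_mult_integrable[OF z gkL2[OF j]] by auto
    show "AE x in halfline. (\<lambda>k. kern j x z * gk k j x) \<longlonglongrightarrow> kern j x z * g j x"
    proof (rule AE_I2)
      fix x
      have "(\<lambda>k. gk k j x) \<longlonglongrightarrow> g j x"
        unfolding gk_def by (rule tendsto_eventually[OF truncate_eventually])
      then show "(\<lambda>k. kern j x z * gk k j x) \<longlonglongrightarrow> kern j x z * g j x"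
        by (rule tendsto_mult_left)
    qed
    show "AE x in halfline. norm (kern j x z * gk k j x) \<le> cmod (kern j x z * g j x)" for k
      unfolding norm_mult gk_def by (intro AE_I2 mult_left_mono norm_truncate_le) auto
  qed
  show ?thesis
  proof (rule sq_norm_Fatou)
    show "AE z in area. (\<lambda>k. synth n (gk k) z) \<longlonglongrightarrow> synth n g z"
      using lim by (intro AE_I2) simp
    have "sq_norm area (synth n (gk k)) \<le> (\<Sum>j=1..n. sq_norm halfline (g j))" for k
    proof -
      have "sq_norm area (synth n (gk k)) = (\<Sum>j=1..n. sq_norm halfline (gk k j))"
        by (rule synth_isometry_bounded[where B = "real k"])
           (auto simp: gk_def truncate_bound intro!: truncate_integrable gm)
      also have "\<dots> \<le> (\<Sum>j=1..n. sq_norm halfline (g j))"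
        unfolding gk_def by (intro sum_mono sq_norm_mono norm_truncate_le)
      finally show ?thesis .
    qed
    then show "\<forall>\<^sub>F k in sequentially. sq_norm area (synth n (gk k)) \<le> (\<Sum>j=1..n. sq_norm halfline (g j))"
      by simp
  qed measurable
qed

lemma synth_L2:
  assumes "\<And>j. j \<in> {1..n} \<Longrightarrow> g j \<in> L2 halfline"
  shows "synth n g \<in> L2 area"
proof -
  have "sq_norm area (synth n g) \<le> (\<Sum>j=1..n. sq_norm halfline (g j))"
    by (rule synth_contraction) (rule assms)
  also have "\<dots> < \<infinity>" using assms by (auto simp: L2_iff_sq_norm)
  finally have "sq_norm area (synth n g) < \<infinity>" .
  moreover have "synth n g \<in> borel_measurable area" by (rule synth_measurable) (rule assms)
  ultimately show ?thesis by (simp add: L2_iff_sq_norm)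
qed

section \<open>The transform as a limit in the mean\<close>

text \<open>The modulus of \<open>kern j x z\<close> is independent of \<open>Re z\<close>, so the kernel is not square integrable on the
  half-plane. It is on strips, which is why the transform is a limit over them.\<close>

definition strip :: "real \<Rightarrow> (complex \<Rightarrow> complex) \<Rightarrow> complex \<Rightarrow> complex" where
  "strip T f z = (if \<bar>Re z\<bar> \<le> T then f z else 0)"

lemma strip_measurable[measurable]:
  assumes [measurable]: "f \<in> borel_measurable area"
  shows "strip T f \<in> borel_measurable area"
  unfolding strip_def by measurable

lemma strip_L2: "f \<in> L2 area \<Longrightarrow> strip T f \<in> L2 area"
proof -
  assume f: "f \<in> L2 area"
  have "sq_norm area (strip T f) \<le> sq_norm area f"
    by (rule sq_norm_mono) (simp add: strip_def)
  then show ?thesis using f by (auto simp: L2_iff_sq_norm intro: le_less_trans)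
qed

lemma kern_strip_L2:
  assumes x: "x > 0"
  shows "strip T (kern j x) \<in> L2 area" "sq_norm area (strip T (kern j x)) \<le> ennreal (\<bar>T\<bar> / pi)"
proof -
  let ?l = "\<lambda>r. laguerre_fun (j - 1) (2 * x * r)"
  let ?e = "\<lambda>r. ennreal (2 * x * (?l r)\<^sup>2 / (2 * pi))"
  have km: "kern j x \<in> borel_measurable area" by (intro borel_measurable_areaI) measurable
  note [measurable] = strip_measurable[OF km]
  have "sq_norm area (strip T (kern j x)) =
      (\<integral>\<^sup>+r. \<integral>\<^sup>+t. ennreal ((cmod (strip T (kern j x) (Complex t r)))\<^sup>2) \<partial>lborel \<partial>halfline)"
    unfolding sq_norm_def by (rule nn_integral_area) measurable
  also have "\<dots> = (\<integral>\<^sup>+r. \<integral>\<^sup>+t. ?e r *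
      indicator {- T..T} t \<partial>lborel \<partial>halfline)"
  proof (intro nn_integral_cong)
    fix t r
    have "(cmod (kern j x (Complex t r)))\<^sup>2 = 2 * x * (?l r)\<^sup>2 / (2 * pi)"
      using x unfolding kern_def norm_mult norm_of_real norm_exp_i_times
      by (simp add: power_mult_distrib power_divide)
    then show "ennreal ((cmod (strip T (kern j x) (Complex t r)))\<^sup>2) =
      ?e r * indicator {- T..T} t"
      by (auto simp: strip_def indicator_def)
  qed
  also have "\<dots> = (\<integral>\<^sup>+r. ?e r *
      emeasure lborel {- T..T} \<partial>halfline)"
    by (simp add: nn_integral_cmult_indicator)
  also have "\<dots> \<le> (\<integral>\<^sup>+r. (ennreal (2 * x) * ennreal (\<bar>T\<bar> / pi)) *
      ennreal ((?l r)\<^sup>2) \<partial>halfline)"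
  proof (rule nn_integral_mono)
    fix r
    have "emeasure lborel {- T..T} \<le> ennreal (2 * \<bar>T\<bar>)"
      by (cases "T \<ge> 0") auto
    then have "?e r * emeasure lborel {- T..T} \<le>
        ?e r * ennreal (2 * \<bar>T\<bar>)"
      by (rule mult_left_mono) simp
    also have "\<dots> = ennreal (2 * x) * ennreal (\<bar>T\<bar> / pi) * ennreal ((?l r)\<^sup>2)"
      using x by (simp add: mult_ac flip: ennreal_mult)
    finally show "?e r * emeasure lborel {- T..T} \<le>
      ennreal (2 * x) * ennreal (\<bar>T\<bar> / pi) * ennreal ((?l r)\<^sup>2)" .
  qed
  also have "\<dots> = ennreal (\<bar>T\<bar> / pi) * (ennreal (2 * x) *
      (\<integral>\<^sup>+r. ennreal ((?l r)\<^sup>2) \<partial>halfline))"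
  proof -
    have [measurable]: "(\<lambda>r. ?l r) \<in> borel_measurable halfline"
      by (intro borel_measurable_halflineI) measurable
    show ?thesis by (subst nn_integral_cmult) (simp_all add: mult_ac)
  qed
  also have "ennreal (2 * x) * (\<integral>\<^sup>+r. ennreal ((?l r)\<^sup>2) \<partial>halfline) =
      (\<integral>\<^sup>+s. ennreal ((laguerre_fun (j - 1) s)\<^sup>2) \<partial>halfline)"
    using x by (subst nn_integral_halfline_scale[of "\<lambda>s. ennreal ((laguerre_fun (j - 1) s)\<^sup>2)" "2 * x"]) auto
  also have "\<dots> = ennreal (LINT s|halfline. (laguerre_fun (j - 1) s)\<^sup>2)"
    using integrable_laguerre_fun_mult[of "j - 1" "j - 1"]
    by (intro nn_integral_eq_integral) (auto simp: power2_eq_square)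
  also have "\<dots> = 1"
    using laguerre_fun_orthonormal[of "j - 1" "j - 1"] by (simp add: power2_eq_square)
  finally show bound: "sq_norm area (strip T (kern j x)) \<le> ennreal (\<bar>T\<bar> / pi)" by simp
  show "strip T (kern j x) \<in> L2 area"
    using bound by (auto simp: L2_iff_sq_norm intro: le_less_trans)
qed

text \<open>The transform before passing to the limit in the mean, applied below to functions supported in a
  strip. This support condition on \<open>f\<close> is written \<open>strip T f = f\<close>.\<close>

definition ana :: "(complex \<Rightarrow> complex) \<Rightarrow> nat \<Rightarrow> real \<Rightarrow> complex" where
  "ana f j x = (LINT z|area. f z * cnj (kern j x z))"

lemma ana_integrable:
  assumes f: "f \<in> L2 area" and T: "strip T f = f" and x: "x > 0"
  shows "integrable area (\<lambda>z. f z * cnj (kern j x z))"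
    and "(LINT z|area. cmod (f z * cnj (kern j x z))) \<le> enn2real (sq_norm area f) + \<bar>T\<bar> / pi"
proof -
  have eq: "f z * cnj (kern j x z) = f z * cnj (strip T (kern j x) z)" for z
    using fun_cong[OF T, of z] by (auto simp: strip_def split: if_splits)
  note k = kern_strip_L2[OF x, of T j]
  show int: "integrable area (\<lambda>z. f z * cnj (kern j x z))"
    unfolding eq by (intro L2_inner_integrable f k)
  have "(LINT z|area. cmod (f z * cnj (kern j x z))) \<le>
      (LINT z|area. (cmod (f z))\<^sup>2 + (cmod (strip T (kern j x) z))\<^sup>2)"
  proof (rule integral_mono)
    show "integrable area (\<lambda>z. cmod (f z * cnj (kern j x z)))" using int by (rule integrable_norm)
    show "integrable area (\<lambda>z. (cmod (f z))\<^sup>2 + (cmod (strip T (kern j x) z))\<^sup>2)"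
      by (intro Bochner_Integration.integrable_add L2_integral_square f k)
    fix z
    have "0 \<le> cmod (f z) * cmod (strip T (kern j x) z)" by simp
    then show "cmod (f z * cnj (kern j x z)) \<le> (cmod (f z))\<^sup>2 + (cmod (strip T (kern j x) z))\<^sup>2"
      using sum_squares_bound[of "cmod (f z)" "cmod (strip T (kern j x) z)"]
      unfolding eq norm_mult complex_mod_cnj by linarith
  qed
  also have "\<dots> = enn2real (sq_norm area f) + enn2real (sq_norm area (strip T (kern j x)))"
    using L2_integral_square[OF f] L2_integral_square[OF k(1)]
    by simp
  also have "enn2real (sq_norm area (strip T (kern j x))) \<le> \<bar>T\<bar> / pi"
    using k(2) by (rule enn2real_leI[rotated]) simp
  finally show "(LINT z|area. cmod (f z * cnj (kern j x z))) \<le> enn2real (sq_norm area f) + \<bar>T\<bar> / pi"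
    by simp
qed

lemma ana_bound:
  assumes "f \<in> L2 area" "strip T f = f" "x > 0"
  shows "cmod (ana f j x) \<le> enn2real (sq_norm area f) + \<bar>T\<bar> / pi"
  unfolding ana_def by (rule order_trans[OF integral_norm_bound ana_integrable(2)[OF assms]])

lemma measurable_halfline_area[measurable]:
  "(\<lambda>p. fst p) \<in> borel_measurable (halfline \<Otimes>\<^sub>M area)"
  "(\<lambda>p. snd p) \<in> borel_measurable (halfline \<Otimes>\<^sub>M area)"
  using measurable_compose[OF measurable_fst measurable_ident_halfline]
    measurable_compose[OF measurable_snd measurable_ident_area] by simp_all

lemma ana_measurable:
  assumes [measurable]: "f \<in> borel_measurable area"
  shows "ana f j \<in> borel_measurable halfline"
proof -
  have "(\<lambda>x. LINT z|area. f z * cnj (kern j x z)) \<in> borel_measurable halfline"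
    by (intro area.borel_measurable_lebesgue_integral) (simp add: case_prod_beta)
  then show ?thesis by (simp add: ana_def[abs_def])
qed

lemma ana_diff:
  assumes "f \<in> L2 area" "strip T f = f" "g \<in> L2 area" "strip S g = g" "x > 0"
  shows "ana (\<lambda>z. f z - g z) j x = ana f j x - ana g j x"
  unfolding ana_def using assms
  by (simp add: left_diff_distrib Bochner_Integration.integral_diff ana_integrable(1))

text \<open>Fubini applies since \<open>\<integral> |f(z) kern j x z| dz\<close> is bounded uniformly in \<open>x\<close> for \<open>f\<close> supported in a strip,
  while \<open>g\<close> is integrable.\<close>

lemma synth_ana_duality:
  assumes int: "\<And>j. j \<in> {1..n} \<Longrightarrow> integrable halfline (g j)"
    and f: "f \<in> L2 area" and T: "strip T f = f"
  shows "L2_inner area (synth n g) f = (\<Sum>j=1..n. L2_inner halfline (g j) (ana f j))"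
proof -
  let ?f = "\<lambda>j x z. g j x * (kern j x z * cnj (f z))"
  have [measurable]: "f \<in> borel_measurable area" using f by (rule L2_measurable)
  define C where "C = enn2real (sq_norm area f) + \<bar>T\<bar> / pi"
  have single: "integrable area (\<lambda>z. (LINT x|halfline. kern j x z * g j x) * cnj (f z))"
    "(LINT z|area. (LINT x|halfline. kern j x z * g j x) * cnj (f z)) = L2_inner halfline (g j) (ana f j)"
    if j: "j \<in> {1..n}" for j
  proof -
    have [measurable]: "g j \<in> borel_measurable halfline" using int[OF j] by auto
    have kint: "integrable area (\<lambda>z. kern j x z * cnj (f z))" if "x > 0" for x
    proof -
      have "integrable area (\<lambda>z. cnj (f z * cnj (kern j x z)))"
        using ana_integrable(1)[OF f T that, of j] by (rule integrable_bounded_linear[OF bounded_linear_cnj])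
      then show ?thesis by (simp add: mult.commute)
    qed
    have kbound: "(LINT z|area. cmod (kern j x z * cnj (f z))) \<le> C" if "x > 0" for x
      using ana_integrable(2)[OF f T that, of j] by (simp add: C_def norm_mult mult.commute)
    have pint: "integrable (halfline \<Otimes>\<^sub>M area) (\<lambda>(x, z). ?f j x z)"
    proof (rule halfline_area.Fubini_integrable)
      show "(\<lambda>(x, z). ?f j x z) \<in> borel_measurable (halfline \<Otimes>\<^sub>M area)"
        unfolding case_prod_beta by measurable
      show "AE x in halfline. integrable area (\<lambda>z. case (x, z) of (x, z) \<Rightarrow> ?f j x z)"
        using kint by (intro AE_I2) auto
      show "integrable halfline (\<lambda>x. LINT z|area. norm (case (x, z) of (x, z) \<Rightarrow> ?f j x z))"
      proof (rule Bochner_Integration.integrable_bound)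
        show "integrable halfline (\<lambda>x. C * cmod (g j x))" using int[OF j] by auto
        show "(\<lambda>x. LINT z|area. norm (case (x, z) of (x, z) \<Rightarrow> ?f j x z)) \<in> borel_measurable halfline"
          by (intro area.borel_measurable_lebesgue_integral) (simp add: case_prod_beta)
        show "AE x in halfline. norm (LINT z|area. norm (case (x, z) of (x, z) \<Rightarrow> ?f j x z))
            \<le> norm (C * cmod (g j x))"
        proof (rule AE_I2)
          fix x assume "x \<in> space halfline"
          then have x: "x > 0" by simp
          have "(LINT z|area. norm (?f j x z)) =
              cmod (g j x) * (LINT z|area. cmod (kern j x z * cnj (f z)))"
            by (simp only: norm_mult[of "g j x"] integral_mult_right_zero)
          also have "\<dots> \<le> cmod (g j x) * C" by (intro mult_left_mono kbound x) simp
          finally show "norm (LINT z|area. norm (case (x, z) of (x, z) \<Rightarrow> ?f j x z))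
            \<le> norm (C * cmod (g j x))"
            by (simp add: integral_nonneg_AE mult.commute)
        qed
      qed
    qed
    have in_z: "(LINT x|halfline. ?f j x z) =
        (LINT x|halfline. kern j x z * g j x) * cnj (f z)" for z
      by (simp add: mult_ac flip: integral_mult_left_zero)
    have in_x: "(LINT z|area. ?f j x z) = g j x * cnj (ana f j x)" for x
    proof -
      have "cnj (ana f j x) = (LINT z|area. kern j x z * cnj (f z))"
        unfolding ana_def Bochner_Integration.integral_cnj[symmetric] by (simp add: mult.commute)
      then show ?thesis by simp
    qed
    show "integrable area (\<lambda>z. (LINT x|halfline. kern j x z * g j x) * cnj (f z))"
      using halfline_area.integrable_snd[OF pint] by (simp add: in_z)
    show "(LINT z|area. (LINT x|halfline. kern j x z * g j x) * cnj (f z)) = L2_inner halfline (g j) (ana f j)"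
      using halfline_area.Fubini_integral[OF pint] by (simp only: in_z in_x L2_inner_def)
  qed
  have "L2_inner area (synth n g) f =
      (LINT z|area. (\<Sum>j=1..n. (LINT x|halfline. kern j x z * g j x) * cnj (f z)))"
    by (simp add: L2_inner_def synth_def sum_distrib_right)
  also have "\<dots> = (\<Sum>j=1..n. L2_inner halfline (g j) (ana f j))"
    using single by (subst Bochner_Integration.integral_sum) auto
  finally show ?thesis .
qed

text \<open>An operator and its adjoint have the same norm: testing \<open>h = ana f j\<close> against its own truncation
  \<open>g\<close> gives \<open>\<parallel>g\<parallel>\<^sup>2 = \<langle>g, h\<rangle> = \<langle>synth g, f\<rangle> \<le> (\<parallel>g\<parallel>\<^sup>2 + \<parallel>f\<parallel>\<^sup>2) / 2\<close>, and \<open>g\<close> tends to \<open>h\<close>.\<close>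

lemma ana_contraction:
  assumes f: "f \<in> L2 area" and T: "strip T f = f" and j: "j \<ge> 1"
  shows "sq_norm halfline (ana f j) \<le> sq_norm area f"
proof -
  define h where "h = ana f j"
  have [measurable]: "h \<in> borel_measurable halfline"
    unfolding h_def using f by (intro ana_measurable L2_measurable)
  have h_bound: "cmod (h x) \<le> enn2real (sq_norm area f) + \<bar>T\<bar> / pi" if "x > 0" for x
    unfolding h_def by (rule ana_bound[OF f T that])
  have cut: "sq_norm halfline (truncate k h) \<le> sq_norm area f" for k
  proof -
    \<comment> \<open>Data concentrated in the single component \<open>j\<close>.\<close>
    define g where "g i = (if i = j then truncate k h else (\<lambda>x. 0))" for i
    have g_int: "integrable halfline (g i)" for i
      unfolding g_def by (auto intro: truncate_integrable)
    have g_bd: "cmod (g i x) \<le> real k" for i x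
      unfolding g_def using truncate_bound by auto
    have gL2: "g i \<in> L2 halfline" for i
      using g_int g_bd by (rule L2_bounded_integrable)
    define a where "a = enn2real (sq_norm halfline (truncate k h))"
    have tL2: "truncate k h \<in> L2 halfline" by (rule truncate_L2) measurable
    have zero: "sq_norm M (\<lambda>x. 0) = 0" for M :: "real measure" by (simp add: sq_norm_def)
    have S: "sq_norm area (synth j g) = sq_norm halfline (truncate k h)"
    proof -
      have "sq_norm area (synth j g) = (\<Sum>i=1..j. sq_norm halfline (g i))"
        using g_int g_bd by (rule synth_isometry_bounded)
      also have "\<dots> = (\<Sum>i=1..j. if i = j then sq_norm halfline (truncate k h) else 0)"
        by (intro sum.cong) (auto simp: g_def zero)
      finally show ?thesis using j by simp
    qed
    have SL2: "synth j g \<in> L2 area" by (rule synth_L2) (rule gL2)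
    have "L2_inner area (synth j g) f = (\<Sum>i=1..j. L2_inner halfline (g i) (ana f i))"
      using g_int f T by (rule synth_ana_duality)
    also have "\<dots> = (\<Sum>i=1..j. if i = j then L2_inner halfline (truncate k h) h else 0)"
      by (intro sum.cong) (auto simp: g_def h_def L2_inner_def)
    also have "\<dots> = L2_inner halfline (truncate k h) h" using j by simp
    also have "\<dots> = L2_inner halfline (truncate k h) (truncate k h)"
      unfolding L2_inner_def by (intro Bochner_Integration.integral_cong) (auto simp: truncate_def)
    also have "\<dots> = of_real a" using L2_inner_self[OF tL2] by (simp add: a_def)
    finally have "L2_inner area (synth j g) f = of_real a" .
    moreover have "a \<ge> 0" by (simp add: a_def)
    ultimately have "a \<le> enn2real (sq_norm area f)"
      using L2_inner_weighted_bound[OF SL2 f, of 1] by (simp add: S flip: a_def)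
    then have "ennreal a \<le> ennreal (enn2real (sq_norm area f))" by (rule ennreal_leI)
    also have "ennreal (enn2real (sq_norm area f)) = sq_norm area f"
      using f by (simp add: L2_iff_sq_norm ennreal_enn2real)
    also have "ennreal a = sq_norm halfline (truncate k h)"
      using tL2 by (simp add: a_def L2_iff_sq_norm ennreal_enn2real)
    finally show ?thesis .
  qed
  have "truncate k h \<in> borel_measurable halfline" for k unfolding truncate_def by measurable
  then show ?thesis unfolding h_def[symmetric]
    by (rule sq_norm_Fatou[where f = "\<lambda>k. truncate k h"])
       (auto simp: cut intro: tendsto_eventually truncate_eventually)
qed

lemma strip_strip: "S \<le> T \<Longrightarrow> strip T (strip S f) = strip S f"
  by (auto simp: strip_def fun_eq_iff)

lemma R_trunc_eq_ana:
  assumes f: "f \<in> L2 area" and x: "x > 0"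
  shows "R_trunc T f j x = ana (strip T f) j x"
proof -
  define c where "c = complex_of_real (1 / sqrt (2 * pi))"
  have "ana (strip T f) j x = (LINT t|lborel. LINT r|halfline.
      strip T f (Complex t r) * cnj (kern j x (Complex t r)))"
    unfolding ana_def
    by (intro integral_area ana_integrable(1)[where T = T] strip_L2 f strip_strip order.refl x)
  also have "\<dots> = (LINT t|lborel. c * (indicator {-T..T} t *\<^sub>R (exp (- \<i> * of_real (x * t)) *
        (LINT r|halfline. f (Complex t r) * of_real (sqrt (2 * x) * laguerre_fun (j - 1) (2 * x * r))))))"
  proof (intro Bochner_Integration.integral_cong refl)
    fix t
    have "(LINT r|halfline. strip T f (Complex t r) * cnj (kern j x (Complex t r))) =
        (LINT r|halfline. (c * (of_real (indicator {-T..T} t) * exp (- \<i> * of_real (x * t)))) *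
          (f (Complex t r) * of_real (sqrt (2 * x) * laguerre_fun (j - 1) (2 * x * r))))"
      by (intro Bochner_Integration.integral_cong refl)
         (auto simp: strip_def kern_def c_def indicator_def exp_cnj)
    then show "(LINT r|halfline. strip T f (Complex t r) * cnj (kern j x (Complex t r))) =
      c * (indicator {-T..T} t *\<^sub>R (exp (- \<i> * of_real (x * t)) *
        (LINT r|halfline. f (Complex t r) * of_real (sqrt (2 * x) * laguerre_fun (j - 1) (2 * x * r)))))"
      by (simp only: integral_mult_right_zero scaleR_conv_of_real mult.assoc)
  qed
  also have "\<dots> = R_trunc T f j x"
    unfolding R_trunc_def set_lebesgue_integral_def integral_mult_right_zero c_def ..
  finally show ?thesis ..
qed

lemma strip_tendsto:
  assumes f: "f \<in> L2 area"
  shows "((\<lambda>T. sq_norm area (\<lambda>z. strip T f z - f z)) \<longlongrightarrow> 0) at_top"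
proof -
  let ?e = "\<lambda>T z. (cmod (strip T f z - f z))\<^sup>2"
  have [measurable]: "f \<in> borel_measurable area" using f by (rule L2_measurable)
  have fin: "sq_norm area (\<lambda>z. strip T f z - f z) = ennreal (LINT z|area. ?e T z)" for T
  proof -
    have "(\<lambda>z. strip T f z - f z) \<in> L2 area" by (intro L2_diff strip_L2 f)
    then show ?thesis using L2_integral_square[of "\<lambda>z. strip T f z - f z" area]
      by (simp add: L2_iff_sq_norm ennreal_enn2real)
  qed
  have "((\<lambda>T. LINT z|area. ?e T z) \<longlongrightarrow> (LINT z|area. 0)) at_top"
  proof (rule integral_dominated_convergence_at_top[where w = "\<lambda>z. (cmod (f z))\<^sup>2"])
    show "integrable area (\<lambda>z. (cmod (f z))\<^sup>2)" using f by (rule L2_integral_square)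
    show "\<forall>\<^sub>F T in at_top. AE z in area. norm (?e T z) \<le> (cmod (f z))\<^sup>2"
      by (intro always_eventually allI AE_I2) (auto simp: strip_def)
    show "AE z in area. ((\<lambda>T. ?e T z) \<longlongrightarrow> 0) at_top"
    proof (rule AE_I2)
      fix z
      have "\<forall>\<^sub>F T in at_top. ?e T z = 0"
        using eventually_ge_at_top[of "\<bar>Re z\<bar>"] by eventually_elim (simp add: strip_def)
      then show "((\<lambda>T. ?e T z) \<longlongrightarrow> 0) at_top" by (rule tendsto_eventually)
    qed
  qed measurable
  then have "((\<lambda>T. LINT z|area. ?e T z) \<longlongrightarrow> 0) at_top" by simp
  from tendsto_ennrealI[OF this] show ?thesis by (simp add: fin)
qed

lemma ana_strip_L2:
  assumes f: "f \<in> L2 area" and j: "j \<ge> 1"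
  shows "ana (strip T f) j \<in> L2 halfline"
proof -
  have "sq_norm halfline (ana (strip T f) j) \<le> sq_norm area (strip T f)"
    by (rule ana_contraction[OF strip_L2[OF f] strip_strip[OF order.refl] j])
  also have "\<dots> < \<infinity>" using strip_L2[OF f] by (simp add: L2_iff_sq_norm)
  finally have "sq_norm halfline (ana (strip T f) j) < \<infinity>" .
  moreover have "ana (strip T f) j \<in> borel_measurable halfline"
    using f by (intro ana_measurable L2_measurable strip_L2)
  ultimately show ?thesis by (simp add: L2_iff_sq_norm)
qed

text \<open>By the contraction property the integrals over strips form a Cauchy family, controlled by the mass
  of \<open>f\<close> outside the strip, so that completeness of \<open>L\<^sub>2\<close> provides the limit.\<close>

lemma R_op_exists:
  assumes f: "f \<in> L2 area" and j: "j \<ge> 1"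
  shows "\<exists>h. h \<in> L2 halfline \<and>
     ((\<lambda>T. \<integral>\<^sup>+ x. ennreal ((cmod (h x - R_trunc T f j x))\<^sup>2) \<partial>halfline) \<longlongrightarrow> 0) at_top"
proof -
  define \<tau> where "\<tau> T = enn2real (sq_norm area (\<lambda>z. strip T f z - f z))" for T
  have am[measurable]: "ana (strip T f) j \<in> borel_measurable halfline" for T
    using f by (intro ana_measurable L2_measurable strip_L2)
  have aL2: "ana (strip T f) j \<in> L2 halfline" for T by (rule ana_strip_L2[OF f j])
  have cauchy: "sq_norm halfline (\<lambda>x. ana (strip T f) j x - ana (strip S f) j x) \<le> ennreal (\<tau> S)"
    if ST: "S \<le> T" for S T
  proof -
    define d where "d z = strip T f z - strip S f z" for z
    have "(\<lambda>z. strip T f z - strip S f z) \<in> L2 area" by (intro L2_diff strip_L2 f)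
    then have d: "d \<in> L2 area" "strip T d = d"
      using ST by (auto simp: d_def[abs_def] strip_def fun_eq_iff)
    have "sq_norm halfline (\<lambda>x. ana (strip T f) j x - ana (strip S f) j x) = sq_norm halfline (ana d j)"
    proof (rule sq_norm_cong_AE, rule AE_I2)
      fix x assume "x \<in> space halfline"
      then show "ana (strip T f) j x - ana (strip S f) j x = ana d j x"
        unfolding d_def using f
        by (intro ana_diff[symmetric, where T = T and S = S] strip_L2 strip_strip) auto
    qed
    also have "\<dots> \<le> sq_norm area d" using d j by (rule ana_contraction)
    also have "\<dots> \<le> sq_norm area (\<lambda>z. strip S f z - f z)"
      using ST by (intro sq_norm_mono) (auto simp: d_def strip_def)
    also have "\<dots> = ennreal (\<tau> S)"
      using L2_diff[OF strip_L2[OF f, of S] f] by (simp add: \<tau>_def L2_iff_sq_norm ennreal_enn2real)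
    finally show ?thesis .
  qed
  have "((\<lambda>T. enn2real (sq_norm area (\<lambda>z. strip T f z - f z))) \<longlongrightarrow> enn2real 0) at_top"
    by (rule tendsto_enn2real) (use strip_tendsto[OF f] in auto)
  then have "(\<tau> \<longlongrightarrow> 0) at_top" by (simp add: \<tau>_def[abs_def])
  then obtain h where h: "h \<in> borel_measurable halfline"
    "((\<lambda>T. sq_norm halfline (\<lambda>x. h x - ana (strip T f) j x)) \<longlongrightarrow> 0) at_top"
    using L2_complete[of "\<lambda>T. ana (strip T f) j" halfline \<tau>, OF am cauchy] by blast
  have "\<forall>\<^sub>F T in at_top. sq_norm halfline (\<lambda>x. h x - ana (strip T f) j x) < 1"
    using h(2) by (rule order_tendstoD) simp
  then obtain T where "sq_norm halfline (\<lambda>x. h x - ana (strip T f) j x) < 1"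
    by (auto simp: eventually_at_top_linorder)
  then have "(\<lambda>x. h x - ana (strip T f) j x) \<in> L2 halfline"
    using h(1) by (auto simp: L2_iff_sq_norm intro: less_trans)
  from L2_add[OF this aL2[of T]] have "h \<in> L2 halfline" by simp
  moreover have "(\<integral>\<^sup>+ x. ennreal ((cmod (h x - R_trunc T f j x))\<^sup>2) \<partial>halfline) =
      sq_norm halfline (\<lambda>x. h x - ana (strip T f) j x)" for T
    unfolding sq_norm_def using R_trunc_eq_ana[OF f] by (intro nn_integral_cong) simp
  ultimately show ?thesis using h(2) by auto
qed

section \<open>The adjoint and the inverse of the transform\<close>

lemma R_op_spec:
  assumes f: "f \<in> L2 area" and j: "j \<in> {1..n}"
  shows "R_op n f j \<in> L2 halfline"
    and "((\<lambda>T. sq_norm halfline (\<lambda>x. ana (strip T f) j x - R_op n f j x)) \<longlongrightarrow> 0) at_top"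
proof -
  have "\<exists>g. \<forall>j\<in>{1..n}. g j \<in> L2 halfline \<and>
     ((\<lambda>T. \<integral>\<^sup>+ x. ennreal ((cmod (g j x - R_trunc T f j x))\<^sup>2) \<partial>halfline) \<longlongrightarrow> 0) at_top"
    using R_op_exists[OF f] by (intro bchoice ballI) auto
  then have "\<forall>j\<in>{1..n}. R_op n f j \<in> L2 halfline \<and>
     ((\<lambda>T. \<integral>\<^sup>+ x. ennreal ((cmod (R_op n f j x - R_trunc T f j x))\<^sup>2) \<partial>halfline) \<longlongrightarrow> 0) at_top"
    unfolding R_op_def by (rule someI_ex)
  then have R: "R_op n f j \<in> L2 halfline"
     "((\<lambda>T. \<integral>\<^sup>+ x. ennreal ((cmod (R_op n f j x - R_trunc T f j x))\<^sup>2) \<partial>halfline) \<longlongrightarrow> 0) at_top"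
    using j by blast+
  show "R_op n f j \<in> L2 halfline" by fact
  have "(\<integral>\<^sup>+ x. ennreal ((cmod (R_op n f j x - R_trunc T f j x))\<^sup>2) \<partial>halfline) =
      sq_norm halfline (\<lambda>x. ana (strip T f) j x - R_op n f j x)" for T
    unfolding sq_norm_def using R_trunc_eq_ana[OF f]
    by (intro nn_integral_cong) (simp add: norm_minus_commute)
  then show "((\<lambda>T. sq_norm halfline (\<lambda>x. ana (strip T f) j x - R_op n f j x)) \<longlongrightarrow> 0) at_top"
    using R(2) by simp
qed

text \<open>The duality on strips extends to the limit in two passages: first the strip exhausts the
  half-plane for integrable \<open>g\<close>, then \<open>g\<close> is approximated by its truncations.\<close>

lemma synth_adjoint_R_op:
  assumes g: "\<And>j. j \<in> {1..n} \<Longrightarrow> g j \<in> L2 halfline" and f: "f \<in> L2 area"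
  shows "L2_inner area (synth n g) f = (\<Sum>j=1..n. L2_inner halfline (g j) (R_op n f j))"
proof -
  have bounded: "L2_inner area (synth n h) f = (\<Sum>j=1..n. L2_inner halfline (h j) (R_op n f j))"
    if hL2: "\<And>j. j \<in> {1..n} \<Longrightarrow> h j \<in> L2 halfline"
      and int: "\<And>j. j \<in> {1..n} \<Longrightarrow> integrable halfline (h j)" for h
  proof (rule tendsto_unique[OF trivial_limit_at_top_linorder])
    have SL2: "synth n h \<in> L2 area" by (rule synth_L2) (rule hL2)
    show "((\<lambda>T. L2_inner area (synth n h) (strip T f)) \<longlongrightarrow> L2_inner area (synth n h) f) at_top"
      by (intro L2_inner_tendsto_right strip_L2 f SL2 strip_tendsto)
    have "((\<lambda>T. \<Sum>j=1..n. L2_inner halfline (h j) (ana (strip T f) j)) \<longlongrightarrow>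
        (\<Sum>j=1..n. L2_inner halfline (h j) (R_op n f j))) at_top"
      by (intro tendsto_sum L2_inner_tendsto_right ana_strip_L2 R_op_spec f hL2) auto
    also have "(\<lambda>T. \<Sum>j=1..n. L2_inner halfline (h j) (ana (strip T f) j)) =
        (\<lambda>T. L2_inner area (synth n h) (strip T f))"
      by (intro ext synth_ana_duality[symmetric, where T = "T" for T] int strip_L2 f strip_strip) auto
    finally show "((\<lambda>T. L2_inner area (synth n h) (strip T f)) \<longlongrightarrow>
        (\<Sum>j=1..n. L2_inner halfline (h j) (R_op n f j))) at_top" .
  qed
  define gk where "gk k j = truncate k (g j)" for k j
  let ?d = "\<lambda>k. \<Sum>j=1..n. sq_norm halfline (\<lambda>x. gk k j x - g j x)"
  have gm: "g j \<in> borel_measurable halfline" if "j \<in> {1..n}" for j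
    using g[OF that] by (rule L2_measurable)
  have gkL2: "gk k j \<in> L2 halfline" if "j \<in> {1..n}" for j k
    unfolding gk_def by (rule truncate_L2[OF gm[OF that]])
  have SL2: "synth n g \<in> L2 area" "synth n (gk k) \<in> L2 area" for k
    by (rule synth_L2, rule g gkL2, assumption)+
  have dist: "sq_norm area (\<lambda>z. synth n (gk k) z - synth n g z) \<le>
      ?d k" for k
  proof -
    have "sq_norm area (\<lambda>z. synth n (gk k) z - synth n g z) =
        sq_norm area (synth n (\<lambda>j x. gk k j x - g j x))"
      by (intro sq_norm_cong_AE AE_I2 synth_diff[symmetric] g gkL2) simp_all
    also have "\<dots> \<le> ?d k"
      by (intro synth_contraction L2_diff g gkL2)
    finally show ?thesis .
  qed
  have "?d \<longlonglongrightarrow> (\<Sum>j=1..n. 0)"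
    unfolding gk_def by (intro tendsto_sum truncate_tendsto g)
  then have sum0: "?d \<longlonglongrightarrow> 0" by simp
  have "(\<lambda>k. sq_norm area (\<lambda>z. synth n (gk k) z - synth n g z)) \<longlonglongrightarrow> 0"
    by (rule tendsto_sandwich[OF _ _ tendsto_const sum0]) (use dist in simp_all)
  then have "(\<lambda>k. L2_inner area (synth n (gk k)) f) \<longlonglongrightarrow> L2_inner area (synth n g) f"
    by (intro L2_inner_tendsto SL2 f)
  moreover have "(\<lambda>k. \<Sum>j=1..n. L2_inner halfline (gk k j) (R_op n f j)) \<longlonglongrightarrow>
      (\<Sum>j=1..n. L2_inner halfline (g j) (R_op n f j))"
  proof (intro tendsto_sum L2_inner_tendsto)
    fix j assume j: "j \<in> {1..n}"
    show "(\<lambda>k. sq_norm halfline (\<lambda>x. gk k j x - g j x)) \<longlonglongrightarrow> 0"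
      unfolding gk_def by (rule truncate_tendsto[OF g[OF j]])
  qed (use gkL2 g R_op_spec(1)[OF f] in auto)
  moreover have "L2_inner area (synth n (gk k)) f = (\<Sum>j=1..n. L2_inner halfline (gk k j) (R_op n f j))" for k
  proof (rule bounded)
    fix j assume j: "j \<in> {1..n}"
    show "gk k j \<in> L2 halfline" by (rule gkL2[OF j])
    show "integrable halfline (gk k j)" unfolding gk_def by (rule truncate_integrable[OF gm[OF j]])
  qed
  ultimately show ?thesis using LIMSEQ_unique by auto
qed

text \<open>The choice of \<open>R_adj n g\<close> is determined by its inner products up to null sets: the difference of
  two candidates is orthogonal to itself.\<close>

lemma R_adj_eq_synth:
  assumes g: "\<And>j. j \<in> {1..n} \<Longrightarrow> g j \<in> L2 halfline"
  shows "AE z in area. R_adj n g z = synth n g z"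
proof -
  have SL2: "synth n g \<in> L2 area" by (rule synth_L2) (rule g)
  have ad: "L2_inner area (synth n g) \<psi> = (\<Sum>j=1..n. L2_inner halfline (g j) (R_op n \<psi> j))"
    if "\<psi> \<in> L2 area" for \<psi> using g that by (rule synth_adjoint_R_op)
  then have "\<exists>f. f \<in> L2 area \<and>
     (\<forall>\<psi>\<in>L2 area. L2_inner area f \<psi> = (\<Sum>j=1..n. L2_inner halfline (g j) (R_op n \<psi> j)))"
    using SL2 by blast
  then have R: "R_adj n g \<in> L2 area \<and>
     (\<forall>\<psi>\<in>L2 area. L2_inner area (R_adj n g) \<psi> = (\<Sum>j=1..n. L2_inner halfline (g j) (R_op n \<psi> j)))"
    unfolding R_adj_def by (rule someI_ex)
  define d where "d = (\<lambda>z. R_adj n g z - synth n g z)"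
  have d: "d \<in> L2 area" unfolding d_def using R SL2 by (intro L2_diff) auto
  have "L2_inner area d d = L2_inner area (R_adj n g) d - L2_inner area (synth n g) d"
    using R SL2 d by (subst d_def, intro L2_inner_diff_left) auto
  also have "\<dots> = 0" using R d ad[OF d] by simp
  finally have "enn2real (sq_norm area d) = 0" using L2_inner_self[OF d] by simp
  then have "sq_norm area d = 0"
    using d by (auto simp: L2_iff_sq_norm enn2real_eq_0_iff)
  then have "AE z in area. d z = 0" using d by (intro sq_norm_zero_imp_AE L2_measurable)
  then show ?thesis by eventually_elim (simp add: d_def)
qed

text \<open>With \<open>f = synth n h\<close> and \<open>r = R f\<close>, the adjoint relation gives \<open>\<langle>h, r\<rangle> = \<parallel>f\<parallel>\<^sup>2 = \<parallel>h\<parallel>\<^sup>2\<close>, and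
  \<open>\<parallel>r\<parallel>\<^sup>2 = \<langle>synth n r, f\<rangle> \<le> (\<parallel>r\<parallel>\<^sup>2 + \<parallel>h\<parallel>\<^sup>2) / 2\<close>. Therefore \<open>\<parallel>r - h\<parallel>\<^sup>2 = \<parallel>r\<parallel>\<^sup>2 - \<parallel>h\<parallel>\<^sup>2 \<le> 0\<close>.\<close>

lemma R_op_synth:
  assumes int: "\<And>j. j \<in> {1..n} \<Longrightarrow> integrable halfline (h j)"
    and bd: "\<And>j x. j \<in> {1..n} \<Longrightarrow> x > 0 \<Longrightarrow> cmod (h j x) \<le> B"
    and j: "j \<in> {1..n}"
  shows "AE x in halfline. R_op n (synth n h) j x = h j x"
proof -
  have h: "h j \<in> L2 halfline" if "j \<in> {1..n}" for j
    using int[OF that] bd[OF that] by (intro L2_bounded_integrable) auto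
  define f where "f = synth n h"
  have f: "f \<in> L2 area" unfolding f_def by (rule synth_L2) (rule h)
  define r where "r = R_op n f"
  let ?d = "\<lambda>j. enn2real (sq_norm halfline (\<lambda>x. r j x - h j x))"
  have r: "r j \<in> L2 halfline" if "j \<in> {1..n}" for j
    unfolding r_def using f that by (rule R_op_spec)
  have fin: "(\<Sum>j=1..n. sq_norm halfline (g j)) = ennreal (\<Sum>j=1..n. enn2real (sq_norm halfline (g j)))"
    if "\<And>j. j \<in> {1..n} \<Longrightarrow> g j \<in> L2 halfline" for g
  proof -
    have "(\<Sum>j=1..n. sq_norm halfline (g j)) = (\<Sum>j=1..n. ennreal (enn2real (sq_norm halfline (g j))))"
      using that by (intro sum.cong refl) (simp add: L2_iff_sq_norm ennreal_enn2real)
    also have "\<dots> = ennreal (\<Sum>j=1..n. enn2real (sq_norm halfline (g j)))"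
      by (rule sum_ennreal) simp
    finally show ?thesis .
  qed
  define a b where "a = (\<Sum>j=1..n. enn2real (sq_norm halfline (r j)))"
    and "b = (\<Sum>j=1..n. enn2real (sq_norm halfline (h j)))"
  have nn: "a \<ge> 0" "b \<ge> 0" by (auto simp: a_def b_def intro: sum_nonneg)
  have "sq_norm area f = (\<Sum>j=1..n. sq_norm halfline (h j))"
    unfolding f_def using int bd by (rule synth_isometry_bounded)
  also have "\<dots> = ennreal b"
    unfolding b_def using h by (rule fin)
  finally have fb: "enn2real (sq_norm area f) = b" using nn by simp
  have "(\<Sum>j=1..n. L2_inner halfline (h j) (r j)) = L2_inner area f f"
    using synth_adjoint_R_op[OF h f] by (simp add: r_def f_def)
  then have hr: "(\<Sum>j=1..n. L2_inner halfline (h j) (r j)) = of_real b"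
    using L2_inner_self[OF f] fb by simp
  have "(\<Sum>j=1..n. L2_inner halfline (r j) (h j)) = cnj (\<Sum>j=1..n. L2_inner halfline (h j) (r j))"
    unfolding cnj_sum by (intro sum.cong refl L2_inner_commute)
  then have rh: "(\<Sum>j=1..n. L2_inner halfline (r j) (h j)) = of_real b"
    unfolding hr complex_cnj_complex_of_real .
  have rr: "(\<Sum>j=1..n. L2_inner halfline (r j) (r j)) = of_real a"
    using r by (simp add: L2_inner_self a_def)
  have hh: "(\<Sum>j=1..n. L2_inner halfline (h j) (h j)) = of_real b"
    using h by (simp add: L2_inner_self b_def)
  have "a \<le> b"
  proof -
    have SL2: "synth n r \<in> L2 area" by (rule synth_L2) (rule r)
    have "sq_norm area (synth n r) \<le> (\<Sum>j=1..n. sq_norm halfline (r j))"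
      by (rule synth_contraction) (rule r)
    also have "\<dots> = ennreal a"
      unfolding a_def using r by (rule fin)
    finally have "enn2real (sq_norm area (synth n r)) \<le> a" using nn by (intro enn2real_leI) auto
    moreover have "L2_inner area (synth n r) f = of_real a"
      using synth_adjoint_R_op[OF r f] rr by (simp add: r_def)
    then have "2 * a \<le> enn2real (sq_norm area (synth n r)) + b"
      using L2_inner_weighted_bound[OF SL2 f, of 1] fb nn by simp
    ultimately show "a \<le> b" by simp
  qed
  have "complex_of_real (\<Sum>j=1..n. ?d j) =
      (\<Sum>j=1..n. L2_inner halfline (\<lambda>x. r j x - h j x) (\<lambda>x. r j x - h j x))"
    using r h by (simp add: L2_inner_self L2_diff)
  also have "\<dots> = (\<Sum>j=1..n. L2_inner halfline (r j) (r j) - L2_inner halfline (h j) (r j) -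
      (L2_inner halfline (r j) (h j) - L2_inner halfline (h j) (h j)))"
    using r h by (intro sum.cong refl) (simp add: L2_inner_diff_left L2_inner_diff_right L2_diff)
  also have "\<dots> = of_real (a - b)"
    unfolding sum_subtractf hr rh rr hh by simp
  finally have "(\<Sum>j=1..n. ?d j) = a - b"
    by (simp only: of_real_eq_iff)
  then have "(\<Sum>j=1..n. ?d j) = 0"
    using \<open>a \<le> b\<close> by (intro antisym sum_nonneg) auto
  then have "?d j = 0"
    using j by (subst (asm) sum_nonneg_eq_0_iff) auto
  moreover have rhL2: "(\<lambda>x. r j x - h j x) \<in> L2 halfline" using r[OF j] h[OF j] by (rule L2_diff)
  ultimately have "sq_norm halfline (\<lambda>x. r j x - h j x) = 0"
    by (auto simp: L2_iff_sq_norm enn2real_eq_0_iff)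
  then have "AE x in halfline. r j x - h j x = 0"
    using rhL2 by (intro sq_norm_zero_imp_AE L2_measurable)
  then show ?thesis by eventually_elim (simp add: r_def f_def)
qed

section \<open>The symbol\<close>

lemma gamma_sym_nonneg: "t > 0 \<Longrightarrow> gamma_sym n k t \<ge> 0"
  by (simp add: gamma_sym_def)

text \<open>The first \<open>n - 1\<close> terms are differences of consecutive powers of \<open>e\<^sup>-\<^sup>2\<^sup>t\<close>; the sum telescopes, and the
  last term is what is missing to \<open>1\<close>. This makes the rank one matrix \<open>P_gamma\<close> a projection.\<close>

lemma sum_gamma_sym:
  assumes "n \<ge> 1"
  shows "(\<Sum>k=1..n. gamma_sym n k t) = 1"
proof -
  obtain m where n: "n = Suc m" using assms by (cases n) auto
  have "(\<Sum>k=1..i. exp (- 2 * real k * t) * (exp (2 * t) - 1)) = 1 - exp (- 2 * real i * t)" for i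
    by (induction i) (simp_all add: algebra_simps flip: exp_add)
  then have "(\<Sum>k=1..m. gamma_sym n k t) = 1 - exp (- 2 * real m * t)"
    by (simp add: gamma_sym_def n)
  then show ?thesis by (simp add: n gamma_sym_def)
qed

lemma P_gamma_bound:
  assumes "t > 0" "j \<in> {1..n}" "k \<in> {1..n}"
  shows "0 \<le> P_gamma n t j k" "P_gamma n t j k \<le> 1"
proof -
  have n: "n \<ge> 1" using assms by auto
  have "gamma_sym n i t \<le> 1" if "i \<in> {1..n}" for i
    unfolding sum_gamma_sym[OF n, of t, symmetric] using that gamma_sym_nonneg[OF assms(1)]
    by (intro member_le_sum) auto
  then have "sqrt (gamma_sym n i t) \<le> 1" if "i \<in> {1..n}" for i using that by simp
  then show "P_gamma n t j k \<le> 1"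
    unfolding P_gamma_def using assms gamma_sym_nonneg[OF assms(1)] by (intro mult_le_one) auto
  show "0 \<le> P_gamma n t j k"
    unfolding P_gamma_def using gamma_sym_nonneg[OF assms(1)] by simp
qed

lemma P_gamma_idempotent:
  assumes n: "n \<ge> 1" and t: "t > 0"
  shows "(\<Sum>k=1..n. P_gamma n t j k * P_gamma n t k l) = P_gamma n t j l"
proof -
  have "(\<Sum>k=1..n. P_gamma n t j k * P_gamma n t k l) =
      P_gamma n t j l * (\<Sum>k=1..n. gamma_sym n k t)"
    unfolding sum_distrib_left
  proof (intro sum.cong refl)
    fix k
    have "sqrt (gamma_sym n k t) * sqrt (gamma_sym n k t) = gamma_sym n k t"
      using gamma_sym_nonneg[OF t] by simp
    then show "P_gamma n t j k * P_gamma n t k l = P_gamma n t j l * gamma_sym n k t"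
      unfolding P_gamma_def by (metis mult.assoc mult.commute)
  qed
  then show ?thesis using sum_gamma_sym[OF n] by simp
qed

lemma P_gamma_commute: "P_gamma n t j k = P_gamma n t k j"
  by (simp add: P_gamma_def mult.commute)

lemma P_gamma_mult_idempotent:
  assumes n: "n \<ge> 1" and t: "t > 0"
  shows "P_gamma_mult n (P_gamma_mult n g) j t = P_gamma_mult n g j t"
proof -
  have "P_gamma_mult n (P_gamma_mult n g) j t =
      (\<Sum>l=1..n. \<Sum>k=1..n. of_real (P_gamma n t j k * P_gamma n t k l) * g l t)"
    unfolding P_gamma_mult_def sum_distrib_left by (subst sum.swap) (simp add: mult.assoc)
  also have "\<dots> = (\<Sum>l=1..n. of_real (\<Sum>k=1..n. P_gamma n t j k * P_gamma n t k l) * g l t)"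
    by (simp add: sum_distrib_right)
  also have "\<dots> = P_gamma_mult n g j t"
    unfolding P_gamma_idempotent[OF n t] P_gamma_mult_def ..
  finally show ?thesis .
qed

lemma P_gamma_mult_self_adjoint:
  "(\<Sum>j=1..n. g j t * P_gamma_mult n h j t) = (\<Sum>j=1..n. P_gamma_mult n g j t * h j t)"
proof -
  have "(\<Sum>j=1..n. g j t * P_gamma_mult n h j t) =
      (\<Sum>j=1..n. \<Sum>k=1..n. of_real (P_gamma n t j k) * (g j t * h k t))"
    unfolding P_gamma_mult_def sum_distrib_left by (simp add: mult_ac)
  also have "\<dots> = (\<Sum>k=1..n. \<Sum>j=1..n. of_real (P_gamma n t k j) * (g j t * h k t))"
    by (subst sum.swap) (simp only: P_gamma_commute)
  also have "\<dots> = (\<Sum>j=1..n. P_gamma_mult n g j t * h j t)"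
    unfolding P_gamma_mult_def sum_distrib_right by (simp add: mult_ac)
  finally show ?thesis .
qed

lemma P_gamma_mult_L2:
  assumes g: "\<And>k. k \<in> {1..n} \<Longrightarrow> g k \<in> L2 halfline" and j: "j \<in> {1..n}"
  shows "P_gamma_mult n g j \<in> L2 halfline"
proof -
  have "(\<lambda>t. of_real (P_gamma n t j k) * g k t) \<in> L2 halfline" if k: "k \<in> {1..n}" for k
  proof (rule L2_bounded_mult[OF g[OF k], where C = 1])
    show "(\<lambda>t. complex_of_real (P_gamma n t j k)) \<in> borel_measurable halfline"
      unfolding P_gamma_def gamma_sym_def by (intro borel_measurable_halflineI) measurable
    fix t assume "t \<in> space halfline"
    then show "cmod (of_real (P_gamma n t j k)) \<le> 1"
      using P_gamma_bound[of t j n k] j k by simp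
  qed
  then show ?thesis unfolding P_gamma_mult_def[abs_def] by (rule L2_sum)
qed

section \<open>The reproducing kernel\<close>

text \<open>The data from which \<open>synth\<close> produces the kernel section at \<open>w\<close>. Without the projection, it
  would produce the kernel section of the range of \<open>synth n\<close>.\<close>

definition repr :: "nat \<Rightarrow> complex \<Rightarrow> nat \<Rightarrow> real \<Rightarrow> complex" where
  "repr n w = P_gamma_mult n (\<lambda>k t. cnj (kern k t w))"

lemma repr_L2:
  "w \<in> upper_halfplane \<Longrightarrow> j \<in> {1..n} \<Longrightarrow> repr n w j \<in> L2 halfline"
  unfolding repr_def by (intro P_gamma_mult_L2 L2_cnj kern_L2)

lemma repr_bounded_integrable:
  assumes w: "w \<in> upper_halfplane"
  obtains B where "\<And>j. j \<in> {1..n} \<Longrightarrow> integrable halfline (repr n w j)"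
    "\<And>j x. j \<in> {1..n} \<Longrightarrow> x > 0 \<Longrightarrow> cmod (repr n w j x) \<le> B"
proof -
  have "\<exists>C\<ge>0. \<forall>x>0. cmod (kern k x w) \<le> C * exp (- (Im w / 4 * x))" for k
    using kern_bound[OF w] by metis
  then obtain C where C: "\<And>k. C k \<ge> 0"
    "\<And>k x. x > 0 \<Longrightarrow> cmod (kern k x w) \<le> C k * exp (- (Im w / 4 * x))" by metis
  define B where "B = (\<Sum>k=1..n. C k)"
  have w0: "Im w / 4 > 0" using w by (simp add: upper_halfplane_def)
  have B0: "B \<ge> 0" unfolding B_def by (intro sum_nonneg C)
  have decay: "cmod (repr n w j x) \<le> B * exp (- (Im w / 4 * x))" if j: "j \<in> {1..n}" and x: "x > 0" for j x
  proof -
    have "cmod (repr n w j x) \<le> (\<Sum>k=1..n. cmod (of_real (P_gamma n x j k) * cnj (kern k x w)))"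
      unfolding repr_def P_gamma_mult_def by (rule norm_sum)
    also have "\<dots> \<le> (\<Sum>k=1..n. 1 * (C k * exp (- (Im w / 4 * x))))"
      unfolding norm_mult complex_mod_cnj norm_of_real
      using P_gamma_bound[OF x j] C x by (intro sum_mono mult_mono) auto
    finally show ?thesis by (simp add: B_def sum_distrib_right)
  qed
  show thesis
  proof
    show "integrable halfline (repr n w j)" if "j \<in> {1..n}" for j
      by (rule L2_exp_decay(2)[OF L2_measurable[OF repr_L2[OF w that]] w0 decay[OF that]])
    fix j x assume j: "j \<in> {1..n}" and x: "(x::real) > 0"
    have "B * exp (- (Im w / 4 * x)) \<le> B * 1" using B0 w0 x by (intro mult_left_mono) auto
    then show "cmod (repr n w j x) \<le> B" using decay[OF j x] by simp
  qed
qed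

lemma synth_cong_AE:
  assumes g: "\<And>j. j \<in> {1..n} \<Longrightarrow> g j \<in> L2 halfline" and h: "\<And>j. j \<in> {1..n} \<Longrightarrow> h j \<in> L2 halfline"
    and eq: "\<And>j. j \<in> {1..n} \<Longrightarrow> AE x in halfline. g j x = h j x" and z: "z \<in> upper_halfplane"
  shows "synth n g z = synth n h z"
  unfolding synth_def
proof (intro sum.cong refl integral_cong_AE)
  fix j assume j: "j \<in> {1..n}"
  show "(\<lambda>x. kern j x z * g j x) \<in> borel_measurable halfline"
    "(\<lambda>x. kern j x z * h j x) \<in> borel_measurable halfline"
    using kern_mult_integrable[OF z g[OF j]] kern_mult_integrable[OF z h[OF j]] by auto
  show "AE x in halfline. kern j x z * g j x = kern j x z * h j x"
    using eq[OF j] by eventually_elim simp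
qed

lemma P_op_eq_synth:
  assumes "f \<in> L2 area"
  shows "AE z in area. P_op n f z = synth n (P_gamma_mult n (R_op n f)) z"
  unfolding P_op_def by (intro R_adj_eq_synth P_gamma_mult_L2 R_op_spec(1) assms)

text \<open>Point values of elements of the image: almost everywhere they agree with a function of the form
  \<open>synth n g\<close>, and both functions are continuous.\<close>

lemma image_P_representation:
  assumes n: "n \<ge> 1" and f: "f \<in> image_P n"
  obtains g where "\<And>j. j \<in> {1..n} \<Longrightarrow> g j \<in> L2 halfline"
    "\<And>j t. t > 0 \<Longrightarrow> P_gamma_mult n g j t = g j t"
    "\<And>z. z \<in> upper_halfplane \<Longrightarrow> f z = synth n g z"
proof -
  obtain \<phi> where \<phi>: "\<phi> \<in> poly_bergman n" "AE z in area. f z = P_op n \<phi> z" and fp: "f \<in> poly_bergman n"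
    using f by (auto simp: image_P_def)
  have \<phi>L2: "\<phi> \<in> L2 area" using \<phi> by (simp add: poly_bergman_def)
  define g where "g = P_gamma_mult n (R_op n \<phi>)"
  have g: "g j \<in> L2 halfline" if "j \<in> {1..n}" for j
    unfolding g_def by (intro P_gamma_mult_L2 R_op_spec(1) \<phi>L2 that)
  have gP: "P_gamma_mult n g j t = g j t" if "t > 0" for j t
    unfolding g_def by (rule P_gamma_mult_idempotent[OF n that])
  have "AE z in area. f z = synth n g z"
    using \<phi>(2) P_op_eq_synth[OF \<phi>L2, of n] unfolding g_def by eventually_elim simp
  moreover have "C_diff_on n upper_halfplane f" using fp by (simp add: poly_bergman_def)
  then have "continuous_on upper_halfplane f"
    by (cases n) (auto intro!: continuous_at_imp_continuous_on differentiable_imp_continuous_within)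
  moreover have "continuous_on upper_halfplane (synth n g)"
    by (intro polyanalytic_continuous_on[of n] synth_polyanalytic g)
  ultimately have "f z = synth n g z" if "z \<in> upper_halfplane" for z
    using continuous_AE_eq_imp_eq that by blast
  then show thesis using that g gP by blast
qed

text \<open>The data \<open>repr n w\<close> are bounded and integrable, hence recovered by the transform, and they are fixed
  by the projection; so the projection maps the kernel section to itself.\<close>

lemma synth_repr_in_image_P:
  assumes n: "n \<ge> 1" and w: "w \<in> upper_halfplane"
    and f: "\<And>z. z \<in> upper_halfplane \<Longrightarrow> f z = synth n (repr n w) z"
  shows "f \<in> image_P n"
proof -
  let ?R = "R_op n (synth n (repr n w))"
  define S where "S = synth n (repr n w)"
  have rL2: "repr n w j \<in> L2 halfline" if "j \<in> {1..n}" for j using repr_L2[OF w that] .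
  have SL2: "S \<in> L2 area" unfolding S_def by (rule synth_L2) (rule rL2)
  have Spoly: "polyanalytic n S" unfolding S_def by (rule synth_polyanalytic) (rule rL2)
  obtain B where B: "\<And>j. j \<in> {1..n} \<Longrightarrow> integrable halfline (repr n w j)"
    "\<And>j x. j \<in> {1..n} \<Longrightarrow> x > 0 \<Longrightarrow> cmod (repr n w j x) \<le> B"
    using repr_bounded_integrable[OF w] by blast
  have fS: "f z = S z" if "z \<in> upper_halfplane" for z using f[OF that] by (simp add: S_def)
  have "f \<in> L2 area"
  proof -
    have "f \<in> borel_measurable area"
      using L2_measurable[OF SL2] fS by (subst measurable_cong[of area f S]) auto
    moreover have "sq_norm area f = sq_norm area S"
      by (intro sq_norm_cong_AE AE_I2) (simp add: fS)
    ultimately show ?thesis using SL2 by (simp add: L2_iff_sq_norm)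
  qed
  then have "f \<in> poly_bergman n"
    using polyanalytic_cong[OF Spoly] fS by (intro polyanalytic_imp_poly_bergman) auto
  moreover have "S \<in> poly_bergman n" using Spoly SL2 by (rule polyanalytic_imp_poly_bergman)
  moreover have "AE z in area. f z = P_op n S z"
  proof -
    have R: "AE x in halfline. R_op n S j x = repr n w j x" if "j \<in> {1..n}" for j
      unfolding S_def using B that by (rule R_op_synth)
    have "synth n (P_gamma_mult n (R_op n S)) z = S z" if z: "z \<in> upper_halfplane" for z
      unfolding S_def
    proof (rule synth_cong_AE)
      fix j assume j: "j \<in> {1..n}"
      show "P_gamma_mult n (?R) j \<in> L2 halfline"
        using SL2 unfolding S_def by (intro P_gamma_mult_L2 R_op_spec(1) j)
      show "repr n w j \<in> L2 halfline" by (rule rL2[OF j])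
      have "AE x in halfline. \<forall>k\<in>{1..n}. ?R k x = repr n w k x"
        using R unfolding S_def by (intro AE_finite_allI) auto
      then have "AE x in halfline. P_gamma_mult n (?R) j x =
          P_gamma_mult n (repr n w) j x"
        by eventually_elim (simp add: P_gamma_mult_def)
      moreover have "AE x in halfline. P_gamma_mult n (repr n w) j x = repr n w j x"
        unfolding repr_def by (rule AE_I2) (simp add: P_gamma_mult_idempotent[OF n])
      ultimately show "AE x in halfline. P_gamma_mult n (?R) j x = repr n w j x"
        by eventually_elim simp
    qed (rule z)
    then have "AE z in area. f z = synth n (P_gamma_mult n (R_op n S)) z"
      using fS by (intro AE_I2) simp
    then show ?thesis using P_op_eq_synth[OF SL2, of n] by eventually_elim simp
  qed
  ultimately show ?thesis unfolding image_P_def by blast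
qed

text \<open>For \<open>f = synth n g\<close> with \<open>P g = g\<close> and \<open>k\<close> the vector of the conjugates of \<open>kern j x w\<close>,
  \<open>f(w) = \<langle>g, k\<rangle> = \<langle>P g, k\<rangle> = \<langle>g, P k\<rangle> = \<langle>g, R (synth n (P k))\<rangle> = \<langle>f, synth n (P k)\<rangle>\<close>.\<close>

lemma image_P_reproducing:
  assumes n: "n \<ge> 1" and f: "f \<in> image_P n" and w: "w \<in> upper_halfplane"
  shows "f w = L2_inner area f (synth n (repr n w))"
proof -
  let ?S = "synth n (repr n w)"
  obtain g where g: "\<And>j. j \<in> {1..n} \<Longrightarrow> g j \<in> L2 halfline"
    and gP: "\<And>j t. t > 0 \<Longrightarrow> P_gamma_mult n g j t = g j t"
    and fg: "\<And>z. z \<in> upper_halfplane \<Longrightarrow> f z = synth n g z"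
    using image_P_representation[OF n f] by blast
  have rL2: "repr n w j \<in> L2 halfline" if "j \<in> {1..n}" for j using repr_L2[OF w that] .
  have SL2: "?S \<in> L2 area" by (rule synth_L2) (rule rL2)
  obtain B where B: "\<And>j. j \<in> {1..n} \<Longrightarrow> integrable halfline (repr n w j)"
    "\<And>j x. j \<in> {1..n} \<Longrightarrow> x > 0 \<Longrightarrow> cmod (repr n w j x) \<le> B"
    using repr_bounded_integrable[OF w] by blast
  have "L2_inner area f (?S) = L2_inner area (synth n g) (?S)"
    unfolding L2_inner_def using fg by (intro Bochner_Integration.integral_cong) auto
  also have "\<dots> = (\<Sum>j=1..n. L2_inner halfline (g j) (R_op n (?S) j))"
    using g SL2 by (rule synth_adjoint_R_op)
  also have "\<dots> = (\<Sum>j=1..n. L2_inner halfline (g j) (repr n w j))"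
    unfolding L2_inner_def
  proof (intro sum.cong refl integral_cong_AE)
    fix j assume j: "j \<in> {1..n}"
    show "(\<lambda>x. g j x * cnj (R_op n (?S) j x)) \<in> borel_measurable halfline"
      using L2_inner_integrable[OF g[OF j] R_op_spec(1)[OF SL2 j]] by auto
    show "(\<lambda>x. g j x * cnj (repr n w j x)) \<in> borel_measurable halfline"
      using L2_inner_integrable[OF g[OF j] rL2[OF j]] by auto
    show "AE x in halfline. g j x * cnj (R_op n (?S) j x) = g j x * cnj (repr n w j x)"
    proof -
      have "AE x in halfline. R_op n (?S) j x = repr n w j x"
        using B j by (rule R_op_synth)
      then show ?thesis by eventually_elim simp
    qed
  qed
  also have "\<dots> = (LINT x|halfline. (\<Sum>j=1..n. g j x * cnj (repr n w j x)))"
    unfolding L2_inner_def using g rL2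
    by (intro Bochner_Integration.integral_sum[symmetric] L2_inner_integrable)
  also have "\<dots> = (LINT x|halfline. (\<Sum>j=1..n. kern j x w * g j x))"
  proof (intro Bochner_Integration.integral_cong refl)
    fix x assume "x \<in> space halfline"
    then have x: "x > 0" by simp
    have "cnj (repr n w j x) = P_gamma_mult n (\<lambda>k t. kern k t w) j x" for j
      by (simp add: repr_def P_gamma_mult_def)
    then have "(\<Sum>j=1..n. g j x * cnj (repr n w j x)) =
        (\<Sum>j=1..n. P_gamma_mult n g j x * kern j x w)"
      by (simp only: P_gamma_mult_self_adjoint)
    then show "(\<Sum>j=1..n. g j x * cnj (repr n w j x)) = (\<Sum>j=1..n. kern j x w * g j x)"
      by (simp add: gP[OF x] mult.commute)
  qed
  also have "\<dots> = synth n g w"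
    unfolding synth_def using g w
    by (intro Bochner_Integration.integral_sum kern_mult_integrable)
  finally show ?thesis using fg[OF w] by simp
qed

text \<open>Reproducing each section of one kernel with the other shows that \<open>K(z, w)\<close> is the conjugate of
  \<open>L(w, z)\<close>; the same with \<open>L\<close> in place of \<open>K\<close> shows that \<open>L\<close> is Hermitian.\<close>

lemma reproducing_kernel_unique:
  assumes K: "is_reproducing_kernel M H K" and L: "is_reproducing_kernel M H L"
    and "z \<in> space M" "w \<in> space M"
  shows "K z w = L z w"
proof -
  have sym: "A z w = cnj (B w z)"
    if "is_reproducing_kernel M H A" "is_reproducing_kernel M H B" "z \<in> space M" "w \<in> space M" for A B z w
  proof -
    have "A z w = L2_inner M (\<lambda>v. A v w) (\<lambda>v. B v z)"
      using that by (auto simp: is_reproducing_kernel_def)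
    moreover have "B w z = L2_inner M (\<lambda>v. B v z) (\<lambda>v. A v w)"
      using that by (auto simp: is_reproducing_kernel_def)
    ultimately show ?thesis by (metis L2_inner_commute)
  qed
  show ?thesis using sym[OF K L] sym[OF L L] assms(3,4) by metis
qed

lemma sqrt_exp: "sqrt (exp (2 * a)) = exp (a :: real)"
  by (rule real_sqrt_unique) (simp_all add: power2_eq_square flip: exp_add)

text \<open>For \<open>j < n\<close> the root of \<open>gamma_sym n j t\<close> is \<open>e\<^sup>-\<^sup>(\<^sup>j\<^sup>-\<^sup>1\<^sup>)\<^sup>t\<close> times \<open>sqrt (1 - e\<^sup>-\<^sup>2\<^sup>t) = 1 + phi_root t\<close>, while in
  the last term that factor is missing. Splitting off \<open>phi_root t\<close> gives \<open>phi_sum n\<close> plus a multiple of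
  \<open>phi_sum (n - 1)\<close>.\<close>

lemma sum_sqrt_gamma_laguerre:
  assumes n: "n \<ge> 1" and t: "t > 0"
  shows "(\<Sum>j=1..n. sqrt (gamma_sym n j t) * laguerre_fun (j - 1) (2 * t * y)) =
    phi_sum n t y + phi_root t * phi_sum (n - 1) t y"
proof -
  obtain m where m: "n = Suc m" using n by (cases n) auto
  have low: "sqrt (gamma_sym n j t) = exp (- (real j - 1) * t) * sqrt (1 - exp (- 2 * t))"
    if "j \<in> {1..m}" for j
  proof -
    have "gamma_sym n j t = exp (2 * (- (real j - 1) * t)) * (1 - exp (- 2 * t))"
      using that by (simp add: gamma_sym_def m algebra_simps flip: exp_add)
    then show ?thesis by (simp only: real_sqrt_mult sqrt_exp)
  qed
  have top: "sqrt (gamma_sym n n t) = exp (- (real n - 1) * t)"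
    using sqrt_exp[of "- (real n - 1) * t"] by (simp add: gamma_sym_def algebra_simps)
  have "(\<Sum>j=1..n. sqrt (gamma_sym n j t) * laguerre_fun (j - 1) (2 * t * y)) =
      (\<Sum>j=1..m. sqrt (gamma_sym n j t) * laguerre_fun (j - 1) (2 * t * y)) +
      sqrt (gamma_sym n n t) * laguerre_fun (n - 1) (2 * t * y)"
    by (simp add: m)
  also have "(\<Sum>j=1..m. sqrt (gamma_sym n j t) * laguerre_fun (j - 1) (2 * t * y)) =
      sqrt (1 - exp (- 2 * t)) * phi_sum m t y"
    unfolding phi_sum_def sum_distrib_left by (intro sum.cong refl) (simp add: low mult_ac)
  also have "sqrt (1 - exp (- 2 * t)) = 1 + phi_root t" by (simp add: phi_root_def)
  finally show ?thesis unfolding top by (simp add: m phi_sum_def algebra_simps)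
qed

text \<open>The matrix is the rank one matrix built from the vector \<open>(1, phi_root t)\<close>.\<close>

lemma phi_matrix_eq:
  "(vector [phi_sum n t y, phi_sum (n - 1) t y] :: real ^ 2) \<bullet>
     ((vector [vector [1, phi_root t], vector [phi_root t, (phi_root t)\<^sup>2]] :: real ^ 2 ^ 2) *v
      (vector [phi_sum n t v, phi_sum (n - 1) t v] :: real ^ 2)) =
   (phi_sum n t y + phi_root t * phi_sum (n - 1) t y) * (phi_sum n t v + phi_root t * phi_sum (n - 1) t v)"
  by (simp add: inner_vec_def matrix_vector_mult_def sum_2 vector_2 algebra_simps power2_eq_square)

lemma synth_repr_eq:
  assumes n: "n \<ge> 1" and y: "y > 0" and v: "v > 0"
  shows "synth n (repr n (Complex u v)) (Complex x y) = of_real (1 / pi) *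
    (LINT t:{0<..}|lborel. exp (\<i> * of_real (t * (x - u))) * of_real (t *
      ((phi_sum n t y + phi_root t * phi_sum (n - 1) t y) *
       (phi_sum n t v + phi_root t * phi_sum (n - 1) t v))))"
proof -
  define z w where "z = Complex x y" and "w = Complex u v"
  have zw: "z \<in> upper_halfplane" "w \<in> upper_halfplane"
    using y v by (auto simp: z_def w_def upper_halfplane_def)
  define F where "F t = exp (\<i> * of_real (t * (x - u))) * of_real (t *
      ((phi_sum n t y + phi_root t * phi_sum (n - 1) t y) *
       (phi_sum n t v + phi_root t * phi_sum (n - 1) t v)))" for t
  have "synth n (repr n w) z = (LINT t|halfline. (\<Sum>j=1..n. kern j t z * repr n w j t))"
    unfolding synth_def using repr_L2[OF zw(2)] zw(1)
    by (intro Bochner_Integration.integral_sum[symmetric] kern_mult_integrable)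
  also have "\<dots> = (LINT t|halfline. of_real (1 / pi) * F t)"
  proof (intro Bochner_Integration.integral_cong refl)
    fix t assume "t \<in> space halfline"
    then have t: "t > 0" by simp
    define q where "q r = (\<Sum>j=1..n. sqrt (gamma_sym n j t) * laguerre_fun (j - 1) (2 * t * r))" for r
    define c where "c = sqrt (2 * t) / sqrt (2 * pi)"
    have c2: "c * c = t / pi" using t by (simp add: c_def)
    have kern_eq: "kern j t (Complex a r) = of_real (c * laguerre_fun (j - 1) (2 * t * r)) * iexp (t * a)" for j a r
      by (simp add: kern_def c_def)
    have e: "iexp (t * x) * cnj (iexp (t * u)) = exp (\<i> * of_real (t * (x - u)))"
      by (simp add: exp_cnj algebra_simps flip: exp_add)
    have "(\<Sum>j=1..n. kern j t z * repr n w j t) =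
        (\<Sum>j=1..n. \<Sum>k=1..n. of_real ((c * c) *
          ((sqrt (gamma_sym n j t) * laguerre_fun (j - 1) (2 * t * y)) *
           (sqrt (gamma_sym n k t) * laguerre_fun (k - 1) (2 * t * v)))) *
          (iexp (t * x) * cnj (iexp (t * u))))"
      unfolding repr_def P_gamma_mult_def sum_distrib_left z_def w_def kern_eq P_gamma_def
      by (simp add: mult_ac)
    also have "\<dots> = of_real ((c * c) * (q y * q v)) * (iexp (t * x) * cnj (iexp (t * u)))"
      unfolding q_def sum_product sum_distrib_left of_real_sum sum_distrib_right
      by (rule sum.swap)
    also have "\<dots> = of_real (1 / pi) * F t"
      unfolding e c2 q_def sum_sqrt_gamma_laguerre[OF n t] F_def by simp
    finally show "(\<Sum>j=1..n. kern j t z * repr n w j t) = of_real (1 / pi) * F t" .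
  qed
  also have "\<dots> = of_real (1 / pi) * (LINT t|halfline. F t)" by (rule integral_mult_right_zero)
  also have "(LINT t|halfline. F t) = (LINT t:{0<..}|lborel. F t)"
    unfolding halfline_def set_lebesgue_integral_def by (subst integral_restrict_space) auto
  finally show ?thesis unfolding F_def z_def w_def .
qed

lemma reproducing_kernel_image_P_iff:
  assumes n: "n \<ge> 1"
  shows "is_reproducing_kernel area (image_P n) K \<longleftrightarrow>
    (\<forall>z\<in>upper_halfplane. \<forall>w\<in>upper_halfplane. K z w = synth n (repr n w) z)"
proof -
  have ok: "is_reproducing_kernel area (image_P n) K"
    if K: "\<forall>z\<in>upper_halfplane. \<forall>w\<in>upper_halfplane. K z w = synth n (repr n w) z" for K
    unfolding is_reproducing_kernel_def space_area
  proof (intro conjI ballI)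
    fix z assume z: "z \<in> upper_halfplane"
    show "(\<lambda>w. K w z) \<in> image_P n" using K z by (intro synth_repr_in_image_P[OF n z]) auto
    fix f assume f: "f \<in> image_P n"
    have "L2_inner area f (\<lambda>w. K w z) = L2_inner area f (synth n (repr n z))"
      unfolding L2_inner_def using K z by (intro Bochner_Integration.integral_cong) auto
    then show "f z = L2_inner area f (\<lambda>w. K w z)" using image_P_reproducing[OF n f z] by simp
  qed
  then have "is_reproducing_kernel area (image_P n) (\<lambda>z w. synth n (repr n w) z)" by simp
  from reproducing_kernel_unique[OF _ this] show ?thesis using ok by auto
qed

theorem theorem10:
  fixes n :: nat and K :: "complex \<Rightarrow> complex \<Rightarrow> complex"
  assumes "n \<ge> 1"
  shows "is_reproducing_kernel area (image_P n) K \<longleftrightarrow>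
    (\<forall>x y u v. y > 0 \<longrightarrow> v > 0 \<longrightarrow>
      K (Complex x y) (Complex u v) = of_real (1 / pi) *
        (LINT t:{0<..}|lborel. exp (\<i> * of_real (t * (x - u))) * of_real (t *
          ((vector [phi_sum n t y, phi_sum (n - 1) t y] :: real ^ 2) \<bullet>
           ((vector [vector [1, phi_root t], vector [phi_root t, (phi_root t)\<^sup>2]] :: real ^ 2 ^ 2) *v
            (vector [phi_sum n t v, phi_sum (n - 1) t v] :: real ^ 2))))))"
proof -
  have "(\<forall>z\<in>upper_halfplane. \<forall>w\<in>upper_halfplane. K z w = synth n (repr n w) z) \<longleftrightarrow>
    (\<forall>x y u v. y > 0 \<longrightarrow> v > 0 \<longrightarrow>
      K (Complex x y) (Complex u v) = synth n (repr n (Complex u v)) (Complex x y))"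
    unfolding upper_halfplane_def by (metis complex.collapse complex.sel mem_Collect_eq)
  then show ?thesis
    unfolding reproducing_kernel_image_P_iff[OF assms]
    by (rule trans) (intro iff_allI imp_cong refl, simp only: synth_repr_eq[OF assms] phi_matrix_eq)
qed

end
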